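(* Let $\mathfrak{D}$ be a polynomial deriver. Then the problem $\mathsf{MP}^{\mathsf{poly}}_{\mathsf{binary}}(\mathfrak{D})$ is in NP. Let $\mathfrak{D}$ be an exponential deriver. Then $\mathsf{MP}^{\mathsf{exp}}_{\mathsf{binary}}(\mathfrak{D})$ is in NExpTime.
   Context: A logic $\mathcal{L}=(S_{\mathcal{L}},\models)$ consists of a set $S_{\mathcal{L}}$ of sentences, each with a size $|\alpha|$, and a model-based consequence relation ($\mathcal{T}\models\alpha$ iff every model of $\mathcal{T}$ is a model of $\alpha$). A hypergraph is $H=(V,E,\ell)$ with finite vertex set $V$, hyperedges $(S,d)$ with $S\subseteq V$, $d\in V$, and labelling $\ell:V\to S_{\mathcal{L}}$; its size is $|H|=\sum_{(S,d)\in E}(|\ell(d)|+\sum_{v\in S}|\ell(v)|)$. A leaf is a vertex with no incoming hyperedge $(S,v)$; a sink is a vertex occurring in no $S$ of a hyperedge. A derivation structure over a finite theory $\mathcal{T}$ is a hypergraph whose leaves are labelled by elements of $\mathcal{T}$ and with $\{\ell(s)\mid s\in S\}\models\ell(d)$ for each hyperedge $(S,d)$; substructures are obtained by taking subsets of vertices and hyperedges with restricted labelling that are again derivation structures. Paths $d_0,(S_1,d_1),d_1,\dots,(S_q,d_q),d_q$ ($q\ge1$, $d_{j-1}\in S_j$) and cycles (paths with $d_0=d_q$) are as usual. A proof for $\mathcal{T}\models\eta$ is an acyclic derivation structure over $\mathcal{T}$ with exactly one sink, labelled $\eta$. A homomorphism between hypergraphs maps vertices to vertices, preserving labels and mapping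 hyperedges $(S,d)$ to hyperedges $(h(S),h(d))$. A deriver $\mathfrak{D}$ consists of $C_{\mathcal{L}}\subseteq S_{\mathcal{L}}$ and a function mapping each finite theory $\mathcal{T}$ and $\eta\in C_{\mathcal{L}}$ to a derivation structure $\mathfrak{D}(\mathcal{T},\eta)$ over $\mathcal{T}$ such that $\mathcal{T}\models\eta$ iff $\mathfrak{D}(\mathcal{T},\eta)$ contains a proof for $\mathcal{T}\models\eta$. It is polynomial (exponential) if for some polynomial $p$, $|\mathfrak{D}(\mathcal{T},\eta)|\le p(|\mathcal{T}|+|\eta|)$ (resp. $\le 2^{p(|\mathcal{T}|+|\eta|)}$). A proof $P$ is admissible w.r.t. $\mathfrak{D}(\mathcal{T},\eta)$ if there is a homomorphism $P\to\mathfrak{D}(\mathcal{T},\eta)$. For a proof $P=(V,E,\ell)$ let $\mathrm{ct}(P)=|V|$. $\mathsf{MP}(\mathfrak{D})$ is the problem: given a finite theory $\mathcal{T}$, $\eta\in C_{\mathcal{L}}$ and $n\in\mathbb{N}$, decide whether there is a proof $P$ for $\mathcal{T}\models\eta$, admissible w.r.t. $\mathfrak{D}(\mathcal{T},\eta)$, with $\mathrm{ct}(P)\le n$. The superscript $\mathsf{poly}$/$\mathsf{exp}$ indicates that $\mathfrak{D}$ is a polynomial/exponential deriver; the subscript $\mathsf{binary}$ indicates that $n$ is encoded in binary. For complexity upper bounds, the derivation structure $\mathfrak{D}(\mathcal{T},\eta)$ is accessed as follows: its vertices are numbered $v_1,\dots,v_m$ (indices written in binary), and there are unit-cost oracles deciding,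 for given vertices $v_1,\dots,v_l$, whether $(\{v_1,\dots,v_{l-1}\},v_l)$ is a hyperedge, and, for a vertex $v$ and sentence $\alpha$, whether $\ell(v)=\alpha$.
   Formalization: Sentence sizes are assumed positive, and the binary index of each vertex occurring in a hyperedge of D(T,η) is assumed to have polynomial (resp. exponential) length in |T|+|η|; as |H| ignores isolated vertices, the claim fails for numberings that place too many isolated vertices first. *)

theory Defs
  imports "HOL-Computational_Algebra.Polynomial"
begin

section \<open>Logics\<close>

text \<open>
  The set of sentences is the type \<open>'s\<close>; a logic is given by a satisfaction relation
  \<open>sat m \<alpha>\<close> between models \<open>m\<close> and sentences, and a size function \<open>sz\<close> on sentences.
\<close>

definition entails :: "('m \<Rightarrow> 's \<Rightarrow> bool) \<Rightarrow> 's set \<Rightarrow> 's \<Rightarrow> bool" where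
  "entails sat T \<alpha> \<longleftrightarrow> (\<forall>m. (\<forall>\<beta>\<in>T. sat m \<beta>) \<longrightarrow> sat m \<alpha>)"

definition theory_size :: "('s \<Rightarrow> nat) \<Rightarrow> 's set \<Rightarrow> nat" where
  "theory_size sz T = (\<Sum>\<alpha>\<in>T. sz \<alpha>)"


section \<open>Hypergraphs, derivation structures and proofs\<close>

text \<open>Only the values of \<open>lab\<close> on \<open>verts\<close> are relevant.\<close>

record ('v, 's) hypergraph =
  verts :: "'v set"
  hedges :: "('v set \<times> 'v) set"
  lab :: "'v \<Rightarrow> 's"

definition hypergraph :: "('v, 's) hypergraph \<Rightarrow> bool" where
  "hypergraph H \<longleftrightarrow>
     finite (verts H) \<and> (\<forall>(S, d)\<in>hedges H. S \<subseteq> verts H \<and> d \<in> verts H)"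

definition hypergraph_size :: "('s \<Rightarrow> nat) \<Rightarrow> ('v, 's) hypergraph \<Rightarrow> nat" where
  "hypergraph_size sz H = (\<Sum>(S, d)\<in>hedges H. sz (lab H d) + (\<Sum>v\<in>S. sz (lab H v)))"

definition leaf :: "('v, 's) hypergraph \<Rightarrow> 'v \<Rightarrow> bool" where
  "leaf H v \<longleftrightarrow> v \<in> verts H \<and> (\<nexists>S. (S, v) \<in> hedges H)"

definition sink :: "('v, 's) hypergraph \<Rightarrow> 'v \<Rightarrow> bool" where
  "sink H v \<longleftrightarrow> v \<in> verts H \<and> (\<nexists>S d. (S, d) \<in> hedges H \<and> v \<in> S)"

definition derivation_structure ::
    "('m \<Rightarrow> 's \<Rightarrow> bool) \<Rightarrow> 's set \<Rightarrow> ('v, 's) hypergraph \<Rightarrow> bool" where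
  "derivation_structure sat T H \<longleftrightarrow>
     hypergraph H \<and>
     (\<forall>v. leaf H v \<longrightarrow> lab H v \<in> T) \<and>
     (\<forall>(S, d)\<in>hedges H. entails sat (lab H ` S) (lab H d))"

definition substructure ::
    "('m \<Rightarrow> 's \<Rightarrow> bool) \<Rightarrow> 's set \<Rightarrow> ('v, 's) hypergraph \<Rightarrow> ('v, 's) hypergraph \<Rightarrow> bool" where
  "substructure sat T H' H \<longleftrightarrow>
     verts H' \<subseteq> verts H \<and> hedges H' \<subseteq> hedges H \<and>
     (\<forall>v\<in>verts H'. lab H' v = lab H v) \<and> derivation_structure sat T H'"

text \<open>
  \<open>hpath H d\<^sub>0 [(S\<^sub>1, d\<^sub>1), \<dots>, (S\<^sub>q, d\<^sub>q)]\<close> says that \<open>d\<^sub>0, (S\<^sub>1, d\<^sub>1), d\<^sub>1, \<dots>, (S\<^sub>q, d\<^sub>q), d\<^sub>q\<close> runs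
  along hyperedges of \<open>H\<close> with \<open>d\<^sub>j\<^sub>-\<^sub>1 \<in> S\<^sub>j\<close>; the condition \<open>q \<ge> 1\<close> is imposed separately.
\<close>

primrec hpath :: "('v, 's) hypergraph \<Rightarrow> 'v \<Rightarrow> ('v set \<times> 'v) list \<Rightarrow> bool" where
  "hpath H d [] \<longleftrightarrow> True"
| "hpath H d (e # es) \<longleftrightarrow> e \<in> hedges H \<and> d \<in> fst e \<and> hpath H (snd e) es"

definition acyclic_hypergraph :: "('v, 's) hypergraph \<Rightarrow> bool" where
  "acyclic_hypergraph H \<longleftrightarrow>
     (\<nexists>d es. es \<noteq> [] \<and> hpath H d es \<and> snd (last es) = d)"

definition is_proof ::
    "('m \<Rightarrow> 's \<Rightarrow> bool) \<Rightarrow> 's set \<Rightarrow> 's \<Rightarrow> ('v, 's) hypergraph \<Rightarrow> bool" where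
  "is_proof sat T \<eta> P \<longleftrightarrow>
     derivation_structure sat T P \<and> acyclic_hypergraph P \<and>
     (\<exists>v. {u. sink P u} = {v} \<and> lab P v = \<eta>)"

definition homomorphism ::
    "('u \<Rightarrow> 'v) \<Rightarrow> ('u, 's) hypergraph \<Rightarrow> ('v, 's) hypergraph \<Rightarrow> bool" where
  "homomorphism h P H \<longleftrightarrow>
     h ` verts P \<subseteq> verts H \<and>
     (\<forall>v\<in>verts P. lab H (h v) = lab P v) \<and>
     (\<forall>(S, d)\<in>hedges P. (h ` S, h d) \<in> hedges H)"

definition admissible :: "('u, 's) hypergraph \<Rightarrow> ('v, 's) hypergraph \<Rightarrow> bool" where
  "admissible P H \<longleftrightarrow> (\<exists>h. homomorphism h P H)"


section \<open>Derivers\<close>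

definition deriver ::
    "('m \<Rightarrow> 's \<Rightarrow> bool) \<Rightarrow> 's set \<Rightarrow> ('s set \<Rightarrow> 's \<Rightarrow> ('v, 's) hypergraph) \<Rightarrow> bool" where
  "deriver sat C D \<longleftrightarrow>
     (\<forall>T \<eta>. finite T \<and> \<eta> \<in> C \<longrightarrow>
        derivation_structure sat T (D T \<eta>) \<and>
        (entails sat T \<eta> \<longleftrightarrow>
           (\<exists>P. substructure sat T P (D T \<eta>) \<and> is_proof sat T \<eta> P)))"

definition polynomial_deriver ::
    "('m \<Rightarrow> 's \<Rightarrow> bool) \<Rightarrow> ('s \<Rightarrow> nat) \<Rightarrow> 's set \<Rightarrow>
     ('s set \<Rightarrow> 's \<Rightarrow> ('v, 's) hypergraph) \<Rightarrow> bool" where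
  "polynomial_deriver sat sz C D \<longleftrightarrow>
     deriver sat C D \<and>
     (\<exists>p :: nat poly. \<forall>T \<eta>. finite T \<and> \<eta> \<in> C \<longrightarrow>
        hypergraph_size sz (D T \<eta>) \<le> poly p (theory_size sz T + sz \<eta>))"

definition exponential_deriver ::
    "('m \<Rightarrow> 's \<Rightarrow> bool) \<Rightarrow> ('s \<Rightarrow> nat) \<Rightarrow> 's set \<Rightarrow>
     ('s set \<Rightarrow> 's \<Rightarrow> ('v, 's) hypergraph) \<Rightarrow> bool" where
  "exponential_deriver sat sz C D \<longleftrightarrow>
     deriver sat C D \<and>
     (\<exists>p :: nat poly. \<forall>T \<eta>. finite T \<and> \<eta> \<in> C \<longrightarrow>
        hypergraph_size sz (D T \<eta>) \<le> 2 ^ poly p (theory_size sz T + sz \<eta>))"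


section \<open>Nondeterministic multi-tape oracle Turing machines\<close>

text \<open>
  States and tape symbols are natural numbers; symbol 0 is the blank. Tapes are infinite in both
  directions. Tape 0 initially holds the input, tape 1 is the oracle query tape. In the state
  \<open>query\<close> the machine asks whether the nonblank word starting in cell 0 of tape 1 belongs to the
  oracle set and moves, in one step, to \<open>yes_state\<close> or \<open>no_state\<close>. A configuration without
  successor is halting; it is rejecting unless its state is \<open>accept\<close>.
\<close>

datatype move = GoLeft | Stay | GoRight

type_synonym tape = "(int \<Rightarrow> nat) \<times> int"

record ntm =
  tape_count :: nat
  start :: nat
  accept :: nat
  query :: nat
  yes_state :: nat
  no_state :: nat
  delta :: "(nat \<times> nat list \<times> nat \<times> (nat \<times> move) list) set"

definition ntm :: "ntm \<Rightarrow> bool" where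
  "ntm M \<longleftrightarrow>
     2 \<le> tape_count M \<and> finite (delta M) \<and>
     (\<forall>(q, rs, q', as)\<in>delta M.
        q \<noteq> accept M \<and> q \<noteq> query M \<and>
        length rs = tape_count M \<and> length as = tape_count M) \<and>
     accept M \<noteq> query M"

definition tape_read :: "tape \<Rightarrow> nat" where
  "tape_read t = fst t (snd t)"

primrec offset :: "move \<Rightarrow> int" where
  "offset GoLeft = -1"
| "offset Stay = 0"
| "offset GoRight = 1"

definition tape_act :: "nat \<times> move \<Rightarrow> tape \<Rightarrow> tape" where
  "tape_act a t = ((fst t)(snd t := fst a), snd t + offset (snd a))"

definition tape_word :: "tape \<Rightarrow> nat list" where
  "tape_word t = map (\<lambda>i. fst t (int i)) [0..<(LEAST i. fst t (int i) = 0)]"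

inductive ntm_step :: "ntm \<Rightarrow> nat list set \<Rightarrow> nat \<times> tape list \<Rightarrow> nat \<times> tape list \<Rightarrow> bool"
  for M :: ntm and X :: "nat list set" where
  step_move: "(q, map tape_read ts, q', as) \<in> delta M \<Longrightarrow>
     ntm_step M X (q, ts) (q', map2 tape_act as ts)"
| step_query: "ntm_step M X (query M, ts)
     (if tape_word (ts ! 1) \<in> X then yes_state M else no_state M, ts)"

definition input_tape :: "nat list \<Rightarrow> tape" where
  "input_tape w = ((\<lambda>i. if 0 \<le> i \<and> nat i < length w then w ! nat i else 0), 0)"

definition init_config :: "ntm \<Rightarrow> nat list \<Rightarrow> nat \<times> tape list" where
  "init_config M w =
     (start M, input_tape w # replicate (tape_count M - 1) ((\<lambda>_. 0), 0))"

definition accepts :: "ntm \<Rightarrow> nat list set \<Rightarrow> nat list \<Rightarrow> bool" where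
  "accepts M X w \<longleftrightarrow> (\<exists>c. (ntm_step M X)\<^sup>*\<^sup>* (init_config M w) c \<and> fst c = accept M)"

definition all_runs_halt_within :: "ntm \<Rightarrow> nat list set \<Rightarrow> nat list \<Rightarrow> nat \<Rightarrow> bool" where
  "all_runs_halt_within M X w t \<longleftrightarrow>
     (\<forall>k c. (ntm_step M X ^^ k) (init_config M w) c \<longrightarrow> k \<le> t)"


section \<open>NP and NExpTime for problems with oracle access\<close>

text \<open>
  Every instance comes with its own oracle set; a single machine has to work for all instances.
  The behaviour of the machine on words that do not encode an instance is unconstrained.
\<close>

record 'i problem =
  instances :: "'i set"
  encode :: "'i \<Rightarrow> nat list"
  oracle_of :: "'i \<Rightarrow> nat list set"
  positive :: "'i set"

definition decides_in_time :: "ntm \<Rightarrow> 'i problem \<Rightarrow> (nat \<Rightarrow> nat) \<Rightarrow> bool" where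
  "decides_in_time M R t \<longleftrightarrow>
     (\<forall>x\<in>instances R.
        all_runs_halt_within M (oracle_of R x) (encode R x) (t (length (encode R x))) \<and>
        (accepts M (oracle_of R x) (encode R x) \<longleftrightarrow> x \<in> positive R))"

definition NP :: "'i problem set" where
  "NP = {R. \<exists>M (p :: nat poly). ntm M \<and> decides_in_time M R (\<lambda>n. poly p n)}"

definition NExpTime :: "'i problem set" where
  "NExpTime = {R. \<exists>M (p :: nat poly). ntm M \<and> decides_in_time M R (\<lambda>n. 2 ^ poly p n)}"


section \<open>Encodings and oracle access to derivation structures\<close>

text \<open>Binary representation without leading zeros, least significant bit first.\<close>

fun bin :: "nat \<Rightarrow> bool list" where
  "bin n = (if n = 0 then [] else odd n # bin (n div 2))"

declare bin.simps [simp del]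

definition bits :: "bool list \<Rightarrow> nat list" where
  "bits w = map (\<lambda>b. if b then 2 else 1) w"

text \<open>
  Sentences are written as bit strings. Encodings may be longer than the size of the sentence,
  but not so succinct that the size is not polynomially bounded in their length.
\<close>

definition sentence_encoding :: "('s \<Rightarrow> nat) \<Rightarrow> ('s \<Rightarrow> bool list) \<Rightarrow> bool" where
  "sentence_encoding sz enc \<longleftrightarrow>
     inj enc \<and> (\<exists>p :: nat poly. \<forall>\<alpha>. sz \<alpha> \<le> poly p (length (enc \<alpha>)))"

definition encode_instance :: "('s \<Rightarrow> bool list) \<Rightarrow> 's list \<times> 's \<times> nat \<Rightarrow> nat list" where
  "encode_instance enc =
     (\<lambda>(\<alpha>s, \<eta>, n).
        concat (map (\<lambda>\<alpha>. bits (enc \<alpha>) @ [3]) \<alpha>s) @ [4] @ bits (enc \<eta>) @ [4] @ bits (bin n))"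

definition hedge_query :: "nat list \<Rightarrow> nat list" where
  "hedge_query is = 3 # concat (map (\<lambda>i. bits (bin i) @ [3]) is)"

definition label_query :: "('s \<Rightarrow> bool list) \<Rightarrow> nat \<Rightarrow> 's \<Rightarrow> nat list" where
  "label_query enc i \<alpha> = 4 # bits (bin i) @ [3] @ bits (enc \<alpha>)"

text \<open>
  The queries about \<open>H\<close> that are answered positively: is \<open>({v\<^sub>1, \<dots>, v\<^sub>l\<^sub>-\<^sub>1}, v\<^sub>l)\<close> a hyperedge, and is
  \<open>\<alpha>\<close> the label of \<open>v\<close>? Here \<open>num\<close> assigns to each vertex its index.
\<close>

definition structure_oracle ::
    "('s \<Rightarrow> bool list) \<Rightarrow> ('v \<Rightarrow> nat) \<Rightarrow> ('v, 's) hypergraph \<Rightarrow> nat list set" where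
  "structure_oracle enc num H =
     {hedge_query (map num (vs @ [d])) | vs d. (set vs, d) \<in> hedges H} \<union>
     {label_query enc (num v) (lab H v) | v. v \<in> verts H}"

definition vertex_numbering ::
    "'s set \<Rightarrow> ('s set \<Rightarrow> 's \<Rightarrow> ('v, 's) hypergraph) \<Rightarrow> ('s set \<Rightarrow> 's \<Rightarrow> 'v \<Rightarrow> nat) \<Rightarrow> bool" where
  "vertex_numbering C D num \<longleftrightarrow>
     (\<forall>T \<eta>. finite T \<and> \<eta> \<in> C \<longrightarrow>
        bij_betw (num T \<eta>) (verts (D T \<eta>)) {1..card (verts (D T \<eta>))})"

text \<open>
  The size of a hypergraph does not count isolated vertices, so even a polynomial deriver may
  produce structures with so many isolated vertices that the binary index of some other vertex
  is too long to be written on a query tape at all. The following conditions exclude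
  such numberings. They constrain only the indices of vertices that occur in a hyperedge, hence
  can always be met by numbering the isolated vertices last, and hold for every numbering if
  there are no isolated vertices (see the lemmas below).
\<close>

definition hedge_verts :: "('v, 's) hypergraph \<Rightarrow> 'v set" where
  "hedge_verts H = (\<Union>(S, d)\<in>hedges H. insert d S)"

definition indices_bounded ::
    "('s \<Rightarrow> nat) \<Rightarrow> 's set \<Rightarrow> ('s set \<Rightarrow> 's \<Rightarrow> ('v, 's) hypergraph) \<Rightarrow>
     ('s set \<Rightarrow> 's \<Rightarrow> 'v \<Rightarrow> nat) \<Rightarrow> (nat \<Rightarrow> nat) \<Rightarrow> bool" where
  "indices_bounded sz C D num f \<longleftrightarrow>
     (\<forall>T \<eta>. finite T \<and> \<eta> \<in> C \<longrightarrow>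
        (\<forall>v\<in>hedge_verts (D T \<eta>).
           length (bin (num T \<eta> v)) \<le> f (theory_size sz T + sz \<eta>)))"

definition polynomial_indices ::
    "('s \<Rightarrow> nat) \<Rightarrow> 's set \<Rightarrow> ('s set \<Rightarrow> 's \<Rightarrow> ('v, 's) hypergraph) \<Rightarrow>
     ('s set \<Rightarrow> 's \<Rightarrow> 'v \<Rightarrow> nat) \<Rightarrow> bool" where
  "polynomial_indices sz C D num \<longleftrightarrow>
     (\<exists>p :: nat poly. indices_bounded sz C D num (\<lambda>n. poly p n))"

definition exponential_indices ::
    "('s \<Rightarrow> nat) \<Rightarrow> 's set \<Rightarrow> ('s set \<Rightarrow> 's \<Rightarrow> ('v, 's) hypergraph) \<Rightarrow>
     ('s set \<Rightarrow> 's \<Rightarrow> 'v \<Rightarrow> nat) \<Rightarrow> bool" where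
  "exponential_indices sz C D num \<longleftrightarrow>
     (\<exists>p :: nat poly. indices_bounded sz C D num (\<lambda>n. 2 ^ poly p n))"

lemma length_bin_le: "length (bin n) \<le> n"
proof (induction n rule: less_induct)
  case (less n)
  show ?case
  proof (cases "n = 0")
    case True
    then show ?thesis by (subst bin.simps) (simp only: simp_thms if_True list.size)
  next
    case False
    then have "length (bin (n div 2)) \<le> n div 2" using less by simp
    moreover have "length (bin n) = Suc (length (bin (n div 2)))"
      using False by (subst bin.simps) simp
    moreover have "Suc (n div 2) \<le> n" using False by linarith
    ultimately show ?thesis by linarith
  qed
qed

lemma card_hedge_verts_le:
  assumes H: "hypergraph H" and sz: "\<And>\<alpha>. 0 < sz \<alpha>"
  shows "card (hedge_verts H) \<le> hypergraph_size sz H"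
proof -
  have sub: "hedges H \<subseteq> Pow (verts H) \<times> verts H" and fv: "finite (verts H)"
    using H by (auto simp: hypergraph_def)
  then have fe: "finite (hedges H)"
    by (meson finite_Pow_iff finite_SigmaI finite_subset)
  have "card (hedge_verts H) \<le> (\<Sum>e\<in>hedges H. card (insert (snd e) (fst e)))"
    unfolding hedge_verts_def case_prod_beta using fe by (rule card_UN_le)
  also have "\<dots> \<le> (\<Sum>e\<in>hedges H. sz (lab H (snd e)) + (\<Sum>v\<in>fst e. sz (lab H v)))"
  proof (rule sum_mono)
    fix e assume "e \<in> hedges H"
    then have "finite (fst e)" using sub fv by (metis PowD finite_subset mem_Times_iff subsetD)
    then have "card (insert (snd e) (fst e)) \<le> 1 + card (fst e)"
      by (simp add: card_insert_if)
    also have "card (fst e) = (\<Sum>v\<in>fst e. 1)" by simp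
    also have "1 + (\<Sum>v\<in>fst e. 1) \<le> sz (lab H (snd e)) + (\<Sum>v\<in>fst e. sz (lab H v))"
      by (intro add_mono sum_mono) (simp_all add: Suc_leI sz)
    finally show "card (insert (snd e) (fst e))
      \<le> sz (lab H (snd e)) + (\<Sum>v\<in>fst e. sz (lab H v))" by simp
  qed
  finally show ?thesis by (simp add: hypergraph_size_def case_prod_beta)
qed

text \<open>
  Numberings that list the vertices of hyperedges first satisfy the index condition. In
  particular this holds for every numbering if no vertex is isolated.
\<close>

lemma indices_bounded_if_hedge_verts_first:
  assumes D: "deriver sat C D" and sz: "\<And>\<alpha>. 0 < sz \<alpha>"
    and size: "\<And>T \<eta>. finite T \<Longrightarrow> \<eta> \<in> C \<Longrightarrow>
      hypergraph_size sz (D T \<eta>) \<le> f (theory_size sz T + sz \<eta>)"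
    and first: "\<And>T \<eta> v. finite T \<Longrightarrow> \<eta> \<in> C \<Longrightarrow> v \<in> hedge_verts (D T \<eta>) \<Longrightarrow>
      num T \<eta> v \<le> card (hedge_verts (D T \<eta>))"
  shows "indices_bounded sz C D num f"
  unfolding indices_bounded_def
proof (intro allI impI ballI, elim conjE)
  fix T \<eta> v
  assume *: "finite T" "\<eta> \<in> C" "v \<in> hedge_verts (D T \<eta>)"
  have "hypergraph (D T \<eta>)"
    using D * by (auto simp: deriver_def derivation_structure_def)
  then show "length (bin (num T \<eta> v)) \<le> f (theory_size sz T + sz \<eta>)"
    using length_bin_le[of "num T \<eta> v"] first[OF *] size[OF *(1,2)]
      card_hedge_verts_le[of "D T \<eta>" sz] sz by (meson le_trans)
qed

lemma indices_bounded_if_no_isolated: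
  assumes D: "deriver sat C D" and sz: "\<And>\<alpha>. 0 < sz \<alpha>"
    and size: "\<And>T \<eta>. finite T \<Longrightarrow> \<eta> \<in> C \<Longrightarrow>
      hypergraph_size sz (D T \<eta>) \<le> f (theory_size sz T + sz \<eta>)"
    and num: "vertex_numbering C D num"
    and no_isolated: "\<And>T \<eta>. finite T \<Longrightarrow> \<eta> \<in> C \<Longrightarrow> hedge_verts (D T \<eta>) = verts (D T \<eta>)"
  shows "indices_bounded sz C D num f"
proof (rule indices_bounded_if_hedge_verts_first[OF D sz size])
  fix T \<eta> v assume *: "finite T" "\<eta> \<in> C" "v \<in> hedge_verts (D T \<eta>)"
  have bij: "bij_betw (num T \<eta>) (verts (D T \<eta>)) {1..card (verts (D T \<eta>))}"
    using num *(1,2) by (simp add: vertex_numbering_def)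
  have "v \<in> verts (D T \<eta>)" using *(3) no_isolated[OF *(1,2)] by simp
  then have "num T \<eta> v \<in> {1..card (verts (D T \<eta>))}" by (rule bij_betw_apply[OF bij])
  then show "num T \<eta> v \<le> card (hedge_verts (D T \<eta>))" using no_isolated[OF *(1,2)] by simp
qed


section \<open>The problem of finding small admissible proofs\<close>

text \<open>
  The input theory is given as a list without repetitions, the bound \<open>n\<close> in binary. As finite
  hypergraphs can be renamed, proofs with vertices in \<^typ>\<open>nat\<close> cover all proofs.
\<close>

definition MP_binary ::
    "('m \<Rightarrow> 's \<Rightarrow> bool) \<Rightarrow> 's set \<Rightarrow> ('s set \<Rightarrow> 's \<Rightarrow> ('v, 's) hypergraph) \<Rightarrow>
     ('s \<Rightarrow> bool list) \<Rightarrow> ('s set \<Rightarrow> 's \<Rightarrow> 'v \<Rightarrow> nat) \<Rightarrow> ('s list \<times> 's \<times> nat) problem" where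
  "MP_binary sat C D enc num =
     \<lparr>instances = {(\<alpha>s, \<eta>, n). distinct \<alpha>s \<and> \<eta> \<in> C},
      encode = encode_instance enc,
      oracle_of = (\<lambda>(\<alpha>s, \<eta>, n). structure_oracle enc (num (set \<alpha>s) \<eta>) (D (set \<alpha>s) \<eta>)),
      positive = {(\<alpha>s, \<eta>, n). \<exists>P :: (nat, 's) hypergraph.
        is_proof sat (set \<alpha>s) \<eta> P \<and> admissible P (D (set \<alpha>s) \<eta>) \<and> card (verts P) \<le> n}\<rparr>"

end

theory Submission
  imports Defs "HOL-Library.Countable"
begin

text \<open>
  Listing the vertices of an admissible proof in topological order and identifying vertices with
  the same image in the derivation structure yields a list of distinct vertices of the structure,
  each of which is labelled by an element of the theory or is the target of a hyperedge from earlier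
  vertices. Conversely, the positions of any such list that are needed for the goal form an
  admissible proof. Hence a nondeterministic machine can guess this list, verify every entry by a
  single query, and count down the binary number \<open>n\<close>; by distinctness, only lists that
  are at most as long as the derivation structure is large need to be guessed. Goals contained in
  the theory are treated separately, because they may label only isolated vertices, whose indices
  can be too long for the query tape.

  In order to bound all runs, including those that guess badly, the machine first computes in a
  deterministic way a unary clock of length \<open>N\<^sup>k\<close> or at least \<open>2\<close> to the power of \<open>N\<^sup>k\<close>, where
  \<open>N\<close> is the length of the input, and then consumes one cell of the clock with every move.
\<close>

section \<open>Tapes as zippers\<close>

text \<open>The guessing loops can write bits forever, which is why a clock is needed at all. A
  query changes no tape and so cannot consume a clock cell; but no query directly follows another,
  so \<open>c\<close> cells still bound the checking phase by 2 * c steps. Expiry of the clock means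
  rejection: soundness holds for every budget, and only completeness has to count. Guesses are never
  validated syntactically. A positive answer already certifies that a word is the index of a vertex
  and that the copied indices form the tail of a hyperedge, and a list with repetitions still yields
  a proof because proof vertices are list positions. If \<open>U\<close> bounds the input length,
  the size of the structure and the indices, at most \<open>U\<close> rounds of cost O(U^2) are
  needed, whence a clock of at least 64 * U ^ 3 cells. The exponent \<open>k\<close> that achieves
  this is built into the states, as it depends on deriver, numbering and encoding but not on the
  instance. The end marker sits in cell -1 because query words have to start in cell 0.\<close>

text \<open>
  Cell \<open>-1\<close> of every tape will hold the end marker 5, hence the shift by one:
  \<open>tp l r\<close> is the tape with inscription \<open>rev l @ r\<close> from cell \<open>-1\<close> on and the head on the first
  symbol of \<open>r\<close>.
\<close>

definition tp :: "nat list \<Rightarrow> nat list \<Rightarrow> tape" where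
  "tp l r = ((\<lambda>i. if i < -1 \<or> length (rev l @ r) \<le> nat (i + 1) then 0 else (rev l @ r) ! nat (i + 1)),
     int (length l) - 1)"

lemma tape_read_tp [simp]:
  "tape_read (tp l []) = 0" "tape_read (tp l (x # r)) = x"
  by (simp_all add: tape_read_def tp_def nth_append)

lemma tp_trailing_blank: "tp l (r @ [0]) = tp l r"
  by (rule prod_eqI) (auto simp: tp_def nth_append fun_eq_iff)

lemma tp_shift: "fst (tp (s # l) r) = fst (tp l (s # r))"
  by (simp add: tp_def fun_eq_iff)

lemma tp_write:
  "(fst (tp l (x # r)))(snd (tp l (x # r)) := s) = fst (tp l (s # r))"
  "(fst (tp l []))(snd (tp l []) := s) = fst (tp l [s])"
proof -
  show 1: "(fst (tp l (x # r)))(snd (tp l (x # r)) := s) = fst (tp l (s # r))" for x r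
  proof
    fix i
    consider "i < -1" | "-1 \<le> i" "nat (i + 1) < length l" | "nat (i + 1) = length l" "-1 \<le> i"
      | "length l < nat (i + 1)" "-1 \<le> i"
      by linarith
    then show "((fst (tp l (x # r)))(snd (tp l (x # r)) := s)) i = fst (tp l (s # r)) i"
      by cases (auto simp: tp_def nth_append nth_Cons' simp del: append_Cons)
  qed
  show "(fst (tp l []))(snd (tp l []) := s) = fst (tp l [s])"
    using 1[of 0 "[]"] tp_trailing_blank[of l "[]"] by (simp add: tp_def)
qed

lemma snd_tp: "snd (tp l r) = int (length l) - 1"
  by (simp add: tp_def)

lemma tape_act_stay [simp]:
  "tape_act (s, Stay) (tp l (x # r)) = tp l (s # r)"
  "tape_act (s, Stay) (tp l []) = tp l [s]"
  by (rule prod_eqI; simp add: tape_act_def tp_write; simp add: snd_tp)+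

lemma tape_act_right [simp]:
  "tape_act (s, GoRight) (tp l (x # r)) = tp (s # l) r"
  "tape_act (s, GoRight) (tp l []) = tp (s # l) []"
  by (rule prod_eqI; simp add: tape_act_def tp_write tp_shift; simp add: snd_tp)+

text \<open>A blank at the right end of \<open>r\<close> is invisible on the tape, so descriptions
  by \<open>tp\<close> are not unique. The case distinction never creates a trailing 0; otherwise
  erasing from the right would pile up blanks and equal tapes would not become syntactically
  equal.\<close>

lemma tape_act_left [simp]:
  "tape_act (s, GoLeft) (tp (y # l) (x # z # r)) = tp l (y # s # z # r)"
  "s \<noteq> 0 \<Longrightarrow> tape_act (s, GoLeft) (tp (y # l) [x]) = tp l [y, s]"
  "tape_act (0, GoLeft) (tp (y # l) [x]) = tp l [y]"
  "tape_act (0, GoLeft) (tp (y # l) []) = tp l [y]"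
proof -
  have 1: "tape_act (s, GoLeft) (tp (y # l) (x # r)) = tp l (y # s # r)" for s x r
    by (rule prod_eqI; simp only: tape_act_def tp_write fst_conv snd_conv;
        simp add: snd_tp tp_shift)
  have 2: "tape_act (s, GoLeft) (tp (y # l) []) = tp l [y, s]" for s
    by (rule prod_eqI; simp only: tape_act_def tp_write fst_conv snd_conv;
        simp add: snd_tp tp_shift)
  show "tape_act (s, GoLeft) (tp (y # l) (x # z # r)) = tp l (y # s # z # r)"
    "s \<noteq> 0 \<Longrightarrow> tape_act (s, GoLeft) (tp (y # l) [x]) = tp l [y, s]" by (simp_all add: 1)
  show "tape_act (0, GoLeft) (tp (y # l) [x]) = tp l [y]"
    "tape_act (0, GoLeft) (tp (y # l) []) = tp l [y]"
    using tp_trailing_blank[of l "[y]"] by (simp_all add: 1 2)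
qed

text \<open>Queries are asked with the head just behind the written word. The symbol
  \<open>m\<close> is the end marker in cell -1, which \<open>tape_word\<close> does not see because
  it reads from cell 0.\<close>

lemma tape_word_tp:
  assumes "0 \<notin> set w"
  shows "tape_word (tp (rev w @ [m]) []) = w"
proof -
  have 1: "fst (tp (rev w @ [m]) []) (int i) = (if i < length w then w ! i else 0)" for i
  proof -
    have "nat (int i + 1) = Suc i" by simp
    then show ?thesis by (simp add: tp_def)
  qed
  have nz: "w ! i \<noteq> 0" if "i < length w" for i using assms that nth_mem by metis
  have 2: "(LEAST i. fst (tp (rev w @ [m]) []) (int i) = 0) = length w"
    unfolding 1 by (rule Least_equality) (auto split: if_splits dest: nz leI)
  show ?thesis unfolding tape_word_def 2 by (rule nth_equalityI) (simp_all add: 1)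
qed

lemma tape_act_read_stay [simp]: "tape_act (tape_read t, Stay) t = t"
  by (cases t) (simp add: tape_act_def tape_read_def)


section \<open>Rule tables\<close>

text \<open>
  A rule consists of a guard, listing the admissible symbols for some of the tapes, a target state
  and actions for some of the tapes. An action either writes a fixed symbol or the symbol read on a
  given tape.
\<close>

datatype wr = W nat | Cp nat

type_synonym guard = "(nat \<times> nat list) list"
type_synonym acts = "(nat \<times> wr \<times> move) list"
type_synonym 'q rules = "(guard \<times> 'q \<times> acts) list"

primrec wval :: "(nat \<Rightarrow> nat) \<Rightarrow> wr \<Rightarrow> nat" where
  "wval f (W s) = s"
| "wval f (Cp i) = f i"

definition matches :: "guard \<Rightarrow> (nat \<Rightarrow> nat) \<Rightarrow> bool" where
  "matches g f \<longleftrightarrow> (\<forall>(j, S)\<in>set g. f j \<in> set S)"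

definition act_of :: "acts \<Rightarrow> (nat \<Rightarrow> nat) \<Rightarrow> nat \<Rightarrow> nat \<times> move" where
  "act_of a f j = (case map_of a j of None \<Rightarrow> (f j, Stay) | Some (w, m) \<Rightarrow> (wval f w, m))"

definition reads :: "(nat \<Rightarrow> tape) \<Rightarrow> nat \<Rightarrow> nat" where
  "reads F j = tape_read (F j)"

text \<open>Tapes form a total family, so that changes of tapes are function updates; the number of
  tapes enters only with the translation to \<open>ntm\<close>.\<close>

definition ap :: "acts \<Rightarrow> (nat \<Rightarrow> tape) \<Rightarrow> nat \<Rightarrow> tape" where
  "ap a F j = tape_act (act_of a (reads F) j) (F j)"

record 'q machine =
  table :: "'q \<Rightarrow> 'q rules"
  st_init :: 'q
  st_acc :: 'q
  st_qry :: 'q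
  st_yes :: 'q
  st_no :: 'q

inductive astep :: "'q machine \<Rightarrow> nat list set \<Rightarrow> 'q \<times> (nat \<Rightarrow> tape) \<Rightarrow> 'q \<times> (nat \<Rightarrow> tape) \<Rightarrow> bool"
  for M X where
  rule: "(g, q', a) \<in> set (table M q) \<Longrightarrow> matches g (reads F) \<Longrightarrow> astep M X (q, F) (q', ap a F)"
| query: "astep M X (st_qry M, F) (if tape_word (F 1) \<in> X then st_yes M else st_no M, F)"

text \<open>\<open>n\<close> is the number of tapes and \<open>b\<close> the largest symbol. Copied
  symbols are already on a tape, so only written constants have to respect \<open>b\<close>.\<close>

definition rule_ok :: "nat \<Rightarrow> nat \<Rightarrow> guard \<times> 'q \<times> acts \<Rightarrow> bool" where
  "rule_ok n b = (\<lambda>(g, q', a). (\<forall>(j, S)\<in>set g. j < n) \<and>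
     (\<forall>(j, w, m)\<in>set a. case w of W s \<Rightarrow> s \<le> b | Cp i \<Rightarrow> i < n))"

definition machine_ok :: "nat \<Rightarrow> nat \<Rightarrow> 'q machine \<Rightarrow> bool" where
  "machine_ok n b M \<longleftrightarrow> finite {q. table M q \<noteq> []} \<and> (\<forall>q. \<forall>r\<in>set (table M q). rule_ok n b r) \<and>
     table M (st_acc M) = [] \<and> table M (st_qry M) = [] \<and> st_acc M \<noteq> st_qry M"

text \<open>Every guard is expanded into all vectors of read symbols up to \<open>b\<close>. The
  alphabet bound is what keeps \<open>delta\<close> finite.\<close>

definition ntm_of :: "nat \<Rightarrow> nat \<Rightarrow> 'q::countable machine \<Rightarrow> ntm" where
  "ntm_of n b M = \<lparr>tape_count = n, start = to_nat (st_init M), accept = to_nat (st_acc M),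
     query = to_nat (st_qry M), yes_state = to_nat (st_yes M), no_state = to_nat (st_no M),
     delta = (\<Union>q\<in>{q. table M q \<noteq> []}. \<Union>(g, q', a)\<in>set (table M q).
       (\<lambda>rs. (to_nat q, rs, to_nat q', map (act_of a ((!) rs)) [0..<n])) `
         {rs. set rs \<subseteq> {..b} \<and> length rs = n \<and> matches g ((!) rs)})\<rparr>"

lemma finite_delta_ntm_of:
  assumes "finite {q. table M q \<noteq> []}"
  shows "finite (delta (ntm_of n b M))"
proof -
  have "finite {rs. set rs \<subseteq> {..b} \<and> length rs = n \<and> matches g ((!) rs)}" for g
    by (rule finite_subset[OF _ finite_lists_length_eq[of "{..b}" n]]) auto
  then show ?thesis using assms
    unfolding ntm_of_def ntm.select_convs by (intro finite_UN_I) auto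
qed

lemma ntm_ntm_of:
  assumes "machine_ok n b M" "2 \<le> n"
  shows "ntm (ntm_of n b M)"
  unfolding ntm_def
proof (intro conjI)
  show "finite (delta (ntm_of n b M))"
    using assms by (intro finite_delta_ntm_of) (simp add: machine_ok_def)
  show "\<forall>(q, rs, q', as)\<in>delta (ntm_of n b M). q \<noteq> accept (ntm_of n b M) \<and>
      q \<noteq> query (ntm_of n b M) \<and> length rs = tape_count (ntm_of n b M) \<and>
      length as = tape_count (ntm_of n b M)"
    using assms by (auto simp: ntm_of_def machine_ok_def)
qed (use assms in \<open>auto simp: ntm_of_def machine_ok_def\<close>)

section \<open>Simulation between rule machines and Turing machines\<close>

definition conc :: "nat \<Rightarrow> 'q::countable \<times> (nat \<Rightarrow> tape) \<Rightarrow> nat \<times> tape list" where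
  "conc n c = (to_nat (fst c), map (snd c) [0..<n])"

lemma matches_cong:
  "\<forall>(j, S)\<in>set g. f j = f' j \<Longrightarrow> matches g f = matches g f'"
  by (fastforce simp: matches_def)

lemma act_of_cong:
  assumes "\<forall>(j, w, m)\<in>set a. case w of W s \<Rightarrow> True | Cp i \<Rightarrow> f i = f' i" "f j = f' j"
  shows "act_of a f j = act_of a f' j"
proof (cases "map_of a j")
  case (Some p)
  obtain w m where p: "p = (w, m)" by force
  have "(j, w, m) \<in> set a" using map_of_SomeD[OF Some] p by simp
  then have "wval f w = wval f' w" using assms(1) by (cases w) auto
  then show ?thesis by (simp add: act_of_def Some p)
qed (use assms in \<open>simp add: act_of_def\<close>)

lemma rule_ok_cong:
  assumes "rule_ok n b (g, q', a)" "\<And>j. j < n \<Longrightarrow> f j = f' j"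
  shows "matches g f = matches g f'" "j < n \<Longrightarrow> act_of a f j = act_of a f' j"
proof -
  show "matches g f = matches g f'"
    using assms by (intro matches_cong) (fastforce simp: rule_ok_def)
  show "act_of a f j = act_of a f' j" if "j < n"
    using assms that by (intro act_of_cong) (fastforce simp: rule_ok_def split: wr.splits)+
qed

lemma map2_tape_act:
  "map2 tape_act (map f [0..<n]) (map F [0..<n]) = map (\<lambda>j. tape_act (f j) (F j)) [0..<n]"
  by (simp add: zip_map_map zip_same_conv_map)

lemma ntm_step_conc:
  assumes M: "machine_ok n b M" and n: "2 \<le> n" and st: "ntm_step (ntm_of n b M) X (conc n c) d"
  shows "\<exists>c'. astep M X c c' \<and> d = conc n c'"
proof -
  obtain q F where c: "c = (q, F)" by force
  from st show ?thesis
  proof cases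
    case (step_move q0 ts q1 as)
    then have ts: "ts = map F [0..<n]" and q0: "q0 = to_nat q"
      by (simp_all add: conc_def c)
    from step_move(3) obtain g q' a where r: "(g, q', a) \<in> set (table M q)"
      and q1: "q1 = to_nat q'" and ma: "matches g ((!) (map tape_read ts))"
      and as: "as = map (act_of a ((!) (map tape_read ts))) [0..<n]"
      unfolding q0 by (auto simp: ntm_of_def)
    have ok: "rule_ok n b (g, q', a)" using M r by (auto simp: machine_ok_def)
    have eq: "\<And>j. j < n \<Longrightarrow> (!) (map tape_read ts) j = reads F j"
      by (simp add: ts reads_def)
    have "astep M X c (q', ap a F)"
      unfolding c using r ma rule_ok_cong(1)[OF ok eq] by (auto intro: astep.rule)
    moreover have "d = conc n (q', ap a F)"
      unfolding step_move(2) conc_def as ts map2_tape_act q1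
      using rule_ok_cong(2)[OF ok eq] by (auto simp: ap_def ts)
    ultimately show ?thesis by blast
  next
    case (step_query ts)
    then have "ts = map F [0..<n]" "q = st_qry M" by (auto simp: conc_def c ntm_of_def)
    then show ?thesis using n astep.query[of M X F] step_query(2) unfolding c
      by (intro exI[of _ "(if tape_word (F 1) \<in> X then st_yes M else st_no M, F)"])
        (auto simp: conc_def ntm_of_def)
  qed
qed

definition bounded :: "nat \<Rightarrow> nat \<Rightarrow> (nat \<Rightarrow> tape) \<Rightarrow> bool" where
  "bounded n b F \<longleftrightarrow> (\<forall>j<n. \<forall>i. fst (F j) i \<le> b)"

lemma bounded_ap:
  assumes "bounded n b F" "rule_ok n b (g, q', a)"
  shows "bounded n b (ap a F)"
proof -
  have "fst (act_of a (reads F) j) \<le> b" if "j < n" for j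
  proof (cases "map_of a j")
    case None
    then show ?thesis using assms that by (simp add: act_of_def bounded_def reads_def tape_read_def)
  next
    case (Some p)
    then have "(j, p) \<in> set a" by (rule map_of_SomeD)
    then show ?thesis using assms Some
      by (cases p; cases "fst p")
        (fastforce simp: act_of_def bounded_def reads_def tape_read_def rule_ok_def)+
  qed
  then show ?thesis using assms by (auto simp: bounded_def ap_def tape_act_def)
qed

text \<open>\<open>bounded\<close> makes the expanded transition available, since
  \<open>delta\<close> only lists read vectors over symbols up to \<open>b\<close>; it is returned
  as an invariant so that the lemma can be iterated.\<close>

lemma astep_conc:
  assumes M: "machine_ok n b M" and n: "2 \<le> n" and b: "bounded n b (snd c)" and st: "astep M X c c'"
  shows "ntm_step (ntm_of n b M) X (conc n c) (conc n c') \<and> bounded n b (snd c')"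
  using st
proof cases
  case (rule g q' a q F)
  have ok: "rule_ok n b (g, q', a)" using M rule(3) by (auto simp: machine_ok_def)
  let ?rs = "map tape_read (map F [0..<n])"
  have eq: "\<And>j. j < n \<Longrightarrow> (!) ?rs j = reads F j" by (simp add: reads_def)
  have rs: "set ?rs \<subseteq> {..b}" using b rule by (auto simp: bounded_def tape_read_def)
  have ma: "matches g ((!) ?rs)" using rule(4) rule_ok_cong(1)[OF ok, of "(!) ?rs" "reads F"] eq by simp
  have act: "act_of a ((!) ?rs) j = act_of a (reads F) j" if "j < n" for j
    using rule_ok_cong(2)[OF ok, of "(!) ?rs" "reads F"] eq that by blast
  have eq2: "map (\<lambda>j. tape_act (act_of a ((!) ?rs) j) (F j)) [0..<n] = map (ap a F) [0..<n]"
    by (rule map_cong[OF refl]) (simp only: ap_def act set_upt atLeastLessThan_iff)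
  have "(to_nat q, ?rs, to_nat q', map (act_of a ((!) ?rs)) [0..<n]) \<in> delta (ntm_of n b M)"
    unfolding ntm_of_def using rule(3) rs ma
    by (simp, intro exI[of _ q] conjI bexI[of _ "(g, q', a)"]) (auto intro!: image_eqI)
  from step_move[OF this, of X]
  have "ntm_step (ntm_of n b M) X (conc n c) (conc n c')"
    unfolding map2_tape_act rule(1,2) conc_def fst_conv snd_conv eq2 .
  then show ?thesis using bounded_ap[OF _ ok] b rule by simp
next
  case (query F)
  then show ?thesis using b n step_query[of "ntm_of n b M" X "map F [0..<n]"]
    by (auto simp: conc_def ntm_of_def split: if_splits)
qed

lemma accepts_ntm_of:
  assumes M: "machine_ok n b M" and n: "2 \<le> n" and F: "bounded n b F"
    and init: "init_config (ntm_of n b M) w = conc n (st_init M, F)"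
  shows "accepts (ntm_of n b M) X w \<longleftrightarrow> (\<exists>F'. (astep M X)\<^sup>*\<^sup>* (st_init M, F) (st_acc M, F'))"
proof -
  have 1: "\<exists>c'. (astep M X)\<^sup>*\<^sup>* c c' \<and> d = conc n c'"
    if "(ntm_step (ntm_of n b M) X)\<^sup>*\<^sup>* (conc n c) d" for c d
    using that
  proof (induction rule: rtranclp_induct)
    case (step d0 d)
    then obtain c0 where "(astep M X)\<^sup>*\<^sup>* c c0" "d0 = conc n c0" by blast
    with step(2) ntm_step_conc[OF M n] show ?case
      by (metis rtranclp.rtrancl_into_rtrancl)
  qed blast
  have 2: "(ntm_step (ntm_of n b M) X)\<^sup>*\<^sup>* (conc n c) (conc n c') \<and> bounded n b (snd c')"
    if "(astep M X)\<^sup>*\<^sup>* c c'" "bounded n b (snd c)" for c c'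
    using that by (induction rule: rtranclp_induct)
      (auto dest: astep_conc[OF M n] intro: rtranclp.rtrancl_into_rtrancl)
  have acc: "accept (ntm_of n b M) = to_nat (st_acc M)" by (simp add: ntm_of_def)
  show ?thesis
    unfolding accepts_def init acc
  proof (intro iffI; elim exE conjE)
    fix c assume "(ntm_step (ntm_of n b M) X)\<^sup>*\<^sup>* (conc n (st_init M, F)) c" "fst c = to_nat (st_acc M)"
    with 1[of "(st_init M, F)" c] show "\<exists>F'. (astep M X)\<^sup>*\<^sup>* (st_init M, F) (st_acc M, F')"
      by (auto simp: conc_def)
  next
    fix F' assume "(astep M X)\<^sup>*\<^sup>* (st_init M, F) (st_acc M, F')"
    from 2[OF this] F
    show "\<exists>c. (ntm_step (ntm_of n b M) X)\<^sup>*\<^sup>* (conc n (st_init M, F)) c \<and> fst c = to_nat (st_acc M)"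
      by (auto simp: conc_def)
  qed
qed

section \<open>Bounds on the length of all runs\<close>

definition halts :: "'q machine \<Rightarrow> nat list set \<Rightarrow> nat \<Rightarrow> 'q \<times> (nat \<Rightarrow> tape) \<Rightarrow> bool" where
  "halts M X t c \<longleftrightarrow> (\<forall>k c'. (astep M X ^^ k) c c' \<longrightarrow> k \<le> t)"

lemma all_runs_halt_ntm_of:
  assumes M: "machine_ok n b M" and n: "2 \<le> n"
    and init: "init_config (ntm_of n b M) w = conc n (st_init M, F)"
    and h: "halts M X t (st_init M, F)"
  shows "all_runs_halt_within (ntm_of n b M) X w t"
proof -
  have "\<exists>c'. (astep M X ^^ k) c c' \<and> d = conc n c'"
    if "(ntm_step (ntm_of n b M) X ^^ k) (conc n c) d" for c d k
    using that
  proof (induction k arbitrary: d)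
    case (Suc k)
    then obtain d0 where "(ntm_step (ntm_of n b M) X ^^ k) (conc n c) d0"
      and st: "ntm_step (ntm_of n b M) X d0 d" by auto
    with Suc.IH obtain c0 where c0: "(astep M X ^^ k) c c0" "d0 = conc n c0" by blast
    with ntm_step_conc[OF M n] st obtain c1 where "astep M X c0 c1" "d = conc n c1" by blast
    with c0(1) show ?case by (blast intro: relpowp_Suc_I)
  qed auto
  then show ?thesis using h unfolding all_runs_halt_within_def init halts_def by blast
qed

lemma halts_step:
  assumes "\<And>c'. astep M X c c' \<Longrightarrow> halts M X t c'"
  shows "halts M X (Suc t) c"
  unfolding halts_def
proof (intro allI impI)
  fix k c' assume run: "(astep M X ^^ k) c c'"
  show "k \<le> Suc t"
  proof (cases k)
    case (Suc j)
    with run obtain d where "astep M X c d" "(astep M X ^^ j) d c'"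
      by (metis relpowp_Suc_D2)
    with assms show ?thesis unfolding halts_def Suc by blast
  qed simp
qed

lemma halts_stuck: "(\<And>c'. \<not> astep M X c c') \<Longrightarrow> halts M X t c"
  unfolding halts_def by (metis bot_nat_0.extremum not0_implies_Suc relpowp_Suc_D2)

lemma halts_mono: "halts M X t c \<Longrightarrow> t \<le> t' \<Longrightarrow> halts M X t' c"
  unfolding halts_def by (meson le_trans)


section \<open>Deterministic runs\<close>

text \<open>A list instead of a set: the simplifier evaluates it on concrete configurations, and a
  singleton list then says that the move is forced.\<close>

definition steps :: "('q \<Rightarrow> 'q rules) \<Rightarrow> 'q \<Rightarrow> (nat \<Rightarrow> tape) \<Rightarrow> ('q \<times> (nat \<Rightarrow> tape)) list" where
  "steps T q F = map (\<lambda>(g, q', a). (q', ap a F)) (filter (\<lambda>(g, q', a). matches g (reads F)) (T q))"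

inductive drun :: "('q \<Rightarrow> 'q rules) \<Rightarrow> nat \<Rightarrow> 'q \<times> (nat \<Rightarrow> tape) \<Rightarrow> 'q \<times> (nat \<Rightarrow> tape) \<Rightarrow> bool"
  for T where
  drun_0: "drun T 0 c c"
| drun_Suc: "steps T q F = [c'] \<Longrightarrow> drun T k c' c'' \<Longrightarrow> drun T (Suc k) (q, F) c''"

lemma drun_trans: "drun T k c c' \<Longrightarrow> drun T l c' c'' \<Longrightarrow> drun T (k + l) c c''"
  by (induction rule: drun.induct) (simp_all add: drun.drun_Suc)

lemma drun_1: "steps T q F = [c'] \<Longrightarrow> drun T 1 (q, F) c'"
  by (metis One_nat_def drun.intros)

lemma steps_Nil: "T q = [] \<Longrightarrow> steps T q F = []"
  by (simp add: steps_def)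

lemma set_steps:
  "set (steps T q F) = {(q', ap a F) |g q' a. (g, q', a) \<in> set (T q) \<and> matches g (reads F)}"
proof (intro set_eqI iffI)
  fix c assume "c \<in> {(q', ap a F) |g q' a. (g, q', a) \<in> set (T q) \<and> matches g (reads F)}"
  then obtain g q' a where "c = (q', ap a F)" "(g, q', a) \<in> set (T q)" "matches g (reads F)" by blast
  then show "c \<in> set (steps T q F)"
    unfolding steps_def set_map set_filter by (intro image_eqI[of _ _ "(g, q', a)"]) simp_all
qed (auto simp: steps_def)

lemma astep_iff_steps:
  assumes "q \<noteq> st_qry M"
  shows "astep M X (q, F) c \<longleftrightarrow> c \<in> set (steps (table M) q F)"
  using assms by (auto simp: set_steps astep.simps)

lemma astep_query_iff:
  assumes "table M (st_qry M) = []"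
  shows "astep M X (st_qry M, F) c \<longleftrightarrow> c = (if tape_word (F 1) \<in> X then st_yes M else st_no M, F)"
  using assms by (auto simp: astep.simps)

text \<open>\<open>T\<close> is a partial table agreeing with the machine wherever it has rules. The
  query state has no rules at all, so a state with a rule in \<open>T\<close> is not the query state
  and no query competes with the forced move.\<close>

lemma astep_if_steps:
  assumes "steps T q F = [c']" "T q \<noteq> [] \<Longrightarrow> table M q = T q" "table M (st_qry M) = []"
  shows "astep M X (q, F) c \<longleftrightarrow> c = c'"
proof -
  have "T q \<noteq> []" using assms(1) steps_Nil[of T q F] by auto
  then have eq: "table M q = T q" "q \<noteq> st_qry M" using assms(2,3) by auto
  then have "steps (table M) q F = [c']" using assms(1) by (simp add: steps_def)
  then show ?thesis using astep_iff_steps[OF eq(2)] by auto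
qed

lemma halts_drun:
  assumes "drun T k c c'" "\<And>q. T q \<noteq> [] \<Longrightarrow> table M q = T q" "table M (st_qry M) = []"
    and "halts M X t c'"
  shows "halts M X (k + t) c"
  using assms
proof (induction rule: drun.induct)
  case (drun_Suc q F c' k c'')
  have "halts M X (k + t) c'" using drun_Suc by blast
  then have "halts M X (Suc (k + t)) (q, F)"
    using astep_if_steps[OF drun_Suc.hyps(1) drun_Suc.prems(1,2)] by (intro halts_step) simp
  then show ?case by simp
qed simp

lemma converse_rtranclp_iff: "r\<^sup>*\<^sup>* x z \<longleftrightarrow> x = z \<or> (\<exists>y. r x y \<and> r\<^sup>*\<^sup>* y z)"
  by (metis converse_rtranclpE converse_rtranclp_into_rtranclp rtranclp.rtrancl_refl)

text \<open>Every move is forced, and the run cannot visit the accepting state before its end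
  because that state has no rules.\<close>

lemma reach_drun:
  assumes "drun T k c c'" "\<And>q. T q \<noteq> [] \<Longrightarrow> table M q = T q" "table M (st_qry M) = []"
    and "table M (st_acc M) = []"
  shows "(\<exists>F'. (astep M X)\<^sup>*\<^sup>* c (st_acc M, F')) \<longleftrightarrow> (\<exists>F'. (astep M X)\<^sup>*\<^sup>* c' (st_acc M, F'))"
  using assms
proof (induction rule: drun.induct)
  case (drun_Suc q F c' k c'')
  have "T q \<noteq> []" using drun_Suc.hyps(1) steps_Nil[of T q F] by auto
  then have "q \<noteq> st_acc M" using drun_Suc.prems(1,3) by auto
  then have "(astep M X)\<^sup>*\<^sup>* (q, F) (st_acc M, F') \<longleftrightarrow> (astep M X)\<^sup>*\<^sup>* c' (st_acc M, F')" for F'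
    using astep_if_steps[OF drun_Suc.hyps(1) drun_Suc.prems(1,2), of X]
    by (subst converse_rtranclp_iff) auto
  moreover have "(\<exists>F'. (astep M X)\<^sup>*\<^sup>* c' (st_acc M, F')) \<longleftrightarrow> (\<exists>F'. (astep M X)\<^sup>*\<^sup>* c'' (st_acc M, F'))"
    using drun_Suc by blast
  ultimately show ?case by simp
qed simp


section \<open>Acceptance with a bounded number of steps\<close>

text \<open>The budget counts table moves only, as queries cannot advance a clock. A negative answer
  has no clause: in \<open>clocked_machine\<close> it leads to a non-accepting state without
  rules.\<close>

inductive ac :: "'q machine \<Rightarrow> nat list set \<Rightarrow> nat \<Rightarrow> 'q \<Rightarrow> (nat \<Rightarrow> tape) \<Rightarrow> bool" for M X where
  ac_acc: "ac M X c (st_acc M) F"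
| ac_qry: "tape_word (F 1) \<in> X \<Longrightarrow> ac M X c (st_yes M) F \<Longrightarrow> ac M X c (st_qry M) F"
| ac_rule: "(q', F') \<in> set (steps (table M) q F) \<Longrightarrow> ac M X c q' F' \<Longrightarrow> ac M X (Suc c) q F"

lemma ac_mono: "ac M X c q F \<Longrightarrow> c \<le> d \<Longrightarrow> ac M X d q F"
proof (induction arbitrary: d rule: ac.induct)
  case (ac_rule q' F' q F c)
  then show ?case by (cases d) (auto intro: ac.intros)
qed (auto intro: ac.intros)

text \<open>
  The table \<open>T\<close> belongs to a preprocessing phase, which does not consume the clock on tape \<open>i\<close>.
\<close>

definition clocked :: "nat \<Rightarrow> ('q \<Rightarrow> 'q rules) \<Rightarrow> 'q machine \<Rightarrow> 'q machine" where
  "clocked i T M = M\<lparr>table := \<lambda>q. T q @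
     map (\<lambda>(g, q', a). ((i, [1]) # g, q', (i, W 1, GoRight) # a)) (table M q)\<rparr>"

text \<open>\<open>a\<close> cells are used up and \<open>c\<close> remain. Used cells keep their
  symbol; expiry is noticed when the head reaches the blank behind the block.\<close>

definition clock :: "nat \<Rightarrow> nat \<Rightarrow> tape" where
  "clock a c = tp (replicate a 1 @ [5]) (replicate c 1)"

lemma tape_read_clock: "tape_read (clock a c) = 1 \<longleftrightarrow> 0 < c"
  by (cases c) (simp_all add: clock_def)

lemma tape_act_clock: "0 < c \<Longrightarrow> tape_act (1, GoRight) (clock a c) = clock (Suc a) (c - 1)"
  by (cases c) (simp_all add: clock_def)

definition avoids :: "nat \<Rightarrow> guard \<times> 'q \<times> acts \<Rightarrow> bool" where
  "avoids i = (\<lambda>(g, q', a). (\<forall>(j, S)\<in>set g. j \<noteq> i) \<and>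
     (\<forall>(j, w, m)\<in>set a. j \<noteq> i \<and> w \<noteq> Cp i))"

lemma ap_clocked:
  assumes "avoids i (g, q', a)" "0 < c"
  shows "ap ((i, W 1, GoRight) # a) (F(i := clock k c)) = (ap a F)(i := clock (Suc k) (c - 1))"
proof
  fix j
  have "act_of a (reads (F(i := clock k c))) j = act_of a (reads F) j" if "j \<noteq> i"
    using assms that by (intro act_of_cong) (auto simp: avoids_def reads_def split: wr.splits)
  then show "ap ((i, W 1, GoRight) # a) (F(i := clock k c)) j
      = ((ap a F)(i := clock (Suc k) (c - 1))) j"
    using assms tape_act_clock[of c k] by (auto simp: ap_def act_of_def)
qed

lemma matches_clocked:
  assumes "avoids i (g, q', a)"
  shows "matches ((i, [1]) # g) (reads (F(i := clock k c))) \<longleftrightarrow> 0 < c \<and> matches g (reads F)"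
proof -
  have "matches g (reads (F(i := clock k c))) = matches g (reads F)"
    using assms by (intro matches_cong) (auto simp: avoids_def reads_def)
  then show ?thesis
    using tape_read_clock[of k c] by (auto simp: matches_def reads_def)
qed

lemma steps_clocked:
  assumes "T q = []" "\<forall>r\<in>set (table M q). avoids i r"
  shows "set (steps (table (clocked i T M)) q (F(i := clock k c))) =
    (if 0 < c then (\<lambda>(q', F'). (q', F'(i := clock (Suc k) (c - 1)))) ` set (steps (table M) q F) else {})"
proof -
  have *: "matches ((i, [1]) # g) (reads (F(i := clock k c))) \<longleftrightarrow> 0 < c \<and> matches g (reads F)"
    "0 < c \<Longrightarrow> ap ((i, W 1, GoRight) # a) (F(i := clock k c)) = (ap a F)(i := clock (Suc k) (c - 1))"
    if "(g, q', a) \<in> set (table M q)" for g q' a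
    using ap_clocked[of i g q' a c F k] matches_clocked[of i g q' a F k c] assms(2) that by auto
  show ?thesis
  proof (intro set_eqI iffI)
    fix d assume "d \<in> set (steps (table (clocked i T M)) q (F(i := clock k c)))"
    then obtain g q' a where g: "(g, q', a) \<in> set (table M q)"
      "matches ((i, [1]) # g) (reads (F(i := clock k c)))"
      "d = (q', ap ((i, W 1, GoRight) # a) (F(i := clock k c)))"
      using assms(1) by (auto simp: set_steps clocked_def)
    then have "0 < c" "(q', ap a F) \<in> set (steps (table M) q F)"
      using *(1)[OF g(1)] by (auto simp: set_steps)
    then show "d \<in> (if 0 < c then (\<lambda>(q', F'). (q', F'(i := clock (Suc k) (c - 1)))) `
        set (steps (table M) q F) else {})"
      unfolding g(3) using *(2)[OF g(1)] by (simp add: rev_image_eqI)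
  next
    fix d assume d: "d \<in> (if 0 < c then (\<lambda>(q', F'). (q', F'(i := clock (Suc k) (c - 1)))) `
        set (steps (table M) q F) else {})"
    then have c: "0 < c" by (auto split: if_splits)
    with d obtain g q' a where g: "(g, q', a) \<in> set (table M q)" "matches g (reads F)"
      "d = (q', (ap a F)(i := clock (Suc k) (c - 1)))"
      by (auto simp: set_steps)
    have "((i, [1]) # g, q', (i, W 1, GoRight) # a) \<in> set (table (clocked i T M) q)"
      unfolding clocked_def using g(1) by (auto intro!: rev_image_eqI)
    then show "d \<in> set (steps (table (clocked i T M)) q (F(i := clock k c)))"
      unfolding set_steps g(3) using *[OF g(1)] c g(2) by (metis (mono_tags, lifting) mem_Collect_eq)
  qed
qed

text \<open>\<open>phase\<close> prevents the main computation from returning to the preprocessing,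
  whose moves are not charged. The answer states differ from the query state, so that queries never
  follow each other directly, and \<open>i\<close> differs from 1 so that the clock does not affect
  query words.\<close>

locale clocked_machine =
  fixes i :: nat and T :: "'q \<Rightarrow> 'q rules" and M :: "'q machine"
  assumes avoids: "r \<in> set (table M q) \<Longrightarrow> avoids i r"
    and phase: "(g, q', a) \<in> set (table M q) \<Longrightarrow> T q' = []"
    and qry: "table M (st_qry M) = []" "T (st_qry M) = []" "st_yes M \<noteq> st_qry M" "st_no M \<noteq> st_qry M"
    and answers: "T (st_yes M) = []" "T (st_no M) = []" "table M (st_no M) = []" "st_no M \<noteq> st_acc M"
    and acc: "table M (st_acc M) = []" "T (st_acc M) = []" "st_acc M \<noteq> st_qry M"
    and i: "i \<noteq> 1"
begin

lemma qry_clocked: "table (clocked i T M) (st_qry (clocked i T M)) = []"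
  using qry by (simp add: clocked_def)

text \<open>Each clock cell pays for one table move and for at most one query after it; a run that
  starts in the query state makes one further step before anything is paid.\<close>

lemma halts_clocked:
  assumes "T q = []"
  shows "halts (clocked i T M) X (2 * c + of_bool (q = st_qry M)) (q, F(i := clock k c))"
  using assms
proof (induction c arbitrary: q F k rule: less_induct)
  case (less c)
  have rule: "halts (clocked i T M) X (2 * c) (q, F(i := clock k c))"
    if q: "q \<noteq> st_qry M" "T q = []" for q F
  proof (cases "c = 0")
    case True
    have "steps (table (clocked i T M)) q (F(i := clock k c)) = []"
      using steps_clocked[of T q M i F k c] q avoids True by auto
    then show ?thesis
      using q by (intro halts_stuck) (simp add: astep_iff_steps clocked_def)
  next
    case False
    have "halts (clocked i T M) X (Suc (2 * (c - 1) + 1)) (q, F(i := clock k c))"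
    proof (rule halts_step)
      fix d assume "astep (clocked i T M) X (q, F(i := clock k c)) d"
      then have "d \<in> set (steps (table (clocked i T M)) q (F(i := clock k c)))"
        using q by (subst (asm) astep_iff_steps) (auto simp: clocked_def)
      then obtain q' F' where d: "d = (q', F'(i := clock (Suc k) (c - 1)))"
        and "(q', F') \<in> set (steps (table M) q F)"
        using steps_clocked[of T q M i F k c] q avoids False by auto
      then have "T q' = []" using phase by (auto simp: set_steps)
      then show "halts (clocked i T M) X (2 * (c - 1) + 1) d"
        unfolding d using False by (intro halts_mono[OF less.IH]) auto
    qed
    then show ?thesis using False by (auto elim!: halts_mono)
  qed
  show ?case
  proof (cases "q = st_qry M")
    case True
    have "halts (clocked i T M) X (Suc (2 * c)) (st_qry (clocked i T M), F(i := clock k c))"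
      using rule qry answers
      by (intro halts_step) (subst (asm) astep_query_iff[OF qry_clocked], auto simp: clocked_def)
    then show ?thesis using True by (simp add: clocked_def del: fun_upd_apply)
  qed (use rule less.prems in \<open>simp del: fun_upd_apply\<close>)
qed

lemma ac_qry_iff: "ac M X c (st_qry M) F \<longleftrightarrow> tape_word (F 1) \<in> X \<and> ac M X c (st_yes M) F"
  using qry acc by (subst ac.simps) (auto simp: steps_Nil)

lemma ac_iff_steps:
  "q \<noteq> st_qry M \<Longrightarrow> q \<noteq> st_acc M \<Longrightarrow>
   ac M X c q F \<longleftrightarrow> 0 < c \<and> (\<exists>(q', F')\<in>set (steps (table M) q F). ac M X (c - 1) q' F')"
  by (subst ac.simps) (cases c, auto)

lemma not_ac_no: "\<not> ac M X c (st_no M) F"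
  using qry answers acc by (subst ac.simps) (auto simp: steps_Nil)

text \<open>From here on the clock tape can be forgotten: \<open>F i\<close> is arbitrary on the
  right, and the clock survives only as the number \<open>c\<close>.\<close>

lemma accepts_clocked:
  assumes "T q = []"
  shows "(\<exists>F'. (astep (clocked i T M) X)\<^sup>*\<^sup>* (q, F(i := clock k c)) (st_acc M, F')) \<longleftrightarrow> ac M X c q F"
proof
  assume "\<exists>F'. (astep (clocked i T M) X)\<^sup>*\<^sup>* (q, F(i := clock k c)) (st_acc M, F')"
  then obtain F' where "(astep (clocked i T M) X)\<^sup>*\<^sup>* (q, F(i := clock k c)) (st_acc M, F')" ..
  then show "ac M X c q F" using assms
  proof (induction "(q, F(i := clock k c))" arbitrary: q F k c rule: converse_rtranclp_induct)
    case base
    then show ?case by (auto intro: ac.intros)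
  next
    case (step d)
    show ?case
    proof (cases "q = st_qry M")
      case True
      then have "d = (if tape_word (F 1) \<in> X then st_yes M else st_no M, F(i := clock k c))"
        using step(1) astep_query_iff[OF qry_clocked, of X "F(i := clock k c)" d] i
        by (auto simp: clocked_def)
      with step(3)[of _ F k c] answers not_ac_no True show ?thesis
        by (auto simp: ac_qry_iff split: if_splits)
    next
      case False
      then have "d \<in> set (steps (table (clocked i T M)) q (F(i := clock k c)))"
        using step(1) by (subst (asm) astep_iff_steps) (auto simp: clocked_def)
      then obtain q' F' where d: "d = (q', F'(i := clock (Suc k) (c - 1)))" "0 < c"
        and st: "(q', F') \<in> set (steps (table M) q F)"
        using steps_clocked[of T q M i F k c] step.prems avoids by (auto split: if_splits)
      then have "T q' = []" using phase by (auto simp: set_steps)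
      then have "ac M X (c - 1) q' F'" using step(3) d by blast
      with st ac.ac_rule have "ac M X (Suc (c - 1)) q F" by metis
      then show ?thesis using d by simp
    qed
  qed
next
  assume "ac M X c q F"
  then show "\<exists>F'. (astep (clocked i T M) X)\<^sup>*\<^sup>* (q, F(i := clock k c)) (st_acc M, F')"
    using assms
  proof (induction arbitrary: k rule: ac.induct)
    case (ac_acc c F)
    show ?case by (rule exI, rule rtranclp.rtrancl_refl)
  next
    case (ac_qry F c)
    have "astep (clocked i T M) X (st_qry M, F(i := clock k c)) (st_yes M, F(i := clock k c))"
      using astep_query_iff[OF qry_clocked, of X "F(i := clock k c)"] i ac_qry(1)
      by (simp add: clocked_def)
    moreover obtain F' where
      "(astep (clocked i T M) X)\<^sup>*\<^sup>* (st_yes M, F(i := clock k c)) (st_acc M, F')"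
      using ac_qry.IH[of k] answers(1) by blast
    ultimately show ?case by (intro exI) (rule converse_rtranclp_into_rtranclp)
  next
    case (ac_rule q' F' q F c)
    then have "q \<noteq> st_qry M" using qry by (auto simp: steps_Nil)
    moreover have "(q', F'(i := clock (Suc k) c)) \<in>
        set (steps (table (clocked i T M)) q (F(i := clock k (Suc c))))"
      using steps_clocked[of T q M i F k "Suc c"] ac_rule.prems ac_rule.hyps(1) avoids
      by (auto intro!: image_eqI[of _ _ "(q', F')"])
    ultimately have "astep (clocked i T M) X (q, F(i := clock k (Suc c))) (q', F'(i := clock (Suc k) c))"
      by (subst astep_iff_steps) (auto simp: clocked_def)
    moreover have "T q' = []" using phase ac_rule(1) by (auto simp: set_steps)
    then obtain F'' where
      "(astep (clocked i T M) X)\<^sup>*\<^sup>* (q', F'(i := clock (Suc k) c)) (st_acc M, F'')"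
      using ac_rule.IH[of "Suc k"] by blast
    ultimately show ?case by (intro exI) (rule converse_rtranclp_into_rtranclp)
  qed
qed

text \<open>A forced stretch costs exactly its length. Being an equivalence, this serves soundness
  and completeness at once.\<close>

lemma ac_drun:
  assumes "drun (table M) d (q, F) (q', F')"
  shows "ac M X c q F \<longleftrightarrow> d \<le> c \<and> ac M X (c - d) q' F'"
  using assms
proof (induction d "(q, F)" "(q', F')" arbitrary: q F c rule: drun.induct)
  case (drun_Suc q F c' k)
  then have "table M q \<noteq> []" using steps_Nil[of "table M" q F] by auto
  then have "q \<noteq> st_qry M" "q \<noteq> st_acc M" using qry acc by auto
  note 1 = ac_iff_steps[OF this, of X c F]
  obtain q1 F1 where c': "c' = (q1, F1)" by force
  have "ac M X c q F \<longleftrightarrow> 0 < c \<and> ac M X (c - 1) q1 F1" using 1 drun_Suc(1) c' by simp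
  then show ?case using drun_Suc(3)[OF c', of "c - 1"] by (cases c) simp_all
qed simp

end


section \<open>The machine\<close>

text \<open>
  Tape 0 holds the theory (the rest of the input behind it is ignored), tape 1 the oracle query,
  tape 2 the list of guessed vertex indices, tape 3 the goal, tape 4 the remaining number of
  vertices, and tape 5 the clock; tapes 6 and 7 are used for the computation of the clock only.
\<close>

definition tps :: "tape \<Rightarrow> tape \<Rightarrow> tape \<Rightarrow> tape \<Rightarrow> tape \<Rightarrow> tape \<Rightarrow> tape \<Rightarrow> tape \<Rightarrow> nat \<Rightarrow> tape" where
  "tps I Q G E N C X Y = (\<lambda>j. if j < 8 then [I, Q, G, E, N, C, X, Y] ! j else input_tape [])"

lemma tps_nth [simp]:
  "tps I Q G E N C X Y 0 = I" "tps I Q G E N C X Y (Suc 0) = Q" "tps I Q G E N C X Y 2 = G"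
  "tps I Q G E N C X Y 3 = E" "tps I Q G E N C X Y 4 = N" "tps I Q G E N C X Y 5 = C"
  "tps I Q G E N C X Y 6 = X" "tps I Q G E N C X Y 7 = Y"
  by (simp_all add: tps_def)

lemma less_8_cases:
  "j < 8 \<Longrightarrow> j = 0 \<or> j = 1 \<or> j = 2 \<or> j = 3 \<or> j = 4 \<or> j = 5 \<or> j = 6 \<or> j = (7::nat)"
  by linarith

lemma tps_upd [simp]:
  "(tps I Q G E N C X Y)(0 := t) = tps t Q G E N C X Y"
  "(tps I Q G E N C X Y)(Suc 0 := t) = tps I t G E N C X Y"
  "(tps I Q G E N C X Y)(2 := t) = tps I Q t E N C X Y"
  "(tps I Q G E N C X Y)(3 := t) = tps I Q G t N C X Y"
  "(tps I Q G E N C X Y)(4 := t) = tps I Q G E t C X Y"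
  "(tps I Q G E N C X Y)(5 := t) = tps I Q G E N t X Y"
  "(tps I Q G E N C X Y)(6 := t) = tps I Q G E N C t Y"
  "(tps I Q G E N C X Y)(7 := t) = tps I Q G E N C X t"
  by (auto simp: tps_def fun_eq_iff dest!: less_8_cases)

lemma reads_tps [simp]: "reads (tps I Q G E N C X Y) j = tape_read (tps I Q G E N C X Y j)"
  by (simp add: reads_def)

lemma matches_simps [simp]:
  "matches [] f" "matches ((j, S) # g) f \<longleftrightarrow> f j \<in> set S \<and> matches g f"
  by (auto simp: matches_def)

lemma act_of_simps [simp]:
  "act_of [] f j = (f j, Stay)"
  "act_of ((i, w, m) # a) f j = (if i = j then (wval f w, m) else act_of a f j)"
  by (auto simp: act_of_def)

lemma act_of_other: "j \<notin> fst ` set a \<Longrightarrow> act_of a f j = (f j, Stay)"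
  by (induction a) auto

text \<open>Lets the simplifier execute the tables tape by tape on symbolic inscriptions.\<close>

lemma ap_tps [simp]:
  assumes "\<forall>j\<in>fst ` set a. j < 8"
  shows "ap a (tps I Q G E N C X Y) =
    (let f = reads (tps I Q G E N C X Y) in
     tps (tape_act (act_of a f 0) I) (tape_act (act_of a f 1) Q) (tape_act (act_of a f 2) G)
       (tape_act (act_of a f 3) E) (tape_act (act_of a f 4) N) (tape_act (act_of a f 5) C)
       (tape_act (act_of a f 6) X) (tape_act (act_of a f 7) Y))" (is "?L = ?R")
proof
  fix j
  show "?L j = ?R j"
  proof (cases "j < 8")
    case True
    then show ?thesis using less_8_cases[OF True] by (auto simp: ap_def Let_def)
  next
    case False
    then have "j \<notin> fst ` set a" using assms by blast
    then show ?thesis using False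
      by (simp add: Let_def ap_def act_of_other tps_def reads_def tape_act_def tape_read_def)
  qed
qed

datatype (plugins only: size) st = Z0 | Z1 | Z2 | Z3 | Z4 | Z5 | Z6 | Z7 | Z8
  | M1 nat | M2 nat | M3 nat | M4 nat | M5 nat | M6 nat
  | V0 | V1 | W0 | W1 | W2 | W3 | W4 | W5
  | S0 | A1 | A2 | A3 | D0 | D1 | B0 | B1 | B2 | B3 | B4 | B5 | B7 | B8 | B9 | B10
  | F1 | F2 | F3 | F4 | R1 | R2 | R3 | Qry | Yes | No | Acc

instance st :: countable
  by countable_datatype

text \<open>The symbols \<open>[0..<5]\<close> include the blank, so the head may start behind the
  inscription; from the marker 5 it steps back to cell 0.\<close>

definition rewind :: "nat \<Rightarrow> st \<Rightarrow> st \<Rightarrow> st rules" where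
  "rewind j q q' = [([(j, [5])], q', [(j, Cp j, GoRight)]), ([(j, [0..<5])], q, [(j, Cp j, GoLeft)])]"

definition erase :: "nat \<Rightarrow> st \<Rightarrow> st \<Rightarrow> st rules" where
  "erase j q q' = [([(j, [5])], q', [(j, Cp j, GoRight)]), ([(j, [0..<5])], q, [(j, W 0, GoLeft)])]"

text \<open>
  The states \<open>Z\<close> put the end markers and copy goal and number to their tapes; each round of
  \<open>M\<close> multiplies the unary number on tape 6 by the length of the input; \<open>V\<close> copies the result to the
  clock, whereas \<open>W\<close> adds, for every cell of it, tape 7 to the clock and the clock to tape 7.
\<close>

fun table1 :: "nat \<Rightarrow> bool \<Rightarrow> st \<Rightarrow> st rules" where
  "table1 k e Z0 = [([], Z1, map (\<lambda>j. (j, Cp j, GoLeft)) [0, 1, 2, 3, 4, 5, 6, 7])]"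
| "table1 k e Z1 = [([], Z2, map (\<lambda>j. (j, W 5, GoRight)) [0, 1, 2, 3, 4, 5, 6, 7])]"
| "table1 k e Z2 = [([(0, [1, 2, 3])], Z2, [(0, Cp 0, GoRight)]), ([(0, [4])], Z3, [(0, Cp 0, GoRight)])]"
| "table1 k e Z3 = [([(0, [1, 2])], Z3, [(0, Cp 0, GoRight), (3, Cp 0, GoRight)]),
     ([(0, [4])], Z4, [(0, Cp 0, GoRight)])]"
| "table1 k e Z4 = [([(0, [1, 2])], Z4, [(0, Cp 0, GoRight), (4, Cp 0, GoRight)]), ([(0, [0])], Z5, [])]"
| "table1 k e Z5 = rewind 0 Z5 Z6"
| "table1 k e Z6 = rewind 3 Z6 Z7"
| "table1 k e Z7 = rewind 4 Z7 Z8"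
| "table1 k e Z8 = [([], M1 0, [(6, W 1, Stay)])]"
| "table1 k e (M1 j) = (if j < k then [([(6, [1])], M2 j, [(6, Cp 6, GoRight)]), ([(6, [0])], M4 j, [])]
     else if j = k then [([], if e then W0 else V0, [])] else [])"
| "table1 k e (M2 j) = (if j < k then [([(0, [1, 2, 3, 4])], M2 j, [(0, Cp 0, GoRight), (7, W 1, GoRight)]),
     ([(0, [0])], M3 j, [])] else [])"
| "table1 k e (M3 j) = (if j < k then rewind 0 (M3 j) (M1 j) else [])"
| "table1 k e (M4 j) = (if j < k then erase 6 (M4 j) (M5 j) else [])"
| "table1 k e (M5 j) = (if j < k then [([(7, [0])], M5 j, [(7, Cp 7, GoLeft)]),
     ([(7, [1])], M5 j, [(7, W 0, GoLeft), (6, W 1, GoRight)]), ([(7, [5])], M6 j, [(7, Cp 7, GoRight)])] else [])"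
| "table1 k e (M6 j) = (if j < k then rewind 6 (M6 j) (M1 (Suc j)) else [])"
| "table1 k e V0 = [([(6, [1])], V0, [(6, Cp 6, GoRight), (5, W 1, GoRight)]), ([(6, [0])], V1, [])]"
| "table1 k e V1 = rewind 5 V1 S0"
| "table1 k e W0 = [([], W1, [(5, W 1, GoRight), (7, W 1, GoRight)])]"
| "table1 k e W1 = [([(6, [1])], W2, [(6, Cp 6, GoRight)]), ([(6, [0])], V1, [])]"
| "table1 k e W2 = rewind 7 W2 W3"
| "table1 k e W3 = [([(7, [1])], W3, [(7, Cp 7, GoRight), (5, W 1, GoRight)]), ([(7, [0])], W4, [])]"
| "table1 k e W4 = rewind 5 W4 W5"
| "table1 k e W5 = [([(5, [1])], W5, [(5, Cp 5, GoRight), (7, W 1, GoRight)]), ([(5, [0])], W1, [])]"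
| "table1 k e _ = []"

text \<open>
  From \<open>S0\<close>, the machine either compares the goal with an element of the theory (\<open>A\<close>), or
  decrements the number of vertices (\<open>D\<close>) and guesses a new vertex (\<open>B\<close>), or checks that some
  guessed vertex is labelled by the goal (\<open>F\<close>). In the last case it marks the goal by 3, so that
  \<open>Yes\<close> knows the purpose of the query.
\<close>

fun table2 :: "st \<Rightarrow> st rules" where
  "table2 S0 = [([], A1, []), ([], D0, []), ([], F1, [(1, W 4, GoRight)])]"
| "table2 A1 = [([(0, [1, 2, 3])], A2, []), ([(0, [1, 2, 3])], A3, [])]"
| "table2 A2 = [([(0, [1, 2])], A2, [(0, Cp 0, GoRight)]), ([(0, [3])], A1, [(0, Cp 0, GoRight)])]"
| "table2 A3 = [([(0, [1]), (3, [1])], A3, [(0, Cp 0, GoRight), (3, Cp 3, GoRight)]),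
     ([(0, [2]), (3, [2])], A3, [(0, Cp 0, GoRight), (3, Cp 3, GoRight)]),
     ([(0, [3]), (3, [0]), (4, [1, 2])], Acc, [])]"
| "table2 D0 = [([(4, [1])], D0, [(4, W 2, GoRight)]), ([(4, [2])], D1, [(4, W 1, Stay)])]"
| "table2 D1 = rewind 4 D1 B0"
| "table2 B0 = [([], B1, [(1, W 3, GoRight)]), ([], B5, [(1, W 4, GoRight)])]"
| "table2 B1 = [([(2, [1, 2, 3])], B2, []), ([(2, [1, 2, 3])], B3, []), ([(2, [0])], B4, [])]"
| "table2 B2 = [([(2, [1, 2])], B2, [(2, Cp 2, GoRight)]), ([(2, [3])], B1, [(2, Cp 2, GoRight)])]"
| "table2 B3 = [([(2, [1, 2])], B3, [(2, Cp 2, GoRight), (1, Cp 2, GoRight)]),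
     ([(2, [3])], B1, [(2, Cp 2, GoRight), (1, Cp 2, GoRight)])]"
| "table2 B4 = [([], B4, [(1, W 1, GoRight), (2, W 1, GoRight)]),
     ([], B4, [(1, W 2, GoRight), (2, W 2, GoRight)]), ([], Qry, [(1, W 3, GoRight), (2, W 3, GoRight)])]"
| "table2 B5 = [([(2, [1, 2, 3])], B5, [(2, Cp 2, GoRight)]), ([(2, [0])], B7, [])]"
| "table2 B7 = [([], B7, [(1, W 1, GoRight), (2, W 1, GoRight)]),
     ([], B7, [(1, W 2, GoRight), (2, W 2, GoRight)]), ([], B8, [(1, W 3, GoRight), (2, W 3, GoRight)])]"
| "table2 B8 = [([(0, [1, 2, 3])], B9, []), ([(0, [1, 2, 3])], B10, [])]"
| "table2 B9 = [([(0, [1, 2])], B9, [(0, Cp 0, GoRight)]), ([(0, [3])], B8, [(0, Cp 0, GoRight)])]"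
| "table2 B10 = [([(0, [1, 2])], B10, [(0, Cp 0, GoRight), (1, Cp 0, GoRight)]), ([(0, [3])], Qry, [])]"
| "table2 F1 = [([(2, [1, 2, 3])], F2, []), ([(2, [1, 2, 3])], F3, [])]"
| "table2 F2 = [([(2, [1, 2])], F2, [(2, Cp 2, GoRight)]), ([(2, [3])], F1, [(2, Cp 2, GoRight)])]"
| "table2 F3 = [([(2, [1, 2])], F3, [(2, Cp 2, GoRight), (1, Cp 2, GoRight)]),
     ([(2, [3])], F4, [(2, Cp 2, GoRight), (1, Cp 2, GoRight)])]"
| "table2 F4 = [([(3, [1, 2])], F4, [(3, Cp 3, GoRight), (1, Cp 3, GoRight)]), ([(3, [0])], Qry, [(3, W 3, Stay)])]"
| "table2 Yes = [([(3, [3])], Acc, []), ([(3, [0, 1, 2])], R1, [])]"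
| "table2 R1 = erase 1 R1 R2"
| "table2 R2 = rewind 2 R2 R3"
| "table2 R3 = rewind 0 R3 S0"
| "table2 _ = []"

text \<open>The start state \<open>Z0\<close> has no rules in \<open>table2\<close>; it becomes
  meaningful once \<open>clocked\<close> adds the preprocessing table.\<close>

definition checker :: "st machine" where
  "checker = \<lparr>table = table2, st_init = Z0, st_acc = Acc, st_qry = Qry, st_yes = Yes, st_no = No\<rparr>"

lemma checker_simps [simp]:
  "table checker = table2" "st_init checker = Z0" "st_acc checker = Acc" "st_qry checker = Qry"
  "st_yes checker = Yes" "st_no checker = No"
  by (simp_all add: checker_def)

text \<open>The type \<open>st\<close> is infinite, but the round counter in \<open>M1 j\<close> to
  \<open>M6 j\<close> has rules only for j \<le> k.\<close>

lemma finite_table: "finite {q. table (clocked i (table1 k e) checker) q \<noteq> []}"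
proof (rule finite_subset)
  let ?S = "set [Z0, Z1, Z2, Z3, Z4, Z5, Z6, Z7, Z8, V0, V1, W0, W1, W2, W3, W4, W5,
     S0, A1, A2, A3, D0, D1, B0, B1, B2, B3, B4, B5, B7, B8, B9, B10, F1, F2, F3, F4, R1, R2, R3,
     Qry, Yes, No, Acc] \<union> M1 ` {..k} \<union> M2 ` {..k} \<union> M3 ` {..k} \<union> M4 ` {..k} \<union> M5 ` {..k} \<union> M6 ` {..k}"
  show "finite ?S" by simp
  show "{q. table (clocked i (table1 k e) checker) q \<noteq> []} \<subseteq> ?S"
  proof
    fix q assume "q \<in> {q. table (clocked i (table1 k e) checker) q \<noteq> []}"
    then show "q \<in> ?S" by (cases q) (auto simp: clocked_def split: if_splits)
  qed
qed

lemma table1_ok: "\<forall>r\<in>set (table1 k e q). rule_ok 8 5 r"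
  by (cases q) (auto simp: rule_ok_def rewind_def erase_def)

lemma table2_ok: "\<forall>r\<in>set (table2 q). rule_ok 8 5 r"
  by (cases q) (auto simp: rule_ok_def rewind_def erase_def)

lemma table1_Nil_if_target: "(g, q', a) \<in> set (table2 q) \<Longrightarrow> table1 k e q' = []"
  by (cases q) (auto simp: rewind_def erase_def)

lemma table2_Nil: "table1 k e q \<noteq> [] \<Longrightarrow> table2 q = []"
  by (cases q) auto

lemma table2_avoids: "r \<in> set (table2 q) \<Longrightarrow> avoids 5 r"
  by (cases q) (auto simp: avoids_def rewind_def erase_def)

abbreviation machine :: "nat \<Rightarrow> bool \<Rightarrow> st machine" where
  "machine k e \<equiv> clocked 5 (table1 k e) checker"

interpretation checker: clocked_machine 5 "table1 k e" checker
  by unfold_locales (auto simp: table2_avoids table1_Nil_if_target)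

lemma machine_ok: "machine_ok 8 5 (machine k e)"
proof -
  have "rule_ok 8 5 r" if "r \<in> set (table (machine k e) q)" for r q
    using that table1_ok[of k e q] table2_ok[of q]
    by (force simp: clocked_def rule_ok_def)
  then show ?thesis
    unfolding machine_ok_def using finite_table by (auto simp: clocked_def)
qed


section \<open>Preprocessing\<close>

lemmas [trans] = drun_trans

text \<open>Upper bounds suffice for preprocessing, in contrast to the checking phase, where
  \<open>drun\<close> is used with exact costs.\<close>

definition drun_le :: "('q \<Rightarrow> 'q rules) \<Rightarrow> nat \<Rightarrow> 'q \<times> (nat \<Rightarrow> tape) \<Rightarrow> 'q \<times> (nat \<Rightarrow> tape) \<Rightarrow> bool" where
  "drun_le T t c c' \<longleftrightarrow> (\<exists>k\<le>t. drun T k c c')"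

lemma drun_leI: "drun T k c c' \<Longrightarrow> k \<le> t \<Longrightarrow> drun_le T t c c'"
  by (auto simp: drun_le_def)

lemma drun_le_refl: "drun_le T t c c"
  by (rule drun_leI[OF drun_0]) simp

lemma drun_le_trans: "drun_le T s c c' \<Longrightarrow> drun_le T t c' c'' \<Longrightarrow> s + t \<le> u \<Longrightarrow> drun_le T u c c''"
  unfolding drun_le_def by (metis add_mono drun_trans le_trans)

lemma tp_blank [simp]: "tp l [0] = tp l []"
  using tp_trailing_blank[of l "[]"] by simp

lemma ap_single: "ap [(j, w, m)] F = F(j := tape_act (wval (reads F) w, m) (F j))"
  by (auto simp: fun_eq_iff ap_def reads_def)

text \<open>Besides the moves across \<open>xs\<close>, the 2 counts the step onto the marker and
  the step back to cell 0.\<close>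

lemma drun_rewind:
  assumes "T q = rewind j q q'" "F j = tp (xs @ [5]) r" "set xs \<subseteq> {1..<5}" "r = [] \<or> hd r \<in> {1..<5}"
  shows "drun T (length xs + 2) (q, F) (q', F(j := tp [5] (rev xs @ r)))"
  using assms
proof (induction xs arbitrary: F r)
  case Nil
  have "steps T q F = [(q, F(j := tp [] (5 # r)))]"
    using Nil by (cases r; cases "tl r") (auto simp: steps_def rewind_def ap_single reads_def)
  moreover have "steps T q (F(j := tp [] (5 # r))) = [(q', F(j := tp [5] r))]"
    using Nil by (simp add: steps_def rewind_def ap_single reads_def)
  ultimately show ?case by (simp add: drun_Suc drun_0 del: fun_upd_apply)
next
  case (Cons x xs)
  have "steps T q F = [(q, F(j := tp (xs @ [5]) (x # r)))]"
    using Cons.prems by (cases r; cases "tl r") (auto simp: steps_def rewind_def ap_single reads_def)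
  moreover have "drun T (length xs + 2) (q, F(j := tp (xs @ [5]) (x # r)))
      (q', F(j := tp [5] (rev xs @ x # r)))"
    using Cons.IH[of "F(j := tp (xs @ [5]) (x # r))" "x # r"] Cons.prems
    by (auto simp: fun_upd_same simp del: fun_upd_apply)
  ultimately show ?case by (simp add: drun_Suc del: fun_upd_apply)
qed

lemma drun_erase:
  assumes "T q = erase j q q'" "F j = tp (xs @ [5]) r" "set xs \<subseteq> {1..<5}" "r = [] \<or> (\<exists>x\<in>{1..<5}. r = [x])"
  shows "drun T (length xs + 2) (q, F) (q', F(j := tp [5] []))"
  using assms
proof (induction xs arbitrary: F r)
  case Nil
  have "steps T q F = [(q, F(j := tp [] [5]))]"
    using Nil by (cases r) (auto simp: steps_def erase_def ap_single reads_def)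
  moreover have "steps T q (F(j := tp [] [5])) = [(q', F(j := tp [5] []))]"
    using Nil by (simp add: steps_def erase_def ap_single reads_def)
  ultimately show ?case by (simp add: drun_Suc drun_0 del: fun_upd_apply)
next
  case (Cons x xs)
  have "steps T q F = [(q, F(j := tp (xs @ [5]) [x]))]"
    using Cons.prems by (cases r) (auto simp: steps_def erase_def ap_single reads_def)
  moreover have "drun T (length xs + 2) (q, F(j := tp (xs @ [5]) [x])) (q', F(j := tp [5] []))"
    using Cons.IH[of "F(j := tp (xs @ [5]) [x])" "[x]"] Cons.prems
    by (auto simp: fun_upd_same simp del: fun_upd_apply)
  ultimately show ?case by (simp add: drun_Suc del: fun_upd_apply)
qed

abbreviation ones :: "nat \<Rightarrow> nat list" where
  "ones n \<equiv> replicate n (Suc 0)"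

lemma ones_Cons: "ones n @ Suc 0 # xs = Suc 0 # ones n @ xs"
  by (induction n) auto

lemma set_ones [simp]: "set (ones n) \<subseteq> {Suc 0..<5}"
  by auto

lemma tape_act_init: "tape_act (5, GoRight) (tape_act (tape_read (input_tape w), GoLeft) (input_tape w)) = tp [5] w"
  by (rule prod_eqI) (auto simp: tape_act_def tape_read_def input_tape_def tp_def fun_eq_iff nth_Cons' nat_add_distrib nat_diff_distrib)

context
  fixes k :: nat and e :: bool
begin

abbreviation (input) "T1 \<equiv> table1 k e"

section \<open>Splitting the input into theory, goal and number\<close>

lemma run_Z0:
  "drun T1 2 (Z0, tps (input_tape w) (input_tape []) (input_tape []) (input_tape []) (input_tape [])
     (input_tape []) (input_tape []) (input_tape []))
   (Z2, tps (tp [5] w) (tp [5] []) (tp [5] []) (tp [5] []) (tp [5] []) (tp [5] []) (tp [5] []) (tp [5] []))"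
proof -
  have "steps T1 Z0 (tps (input_tape w) (input_tape []) (input_tape []) (input_tape []) (input_tape [])
     (input_tape []) (input_tape []) (input_tape [])) = [(Z1, 
    let g = (\<lambda>w. tape_act (tape_read (input_tape w), GoLeft) (input_tape w)) in
    tps (g w) (g []) (g []) (g []) (g []) (g []) (g []) (g []))]"
    by (simp add: steps_def)
  then show ?thesis
    by (simp add: numeral_2_eq_2, elim drun_Suc)
      (rule drun_Suc[OF _ drun_0], simp add: steps_def tape_act_init)
qed

lemma run_Z2:
  assumes "set xs \<subseteq> {1, 2, 3}"
  shows "drun T1 (length xs + 1) (Z2, tps (tp l (xs @ 4 # r)) Q G E N C X Y)
     (Z3, tps (tp (4 # rev xs @ l) r) Q G E N C X Y)"
  using assms
proof (induction xs arbitrary: l)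
  case (Cons x xs)
  show ?case
    using Cons.prems drun_Suc[OF _ Cons.IH[of "x # l"], of Z2] by (auto simp: steps_def)
qed (simp add: drun_Suc drun_0 steps_def)

lemma run_Z3:
  assumes "set xs \<subseteq> {1, 2}"
  shows "drun T1 (length xs + 1) (Z3, tps (tp l (xs @ 4 # r)) Q G (tp m []) N C X Y)
     (Z4, tps (tp (4 # rev xs @ l) r) Q G (tp (rev xs @ m) []) N C X Y)"
  using assms
proof (induction xs arbitrary: l m)
  case (Cons x xs)
  show ?case
    using Cons.prems drun_Suc[OF _ Cons.IH[of "x # l" "x # m"], of Z3] by (auto simp: steps_def)
qed (simp add: drun_Suc drun_0 steps_def)

lemma run_Z4:
  assumes "set xs \<subseteq> {1, 2}"
  shows "drun T1 (length xs + 1) (Z4, tps (tp l xs) Q G E (tp m []) C X Y)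
     (Z5, tps (tp (rev xs @ l) []) Q G E (tp (rev xs @ m) []) C X Y)"
  using assms
proof (induction xs arbitrary: l m)
  case (Cons x xs)
  show ?case
    using Cons.prems drun_Suc[OF _ Cons.IH[of "x # l" "x # m"], of Z4] by (auto simp: steps_def)
qed (simp add: drun_Suc drun_0 steps_def)

lemma run_split:
  assumes "set ts \<subseteq> {1, 2, 3}" "set es \<subseteq> {1, 2}" "set ns \<subseteq> {1, 2}"
    and w: "w = ts @ [4] @ es @ [4] @ ns"
  shows "drun_le T1 (3 * length w + 12) (Z0, tps (input_tape w) (input_tape []) (input_tape []) (input_tape [])
      (input_tape []) (input_tape []) (input_tape []) (input_tape []))
    (M1 0, tps (tp [5] w) (tp [5] []) (tp [5] []) (tp [5] es) (tp [5] ns) (tp [5] []) (tp [5] [1]) (tp [5] []))"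
proof -
  let ?B = "tp [5] []"
  have "set ts \<subseteq> {1..<5}" "set es \<subseteq> {1..<5}" "set ns \<subseteq> {1..<5}"
    using assms(1-3) by (auto dest!: subsetD)
  note sub = this[unfolded One_nat_def]
  note run_Z0[of w]
  also have "drun T1 (length ts + 1) (Z2, tps (tp [5] w) ?B ?B ?B ?B ?B ?B ?B)
    (Z3, tps (tp (4 # rev ts @ [5]) (es @ 4 # ns)) ?B ?B ?B ?B ?B ?B ?B)"
    using run_Z2[OF assms(1), of "[5]" "es @ 4 # ns"] w by simp
  also note run_Z3[OF assms(2)]
  also note run_Z4[OF assms(3)]
  also have "drun T1 (length w + 2)
     (Z5, tps (tp (rev ns @ 4 # rev es @ 4 # rev ts @ [5]) []) ?B ?B (tp (rev es @ [5]) []) (tp (rev ns @ [5]) []) ?B ?B ?B)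
     (Z6, tps (tp [5] w) ?B ?B (tp (rev es @ [5]) []) (tp (rev ns @ [5]) []) ?B ?B ?B)"
    using drun_rewind[of T1 Z5 0 Z6 "tps (tp (rev ns @ 4 # rev es @ 4 # rev ts @ [5]) []) ?B ?B
      (tp (rev es @ [5]) []) (tp (rev ns @ [5]) []) ?B ?B ?B" "rev w" "[]"] sub by (simp add: w add.commute add.left_commute)
  also have "drun T1 (length es + 2)
     (Z6, tps (tp [5] w) ?B ?B (tp (rev es @ [5]) []) (tp (rev ns @ [5]) []) ?B ?B ?B)
     (Z7, tps (tp [5] w) ?B ?B (tp [5] es) (tp (rev ns @ [5]) []) ?B ?B ?B)"
    using drun_rewind[of T1 Z6 3 Z7 "tps (tp [5] w) ?B ?B
      (tp (rev es @ [5]) []) (tp (rev ns @ [5]) []) ?B ?B ?B" "rev es" "[]"] sub by (simp add: w add.commute add.left_commute)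
  also have "drun T1 (length ns + 2)
     (Z7, tps (tp [5] w) ?B ?B (tp [5] es) (tp (rev ns @ [5]) []) ?B ?B ?B)
     (Z8, tps (tp [5] w) ?B ?B (tp [5] es) (tp [5] ns) ?B ?B ?B)"
    using drun_rewind[of T1 Z7 4 Z8 "tps (tp [5] w) ?B ?B
      (tp [5] es) (tp (rev ns @ [5]) []) ?B ?B ?B" "rev ns" "[]"] sub by (simp add: w add.commute add.left_commute)
  also have "drun T1 1 (Z8, tps (tp [5] w) ?B ?B (tp [5] es) (tp [5] ns) ?B ?B ?B)
     (M1 0, tps (tp [5] w) ?B ?B (tp [5] es) (tp [5] ns) ?B (tp [5] [1]) ?B)"
    by (rule drun_1) (simp add: steps_def)
  finally show ?thesis by (rule drun_leI) (simp add: w)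
qed

section \<open>Unary powers of the input length\<close>

lemma run_M2:
  assumes "j < k" "set xs \<subseteq> {1..<5}"
  shows "drun T1 (length xs + 1) (M2 j, tps (tp l xs) Q G E N C X (tp m []))
     (M3 j, tps (tp (rev xs @ l) []) Q G E N C X (tp (ones (length xs) @ m) []))"
  using assms(2)
proof (induction xs arbitrary: l m)
  case (Cons x xs)
  have "x \<in> {1, 2, 3, 4}" using Cons.prems by auto
  then have "steps T1 (M2 j) (tps (tp l (x # xs)) Q G E N C X (tp m [])) =
    [(M2 j, tps (tp (x # l) xs) Q G E N C X (tp (1 # m) []))]"
    using assms(1) by (auto simp: steps_def)
  from drun_Suc[OF this Cons.IH] show ?case using Cons.prems by (simp add: ones_Cons)
qed (use assms(1) in \<open>simp add: drun_Suc drun_0 steps_def\<close>)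

lemma run_M1_cell:
  assumes "j < k" "set w \<subseteq> {1..<5}"
  shows "drun T1 (2 * length w + 4) (M1 j, tps (tp [5] w) Q G E N C (tp l (1 # r)) (tp m []))
     (M1 j, tps (tp [5] w) Q G E N C (tp (1 # l) r) (tp (ones (length w) @ m) []))"
proof -
  have "drun T1 1 (M1 j, tps (tp [5] w) Q G E N C (tp l (1 # r)) (tp m []))
     (M2 j, tps (tp [5] w) Q G E N C (tp (1 # l) r) (tp m []))"
    using assms by (intro drun_1) (simp add: steps_def)
  also note run_M2[OF assms]
  also have "drun T1 (length w + 2)
     (M3 j, tps (tp (rev w @ [5]) []) Q G E N C (tp (1 # l) r) (tp (ones (length w) @ m) []))
     (M1 j, tps (tp [5] w) Q G E N C (tp (1 # l) r) (tp (ones (length w) @ m) []))"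
    using drun_rewind[of T1 "M3 j" 0 "M1 j" "tps (tp (rev w @ [5]) []) Q G E N C (tp (1 # l) r)
      (tp (ones (length w) @ m) [])" "rev w" "[]"] assms by simp
  finally have *: "drun T1 (1 + (length w + 1) + (length w + 2))
     (M1 j, tps (tp [5] w) Q G E N C (tp l (1 # r)) (tp m []))
     (M1 j, tps (tp [5] w) Q G E N C (tp (1 # l) r) (tp (ones (length w) @ m) []))" .
  have "1 + (length w + 1) + (length w + 2) = 2 * length w + 4" by simp
  with * show ?thesis by (simp only:)
qed

lemma run_M1:
  assumes "j < k" "set w \<subseteq> {1..<5}"
  shows "drun T1 (x * (2 * length w + 4) + 1) (M1 j, tps (tp [5] w) Q G E N C (tp l (ones x)) (tp m []))
     (M4 j, tps (tp [5] w) Q G E N C (tp (ones x @ l) []) (tp (ones (x * length w) @ m) []))"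
proof (induction x arbitrary: l m)
  case 0
  have "steps T1 (M1 j) (tps (tp [5] w) Q G E N C (tp l []) (tp m [])) =
    [(M4 j, tps (tp [5] w) Q G E N C (tp l []) (tp m []))]"
    using assms by (simp add: steps_def)
  then show ?case by (simp add: drun_Suc drun_0)
next
  case (Suc x)
  have "drun T1 (2 * length w + 4 + (x * (2 * length w + 4) + 1))
     (M1 j, tps (tp [5] w) Q G E N C (tp l (ones (Suc x))) (tp m []))
     (M4 j, tps (tp [5] w) Q G E N C (tp (ones x @ 1 # l) []) (tp (ones (x * length w) @ ones (length w) @ m) []))"
    using drun_trans[OF run_M1_cell[OF assms, of Q G E N C l "ones x" m] Suc.IH[of "1 # l" "ones (length w) @ m"]]
    by simp
  moreover have "ones (x * length w) @ ones (length w) @ m = ones (Suc x * length w) @ m"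
    by (metis add.commute append.assoc mult_Suc replicate_add)
  moreover have "ones x @ 1 # l = ones (Suc x) @ l" by (simp add: ones_Cons)
  moreover have "2 * length w + 4 + (x * (2 * length w + 4) + 1) = Suc x * (2 * length w + 4) + 1" by simp
  ultimately show ?case by (simp only:)
qed

text \<open>The product is moved rather than copied: tape 7 is erased from the right and is
  therefore empty for the next round. The run starts on its last 1, with \<open>z\<close> ones to
  the left.\<close>

lemma run_M5:
  assumes "j < k"
  shows "drun T1 (z + 2) (M5 j, tps I Q G E N C (tp l []) (tp (ones z @ [5]) [1]))
    (M6 j, tps I Q G E N C (tp (ones (Suc z) @ l) []) (tp [5] []))"
proof (induction z arbitrary: l)
  case 0
  have "drun T1 (Suc (Suc 0)) (M5 j, tps I Q G E N C (tp l []) (tp (ones 0 @ [5]) [1]))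
    (M6 j, tps I Q G E N C (tp (ones (Suc 0) @ l) []) (tp [5] []))"
    by (rule drun_Suc, use assms in \<open>simp add: steps_def\<close>, rule drun_Suc,
        use assms in \<open>simp add: steps_def\<close>, simp add: drun_0)
  then show ?case by (simp add: numeral_2_eq_2)
next
  case (Suc z)
  have "steps T1 (M5 j) (tps I Q G E N C (tp l []) (tp (ones (Suc z) @ [5]) [1])) =
    [(M5 j, tps I Q G E N C (tp (1 # l) []) (tp (ones z @ [5]) [1]))]"
    using assms by (simp add: steps_def)
  from drun_Suc[OF this Suc.IH[of "1 # l"]] show ?case by (simp add: ones_Cons)
qed

lemma run_multiply:
  assumes "j < k" "set w \<subseteq> {1..<5}" "w \<noteq> []" "0 < x"
  shows "drun_le T1 (16 * (x * length w)) (M1 j, tps (tp [5] w) Q G E N C (tp [5] (ones x)) (tp [5] []))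
     (M1 (Suc j), tps (tp [5] w) Q G E N C (tp [5] (ones (x * length w))) (tp [5] []))"
proof -
  from assms(3,4) obtain z where z: "x * length w = Suc z" by (metis length_greater_0_conv nat_0_less_mult_iff Suc_pred)
  note run_M1[OF assms(1,2)]
  also have "drun T1 (x + 2)
     (M4 j, tps (tp [5] w) Q G E N C (tp (ones x @ [5]) []) (tp (ones (x * length w) @ [5]) []))
     (M5 j, tps (tp [5] w) Q G E N C (tp [5] []) (tp (ones (x * length w) @ [5]) []))"
    using drun_erase[of T1 "M4 j" 6 "M5 j" "tps (tp [5] w) Q G E N C (tp (ones x @ [5]) [])
      (tp (ones (x * length w) @ [5]) [])" "ones x" "[]"] assms by auto
  also have "drun T1 1 (M5 j, tps (tp [5] w) Q G E N C (tp [5] []) (tp (ones (x * length w) @ [5]) []))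
     (M5 j, tps (tp [5] w) Q G E N C (tp [5] []) (tp (ones z @ [5]) [1]))"
    using assms unfolding z by (intro drun_1) (simp add: steps_def)
  also note run_M5[OF assms(1)]
  also have "drun T1 (Suc z + 2)
     (M6 j, tps (tp [5] w) Q G E N C (tp (ones (Suc z) @ [5]) []) (tp [5] []))
     (M1 (Suc j), tps (tp [5] w) Q G E N C (tp [5] (ones (Suc z))) (tp [5] []))"
    using drun_rewind[of T1 "M6 j" 6 "M1 (Suc j)" "tps (tp [5] w) Q G E N C (tp (ones (Suc z) @ [5]) []) (tp [5] [])"
      "ones (Suc z)" "[]"] assms by (auto simp: ones_Cons)
  finally have 1: "drun T1 (x * (2 * length w + 4) + 1 + (x + 2) + 1 + (z + 2) + (Suc z + 2))
    (M1 j, tps (tp [5] w) Q G E N C (tp [5] (ones x)) (tp [5] []))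
    (M1 (Suc j), tps (tp [5] w) Q G E N C (tp [5] (ones (Suc z))) (tp [5] []))" .
  have "x \<le> x * length w" using assms(3) by (cases w) auto
  \<comment> \<open>With \<open>L = length w\<close> the exact cost is 4 * x * L + 5 * x + 7, and 16
    = 4 + 5 + 7.\<close>
  then have "x * (2 * length w + 4) + 1 + (x + 2) + 1 + (z + 2) + (Suc z + 2) \<le> 16 * (x * length w)"
    using z by (simp add: distrib_left)
  with 1 show ?thesis unfolding z by (rule drun_leI)
qed

lemma run_power:
  assumes "set w \<subseteq> {1..<5}" "w \<noteq> []" "j \<le> k"
  shows "drun_le T1 (16 * j * length w ^ j) (M1 0, tps (tp [5] w) Q G E N C (tp [5] [1]) (tp [5] []))
    (M1 j, tps (tp [5] w) Q G E N C (tp [5] (ones (length w ^ j))) (tp [5] []))"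
  using assms(3)
proof (induction j)
  case 0
  show ?case by (simp add: drun_le_refl)
next
  case (Suc j)
  have pos: "0 < length w ^ j" using assms(2) by simp
  have "16 * j * length w ^ j \<le> 16 * j * length w ^ Suc j"
    using assms(2) by (intro mult_le_mono2 power_increasing) (auto simp: Suc_leI)
  then have le: "16 * j * length w ^ j + 16 * (length w ^ j * length w) \<le> 16 * Suc j * length w ^ Suc j"
    by (simp add: algebra_simps)
  have "drun_le T1 (16 * (length w ^ j * length w)) (M1 j, tps (tp [5] w) Q G E N C (tp [5] (ones (length w ^ j))) (tp [5] []))
    (M1 (Suc j), tps (tp [5] w) Q G E N C (tp [5] (ones (length w ^ Suc j))) (tp [5] []))"
    using run_multiply[OF _ assms(1,2) pos, of j Q G E N C] Suc.prems by (simp add: mult.commute)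
  with Suc le show ?case by (intro drun_le_trans[OF Suc.IH]) auto
qed

section \<open>Writing the clock\<close>

lemma run_V0:
  "drun T1 (c + 1) (V0, tps I Q G E N (tp m []) (tp l (ones c)) Y)
    (V1, tps I Q G E N (tp (ones c @ m) []) (tp (ones c @ l) []) Y)"
proof (induction c arbitrary: l m)
  case (Suc c)
  have "steps T1 V0 (tps I Q G E N (tp m []) (tp l (ones (Suc c))) Y) =
    [(V0, tps I Q G E N (tp (1 # m) []) (tp (1 # l) (ones c)) Y)]"
    by (simp add: steps_def)
  from drun_Suc[OF this Suc.IH[of "1 # m" "1 # l"]] show ?case by (simp add: ones_Cons)
qed (simp add: drun_Suc drun_0 steps_def)

lemma run_V1:
  "drun T1 (c + 2) (V1, tps I Q G E N (tp (ones c @ [5]) []) X Y)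
    (S0, tps I Q G E N (clock 0 c) X Y)"
  using drun_rewind[of T1 V1 5 S0 "tps I Q G E N (tp (ones c @ [5]) []) X Y" "ones c" "[]"]
  by (auto simp: clock_def split: if_splits)

lemma run_W3:
  "drun T1 (b + 1) (W3, tps I Q G E N (tp m []) X (tp l (ones b)))
    (W4, tps I Q G E N (tp (ones b @ m) []) X (tp (ones b @ l) []))"
proof (induction b arbitrary: l m)
  case (Suc c)
  have "steps T1 W3 (tps I Q G E N (tp m []) X (tp l (ones (Suc c)))) =
    [(W3, tps I Q G E N (tp (1 # m) []) X (tp (1 # l) (ones c)))]"
    by (simp add: steps_def)
  from drun_Suc[OF this Suc.IH[of "1 # m" "1 # l"]] show ?case by (simp add: ones_Cons)
qed (simp add: drun_Suc drun_0 steps_def)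

lemma run_W5:
  "drun T1 (b + 1) (W5, tps I Q G E N (tp l (ones b)) X (tp m []))
    (W1, tps I Q G E N (tp (ones b @ l) []) X (tp (ones b @ m) []))"
proof (induction b arbitrary: l m)
  case (Suc c)
  have "steps T1 W5 (tps I Q G E N (tp l (ones (Suc c))) X (tp m [])) =
    [(W5, tps I Q G E N (tp (1 # l) (ones c)) X (tp (1 # m) []))]"
    by (simp add: steps_def)
  from drun_Suc[OF this Suc.IH[of "1 # l" "1 # m"]] show ?case by (simp add: ones_Cons)
qed (simp add: drun_Suc drun_0 steps_def)

text \<open>Adding tape 7 to the clock and then the new clock to tape 7 makes two Fibonacci steps.
  Each addition appends a copy and leaves its source intact, so nothing has to be erased.\<close>

lemma run_W1_cell:
  "drun T1 (2 * a + 4 * b + 7) (W1, tps I Q G E N (tp (ones a @ [5]) []) (tp l (1 # r)) (tp (ones b @ [5]) []))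
    (W1, tps I Q G E N (tp (ones (a + b) @ [5]) []) (tp (1 # l) r) (tp (ones (a + b + b) @ [5]) []))"
proof -
  have "drun T1 1 (W1, tps I Q G E N (tp (ones a @ [5]) []) (tp l (1 # r)) (tp (ones b @ [5]) []))
    (W2, tps I Q G E N (tp (ones a @ [5]) []) (tp (1 # l) r) (tp (ones b @ [5]) []))"
    by (rule drun_1) (simp add: steps_def)
  also have "drun T1 (b + 2) (W2, tps I Q G E N (tp (ones a @ [5]) []) (tp (1 # l) r) (tp (ones b @ [5]) []))
    (W3, tps I Q G E N (tp (ones a @ [5]) []) (tp (1 # l) r) (tp [5] (ones b)))"
    using drun_rewind[of T1 W2 7 W3 "tps I Q G E N (tp (ones a @ [5]) []) (tp (1 # l) r) (tp (ones b @ [5]) [])"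
      "ones b" "[]"] by auto
  also have "drun T1 (b + 1) (W3, tps I Q G E N (tp (ones a @ [5]) []) (tp (1 # l) r) (tp [5] (ones b)))
    (W4, tps I Q G E N (tp (ones (a + b) @ [5]) []) (tp (1 # l) r) (tp (ones b @ [5]) []))"
    using run_W3[of b I Q G E N "ones a @ [5]"] by (simp add: replicate_add add.commute[of a])
  also have "drun T1 (a + b + 2) (W4, tps I Q G E N (tp (ones (a + b) @ [5]) []) (tp (1 # l) r) (tp (ones b @ [5]) []))
    (W5, tps I Q G E N (tp [5] (ones (a + b))) (tp (1 # l) r) (tp (ones b @ [5]) []))"
    using drun_rewind[of T1 W4 5 W5 "tps I Q G E N (tp (ones (a + b) @ [5]) []) (tp (1 # l) r) (tp (ones b @ [5]) [])"
      "ones (a + b)" "[]"] by auto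
  also have "drun T1 (a + b + 1) (W5, tps I Q G E N (tp [5] (ones (a + b))) (tp (1 # l) r) (tp (ones b @ [5]) []))
    (W1, tps I Q G E N (tp (ones (a + b) @ [5]) []) (tp (1 # l) r) (tp (ones (a + b + b) @ [5]) []))"
    using run_W5[of "a + b" I Q G E N "[5]" "tp (1 # l) r" "ones b @ [5]"] by (simp add: replicate_add)
  finally have *: "drun T1 (1 + (b + 2) + (b + 1) + (a + b + 2) + (a + b + 1))
    (W1, tps I Q G E N (tp (ones a @ [5]) []) (tp l (1 # r)) (tp (ones b @ [5]) []))
    (W1, tps I Q G E N (tp (ones (a + b) @ [5]) []) (tp (1 # l) r) (tp (ones (a + b + b) @ [5]) []))" .
  have "1 + (b + 2) + (b + 1) + (a + b + 2) + (a + b + 1) = 2 * a + 4 * b + 7" by simp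
  with * show ?thesis by (simp only:)
qed

text \<open>Only rough growth matters: with every cell the minimum of the pair at least doubles and
  its sum at most triples.\<close>

lemma run_W1:
  assumes "0 < a + b"
  shows "\<exists>a' b'. min a b * 2 ^ n \<le> a' \<and> a' \<le> (a + b) * 4 ^ n \<and>
    drun_le T1 (11 * (a + b) * 4 ^ n)
      (W1, tps I Q G E N (tp (ones a @ [5]) []) (tp l (ones n)) (tp (ones b @ [5]) []))
      (W1, tps I Q G E N (tp (ones a' @ [5]) []) (tp (ones n @ l) []) (tp (ones b' @ [5]) []))"
  using assms
proof (induction n arbitrary: a b l)
  case 0
  show ?case by (intro exI[of _ a] exI[of _ b]) (simp add: drun_le_refl)
next
  case (Suc n)
  \<comment> \<open>The first cell costs at most 11 * (a + b) because a + b is positive. The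
    remaining cells start from a sum at most three times as large, which gives the factor 33, and 11
    + 33 = 11 * 4.\<close>
  have le: "2 * a + 4 * b + 7 + 11 * (a + b + (a + b + b)) * 4 ^ n \<le> 11 * (a + b) * 4 ^ Suc n"
  proof -
    have "2 * a + 4 * b + 7 \<le> 11 * (a + b)" using Suc.prems by presburger
    also have "\<dots> \<le> 11 * (a + b) * 4 ^ n" by simp
    finally have "2 * a + 4 * b + 7 \<le> 11 * (a + b) * 4 ^ n" .
    moreover have "11 * (a + b + (a + b + b)) * 4 ^ n \<le> 11 * (3 * (a + b)) * 4 ^ n"
      by (intro mult_le_mono) simp_all
    ultimately show ?thesis by (simp add: algebra_simps)
  qed
  obtain a' b' where ab: "min (a + b) (a + b + b) * 2 ^ n \<le> a'" "a' \<le> (a + b + (a + b + b)) * 4 ^ n"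
    and run: "drun_le T1 (11 * (a + b + (a + b + b)) * 4 ^ n)
      (W1, tps I Q G E N (tp (ones (a + b) @ [5]) []) (tp (1 # l) (ones n)) (tp (ones (a + b + b) @ [5]) []))
      (W1, tps I Q G E N (tp (ones a' @ [5]) []) (tp (ones n @ 1 # l) []) (tp (ones b' @ [5]) []))"
    using Suc.IH[of "a + b" "a + b + b" "1 # l"] Suc.prems by auto
  have "min a b * 2 ^ Suc n = (2 * min a b) * 2 ^ n" by simp
  also have "\<dots> \<le> min (a + b) (a + b + b) * 2 ^ n" by (intro mult_le_mono1) auto
  also note ab(1)
  finally have "min a b * 2 ^ Suc n \<le> a'" .
  moreover have "a' \<le> (a + b) * 4 ^ Suc n"
  proof -
    have "(a + b + (a + b + b)) * 4 ^ n \<le> (4 * (a + b)) * 4 ^ n" by (intro mult_le_mono1) auto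
    then show ?thesis using ab by (simp add: algebra_simps)
  qed
  moreover have "drun_le T1 (11 * (a + b) * 4 ^ Suc n)
      (W1, tps I Q G E N (tp (ones a @ [5]) []) (tp l (ones (Suc n))) (tp (ones b @ [5]) []))
      (W1, tps I Q G E N (tp (ones a' @ [5]) []) (tp (ones (Suc n) @ l) []) (tp (ones b' @ [5]) []))"
  proof (rule drun_le_trans[OF _ _ le])
    show "drun_le T1 (2 * a + 4 * b + 7)
      (W1, tps I Q G E N (tp (ones a @ [5]) []) (tp l (ones (Suc n))) (tp (ones b @ [5]) []))
      (W1, tps I Q G E N (tp (ones (a + b) @ [5]) []) (tp (1 # l) (ones n)) (tp (ones (a + b + b) @ [5]) []))"
      using drun_leI[OF run_W1_cell[of a b I Q G E N l "ones n"] order.refl] by simp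
    show "drun_le T1 (11 * (a + b + (a + b + b)) * 4 ^ n)
      (W1, tps I Q G E N (tp (ones (a + b) @ [5]) []) (tp (1 # l) (ones n)) (tp (ones (a + b + b) @ [5]) []))
      (W1, tps I Q G E N (tp (ones a' @ [5]) []) (tp (ones (Suc n) @ l) []) (tp (ones b' @ [5]) []))"
      using run by (simp add: ones_Cons)
  qed
  ultimately show ?case by blast
qed

end

lemma preprocessing_poly:
  assumes "set ts \<subseteq> {1, 2, 3}" "set es \<subseteq> {1, 2}" "set ns \<subseteq> {1, 2}"
    and w: "w = ts @ [4] @ es @ [4] @ ns"
  shows "\<exists>X Y. drun_le (table1 k False) (3 * length w + (16 * k + 2) * length w ^ k + 16)
    (Z0, tps (input_tape w) (input_tape []) (input_tape []) (input_tape [])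
      (input_tape []) (input_tape []) (input_tape []) (input_tape []))
    (S0, tps (tp [5] w) (tp [5] []) (tp [5] []) (tp [5] es) (tp [5] ns) (clock 0 (length w ^ k)) X Y)"
proof -
  let ?B = "tp [5] []"
  let ?T = "table1 k False"
  have w': "set w \<subseteq> {1..<5}" "w \<noteq> []" using assms by auto
  let ?c = "length w ^ k"
  let ?F = "\<lambda>C X. tps (tp [5] w) ?B ?B (tp [5] es) (tp [5] ns) C X ?B"
  have "drun ?T 1 (M1 k, ?F ?B (tp [5] (ones ?c))) (V0, ?F ?B (tp [5] (ones ?c)))"
    by (rule drun_1) (simp add: steps_def)
  also note run_V0
  also note run_V1
  finally have "drun_le ?T (2 * ?c + 4) (M1 k, ?F ?B (tp [5] (ones ?c))) (S0, ?F (clock 0 ?c) (tp (ones ?c @ [5]) []))"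
    by (rule drun_leI) simp
  then have "drun_le ?T (3 * length w + (16 * k + 2) * length w ^ k + 16)
     (Z0, tps (input_tape w) (input_tape []) (input_tape []) (input_tape [])
        (input_tape []) (input_tape []) (input_tape []) (input_tape []))
     (S0, ?F (clock 0 ?c) (tp (ones ?c @ [5]) []))"
    by (rule drun_le_trans[OF run_split[OF assms] drun_le_trans[OF run_power[OF w' order.refl] _ order.refl]])
      (simp add: algebra_simps)
  then show ?thesis by blast
qed

text \<open>Starting the additions with the pair 1, 1 gives 22 = 11 * (1 + 1); the final rewind over
  at most 2 * 4 ^ length w ^ k clock cells raises this factor to 24.\<close>

lemma preprocessing_exp:
  assumes "set ts \<subseteq> {1, 2, 3}" "set es \<subseteq> {1, 2}" "set ns \<subseteq> {1, 2}"
    and w: "w = ts @ [4] @ es @ [4] @ ns"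
  shows "\<exists>X Y c. 2 ^ length w ^ k \<le> c \<and> c \<le> 2 * 4 ^ length w ^ k \<and>
    drun_le (table1 k True) (3 * length w + 16 * k * length w ^ k + 24 * 4 ^ length w ^ k + 17)
      (Z0, tps (input_tape w) (input_tape []) (input_tape []) (input_tape [])
        (input_tape []) (input_tape []) (input_tape []) (input_tape []))
      (S0, tps (tp [5] w) (tp [5] []) (tp [5] []) (tp [5] es) (tp [5] ns) (clock 0 c) X Y)"
proof -
  let ?B = "tp [5] []"
  let ?T = "table1 k True"
  have w': "set w \<subseteq> {1..<5}" "w \<noteq> []" using assms by auto
  let ?n = "length w ^ k"
  let ?F = "\<lambda>C X Y. tps (tp [5] w) ?B ?B (tp [5] es) (tp [5] ns) C X Y"
  have "drun ?T 1 (M1 k, ?F ?B (tp [5] (ones ?n)) ?B) (W0, ?F ?B (tp [5] (ones ?n)) ?B)"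
    by (rule drun_1) (simp add: steps_def)
  also have "drun ?T 1 (W0, ?F ?B (tp [5] (ones ?n)) ?B)
      (W1, ?F (tp (ones 1 @ [5]) []) (tp [5] (ones ?n)) (tp (ones 1 @ [5]) []))"
    by (rule drun_1) (simp add: steps_def)
  finally have 1: "drun_le ?T 2 (M1 k, ?F ?B (tp [5] (ones ?n)) ?B)
      (W1, ?F (tp (ones 1 @ [5]) []) (tp [5] (ones ?n)) (tp (ones 1 @ [5]) []))"
    by (rule drun_leI) simp
  obtain a b where ab: "2 ^ ?n \<le> a" "a \<le> 2 * 4 ^ ?n"
    and 2: "drun_le ?T (22 * 4 ^ ?n)
      (W1, ?F (tp (ones 1 @ [5]) []) (tp [5] (ones ?n)) (tp (ones 1 @ [5]) []))
      (W1, ?F (tp (ones a @ [5]) []) (tp (ones ?n @ [5]) []) (tp (ones b @ [5]) []))"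
    using run_W1[of 1 1 ?n k True "tp [5] w" ?B ?B "tp [5] es" "tp [5] ns" "[5]"] by auto
  have "drun ?T 1 (W1, ?F (tp (ones a @ [5]) []) (tp (ones ?n @ [5]) []) (tp (ones b @ [5]) []))
      (V1, ?F (tp (ones a @ [5]) []) (tp (ones ?n @ [5]) []) (tp (ones b @ [5]) []))"
    by (rule drun_1) (simp add: steps_def)
  also note run_V1
  finally have 3: "drun_le ?T (a + 3) (W1, ?F (tp (ones a @ [5]) []) (tp (ones ?n @ [5]) []) (tp (ones b @ [5]) []))
      (S0, ?F (clock 0 a) (tp (ones ?n @ [5]) []) (tp (ones b @ [5]) []))"
    by (rule drun_leI) simp
  have "drun_le ?T (3 * length w + 12 + (16 * k * ?n + (2 + (22 * 4 ^ ?n + (a + 3)))))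
     (Z0, tps (input_tape w) (input_tape []) (input_tape []) (input_tape [])
        (input_tape []) (input_tape []) (input_tape []) (input_tape []))
     (S0, ?F (clock 0 a) (tp (ones ?n @ [5]) []) (tp (ones b @ [5]) []))"
    by (rule drun_le_trans[OF run_split[OF assms] drun_le_trans[OF run_power[OF w' order.refl]
        drun_le_trans[OF 1 drun_le_trans[OF 2 3 order.refl] order.refl] order.refl]]) simp
  then have "drun_le ?T (3 * length w + 16 * k * ?n + 24 * 4 ^ ?n + 17)
     (Z0, tps (input_tape w) (input_tape []) (input_tape []) (input_tape [])
        (input_tape []) (input_tape []) (input_tape []) (input_tape []))
     (S0, ?F (clock 0 a) (tp (ones ?n @ [5]) []) (tp (ones b @ [5]) []))"
    by (rule drun_le_trans[OF _ drun_le_refl[of _ 0]]) (use ab in simp)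
  with ab show ?thesis by blast
qed


section \<open>Checking\<close>

text \<open>Common format of the theory on tape 0, the guessed list on tape 2 and a hyperedge query
  behind its first symbol; a query is assembled by copying entries together with their terminator
  3.\<close>

definition cont :: "bool list list \<Rightarrow> nat list" where
  "cont ws = concat (map (\<lambda>w. bits w @ [3]) ws)"

lemma cont_simps [simp]:
  "cont [] = []" "cont (w # ws) = bits w @ 3 # cont ws" "cont (us @ ws) = cont us @ cont ws"
  by (simp_all add: cont_def)

lemma bits_simps [simp]:
  "bits [] = []" "bits (b # w) = (if b then 2 else 1) # bits w" "length (bits w) = length w"
  by (simp_all add: bits_def)

lemma set_bits: "set (bits w) \<subseteq> {1, 2}"
  by (auto simp: bits_def)

lemma set_cont: "set (cont ws) \<subseteq> {1, 2, 3}"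
  using set_bits by (induction ws) auto

lemma bits_range [simp]: "set (bits w) \<subseteq> {Suc 0..<5}"
  using set_bits[of w] by auto

lemma cont_range [simp]: "set (cont ws) \<subseteq> {Suc 0..<5}"
  using set_cont[of ws] by auto

text \<open>Binary value, least significant bit first. Unlike for words of the form
  \<open>bin n\<close>, the most significant bits may be False, since decrementing keeps the
  length.\<close>

fun val :: "bool list \<Rightarrow> nat" where
  "val [] = 0"
| "val (b # w) = of_bool b + 2 * val w"

text \<open>Read from right to left this is the decrement: the borrow flips the low zeros and clears
  the lowest one.\<close>

lemma val_ones: "val (replicate z True @ False # w) + 1 = val (replicate z False @ True # w)"
  by (induction z) auto

lemma split_at_True:
  assumes "0 < val w"
  obtains z v where "w = replicate z False @ True # v"
proof -
  have "\<exists>z v. w = replicate z False @ True # v" using assms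
  proof (induction w)
    case (Cons b w)
    show ?case
    proof (cases b)
      case True
      then show ?thesis by (intro exI[of _ 0]) auto
    next
      case False
      with Cons obtain z v where "w = replicate z False @ True # v" by auto
      then show ?thesis using False by (intro exI[of _ "Suc z"]) auto
    qed
  qed simp
  then show thesis using that by blast
qed

lemma ap_Nil [simp]: "ap [] F = F"
  by (simp add: fun_eq_iff ap_def reads_def)

lemma subseqs_filter: "filter P xs \<in> set (subseqs xs)"
  by (induction xs) (auto simp: Let_def)

lemma subseqs_subset: "us \<in> set (subseqs ws) \<Longrightarrow> set us \<subseteq> set ws"
  using subseqs_powset[of ws] by auto

lemma length_cont_subseqs: "us \<in> set (subseqs ws) \<Longrightarrow> length (cont us) \<le> length (cont ws)"
  by (induction ws arbitrary: us) (fastforce simp: Let_def)+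

lemma length_le_cont: "length ws \<le> length (cont ws)"
  by (induction ws) auto

section \<open>Loops and guesses of the checking phase\<close>

context
  fixes X :: "nat list set"
begin

abbreviation A :: "nat \<Rightarrow> st \<Rightarrow> (nat \<Rightarrow> tape) \<Rightarrow> bool" where
  "A \<equiv> ac checker X"

lemma A_iff: "q \<noteq> Qry \<Longrightarrow> q \<noteq> Acc \<Longrightarrow>
    A c q F \<longleftrightarrow> 0 < c \<and> (\<exists>(q', F')\<in>set (steps table2 q F). A (c - 1) q' F')"
  using checker.ac_iff_steps[of q X c F] by simp

lemma A_Qry: "A c Qry F \<longleftrightarrow> tape_word (F 1) \<in> X \<and> A c Yes F"
  using checker.ac_qry_iff[of X c F] by simp

lemma A_Acc: "A c Acc F"
  using ac_acc[of checker X c F] by simp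

lemma A_drun: "drun table2 d (q, F) (q', F') \<Longrightarrow> A c q F \<longleftrightarrow> d \<le> c \<and> A (c - d) q' F'"
  using checker.ac_drun[of d q F q' F' X c] by simp

lemma run_skip:
  assumes "table2 q = [([(i, [1, 2])], q, [(i, Cp i, GoRight)]), ([(i, [3])], q', [(i, Cp i, GoRight)])]"
  shows "drun table2 (length w + 1) (q, F(i := tp l (bits w @ 3 # r)))
    (q', F(i := tp (3 # rev (bits w) @ l) r))"
proof (induction w arbitrary: l)
  case Nil
  have "steps table2 q (F(i := tp l (3 # r))) = [(q', F(i := tp (3 # l) r))]"
    using assms by (simp add: steps_def ap_single reads_def)
  then show ?case by (simp add: drun_Suc drun_0 del: fun_upd_apply)
next
  case (Cons b w)
  let ?b = "if b then 2 else 1"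
  have "steps table2 q (F(i := tp l (?b # bits w @ 3 # r))) = [(q, F(i := tp (?b # l) (bits w @ 3 # r)))]"
    using assms by (simp add: steps_def ap_single reads_def)
  from drun_Suc[OF this Cons.IH[of "?b # l"]] show ?case by (simp del: fun_upd_apply)
qed

text \<open>Skipping an entry \<open>w\<close> takes one choice and length w + 1 moves; the last 1
  is the choice that stops the loop. The same pattern selects elements of the theory and entries of
  the guessed list.\<close>

lemma A_choose:
  assumes q1: "table2 q1 = [([(i, [1, 2, 3])], q2, []), ([(i, [1, 2, 3])], q3, [])]"
    and q2: "table2 q2 = [([(i, [1, 2])], q2, [(i, Cp i, GoRight)]), ([(i, [3])], q1, [(i, Cp i, GoRight)])]"
    and r: "r = [] \<or> hd r \<notin> {1, 2, 3}"
  shows "A c q1 (F(i := tp l (cont ws @ r))) \<longleftrightarrow>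
    (\<exists>ws1 w ws2. ws = ws1 @ w # ws2 \<and> length (cont ws1) + length ws1 + 1 \<le> c \<and>
       A (c - (length (cont ws1) + length ws1 + 1)) q3 (F(i := tp (rev (cont ws1) @ l) (cont (w # ws2) @ r))))"
proof (induction ws arbitrary: l c)
  case Nil
  have q: "q1 \<noteq> Qry" "q1 \<noteq> Acc" using q1 by auto
  have "steps table2 q1 (F(i := tp l r)) = []"
    using q1 r by (cases r) (auto simp: steps_def reads_def)
  then show ?case using A_iff[OF q, of c "F(i := tp l r)"] by (simp del: fun_upd_apply)
next
  case (Cons w ws)
  have q: "q1 \<noteq> Qry" "q1 \<noteq> Acc" using q1 by auto
  let ?F = "F(i := tp l (bits w @ 3 # cont ws @ r))"
  have "steps table2 q1 ?F = [(q2, ?F), (q3, ?F)]"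
    using q1 by (cases w) (auto simp: steps_def reads_def fun_upd_same simp del: fun_upd_apply)
  then have "A c q1 ?F \<longleftrightarrow> 0 < c \<and> (A (c - 1) q2 ?F \<or> A (c - 1) q3 ?F)"
    using A_iff[OF q, of c ?F] by simp
  also have "A (c - 1) q2 ?F \<longleftrightarrow> length w + 1 \<le> c - 1 \<and>
      A (c - 1 - (length w + 1)) q1 (F(i := tp (3 # rev (bits w) @ l) (cont ws @ r)))"
    by (rule A_drun[OF run_skip[OF q2]])
  also have "\<dots> \<longleftrightarrow> length w + 1 \<le> c - 1 \<and> (\<exists>ws1 w' ws2. ws = ws1 @ w' # ws2 \<and>
      length (cont ws1) + length ws1 + 1 \<le> c - 1 - (length w + 1) \<and>
      A (c - 1 - (length w + 1) - (length (cont ws1) + length ws1 + 1)) q3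
        (F(i := tp (rev (cont ws1) @ 3 # rev (bits w) @ l) (cont (w' # ws2) @ r))))"
    using Cons.IH by blast
  finally have 1: "A c q1 ?F \<longleftrightarrow> 0 < c \<and> (length w + 1 \<le> c - 1 \<and> (\<exists>ws1 w' ws2. ws = ws1 @ w' # ws2 \<and>
      length (cont ws1) + length ws1 + 1 \<le> c - 1 - (length w + 1) \<and>
      A (c - 1 - (length w + 1) - (length (cont ws1) + length ws1 + 1)) q3
        (F(i := tp (rev (cont ws1) @ 3 # rev (bits w) @ l) (cont (w' # ws2) @ r)))) \<or> A (c - 1) q3 ?F)" .
  let ?P = "\<lambda>ws1 w' ws2. length (cont ws1) + length ws1 + 1 \<le> c \<and>
    A (c - (length (cont ws1) + length ws1 + 1)) q3 (F(i := tp (rev (cont ws1) @ l) (cont (w' # ws2) @ r)))"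
  have split: "(\<exists>us v vs. w # ws = us @ v # vs \<and> R us v vs) \<longleftrightarrow>
      R [] w ws \<or> (\<exists>us v vs. ws = us @ v # vs \<and> R (w # us) v vs)" for R
    by (auto simp: Cons_eq_append_conv)
  have 2: "?P (w # us) v vs \<longleftrightarrow> 0 < c \<and> length w + 1 \<le> c - 1 \<and>
      length (cont us) + length us + 1 \<le> c - 1 - (length w + 1) \<and>
      A (c - 1 - (length w + 1) - (length (cont us) + length us + 1)) q3
        (F(i := tp (rev (cont us) @ 3 # rev (bits w) @ l) (cont (v # vs) @ r)))" for us v vs
  proof -
    have "c - (length (cont (w # us)) + length (w # us) + 1) =
        c - 1 - (length w + 1) - (length (cont us) + length us + 1)" by simp
    moreover have "length (cont (w # us)) + length (w # us) + 1 \<le> c \<longleftrightarrow> 0 < c \<and> length w + 1 \<le> c - 1 \<and>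
      length (cont us) + length us + 1 \<le> c - 1 - (length w + 1)" by auto
    moreover have "rev (cont (w # us)) @ l = rev (cont us) @ 3 # rev (bits w) @ l" by simp
    ultimately show ?thesis by (simp only:) blast
  qed
  have 3: "?P [] w ws \<longleftrightarrow> 0 < c \<and> A (c - 1) q3 ?F" by (simp add: Suc_le_eq del: fun_upd_apply)
  have "A c q1 ?F \<longleftrightarrow> (\<exists>us v vs. w # ws = us @ v # vs \<and> ?P us v vs)"
    unfolding split 2 3 1 by blast
  then show ?case by (simp del: fun_upd_apply)
qed

text \<open>The induction is on the budget, since the guessed word is not present in the starting
  configuration. It is written to the query and to the list of guesses simultaneously.\<close>

lemma A_guess:
  assumes q: "table2 q = [([], q, [(1, W 1, GoRight), (2, W 1, GoRight)]),
     ([], q, [(1, W 2, GoRight), (2, W 2, GoRight)]), ([], q', [(1, W 3, GoRight), (2, W 3, GoRight)])]"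
  shows "A c q (tps I (tp m []) (tp g []) E N C Z Y) \<longleftrightarrow> (\<exists>w. length w + 1 \<le> c \<and>
    A (c - (length w + 1)) q' (tps I (tp (3 # rev (bits w) @ m) []) (tp (3 # rev (bits w) @ g) []) E N C Z Y))"
proof (induction c arbitrary: m g)
  case 0
  have q': "q \<noteq> Qry" "q \<noteq> Acc" using q by auto
  show ?case using A_iff[OF q', of 0] by simp
next
  case (Suc c)
  have q': "q \<noteq> Qry" "q \<noteq> Acc" using q by auto
  let ?T = "\<lambda>w. tps I (tp (rev (bits w) @ m) []) (tp (rev (bits w) @ g) []) E N C Z Y"
  let ?T3 = "\<lambda>w. tps I (tp (3 # rev (bits w) @ m) []) (tp (3 # rev (bits w) @ g) []) E N C Z Y"
  have split: "(\<exists>w. P w) \<longleftrightarrow> P [] \<or> (\<exists>w. P (False # w)) \<or> (\<exists>w. P (True # w))" for P :: "bool list \<Rightarrow> bool"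
    by (metis (full_types) neq_Nil_conv)
  have "A (Suc c) q (?T []) \<longleftrightarrow> A c q (?T [False]) \<or> A c q (?T [True]) \<or> A c q' (?T3 [])"
    using A_iff[OF q', of "Suc c" "?T []"] q by (simp add: steps_def)
  also have "\<dots> \<longleftrightarrow> (\<exists>w. length w + 1 \<le> Suc c \<and> A (Suc c - (length w + 1)) q' (?T3 w))"
    unfolding split[of "\<lambda>w. length w + 1 \<le> Suc c \<and> A (Suc c - (length w + 1)) q' (?T3 w)"]
    using Suc.IH[of "1 # m" "1 # g"] Suc.IH[of "2 # m" "2 # g"] by auto
  finally show ?case by simp
qed

lemma run_B3:
  "drun table2 (length w + 1) (B3, tps I (tp m []) (tp l (bits w @ 3 # r)) E N C Z Y)
    (B1, tps I (tp (3 # rev (bits w) @ m) []) (tp (3 # rev (bits w) @ l) r) E N C Z Y)"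
proof (induction w arbitrary: l m)
  case (Cons b w)
  let ?b = "if b then 2 else 1"
  have "steps table2 B3 (tps I (tp m []) (tp l (?b # bits w @ 3 # r)) E N C Z Y)
     = [(B3, tps I (tp (?b # m) []) (tp (?b # l) (bits w @ 3 # r)) E N C Z Y)]"
    by (simp add: steps_def)
  from drun_Suc[OF this Cons.IH[of "?b # m" "?b # l"]] show ?case by simp
qed (simp add: drun_Suc drun_0 steps_def)

lemma run_F3:
  "drun table2 (length w + 1) (F3, tps I (tp m []) (tp l (bits w @ 3 # r)) E N C Z Y)
    (F4, tps I (tp (3 # rev (bits w) @ m) []) (tp (3 # rev (bits w) @ l) r) E N C Z Y)"
proof (induction w arbitrary: l m)
  case (Cons b w)
  let ?b = "if b then 2 else 1"
  have "steps table2 F3 (tps I (tp m []) (tp l (?b # bits w @ 3 # r)) E N C Z Y)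
     = [(F3, tps I (tp (?b # m) []) (tp (?b # l) (bits w @ 3 # r)) E N C Z Y)]"
    by (simp add: steps_def)
  from drun_Suc[OF this Cons.IH[of "?b # m" "?b # l"]] show ?case by simp
qed (simp add: drun_Suc drun_0 steps_def)

lemma run_F4:
  "drun table2 (length w + 1) (F4, tps I (tp m []) G (tp l (bits w)) N C Z Y)
    (Qry, tps I (tp (rev (bits w) @ m) []) G (tp (rev (bits w) @ l) [3]) N C Z Y)"
proof (induction w arbitrary: l m)
  case Nil
  have "steps table2 F4 (tps I (tp m []) G (tp l []) N C Z Y) = [(Qry, tps I (tp m []) G (tp l [3]) N C Z Y)]"
    by (simp add: steps_def)
  then show ?case by (simp add: drun_Suc drun_0)
next
  case (Cons b w)
  let ?b = "if b then 2 else 1"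
  have "steps table2 F4 (tps I (tp m []) G (tp l (?b # bits w)) N C Z Y)
     = [(F4, tps I (tp (?b # m) []) G (tp (?b # l) (bits w)) N C Z Y)]"
    by (simp add: steps_def)
  from drun_Suc[OF this Cons.IH[of "?b # m" "?b # l"]] show ?case by simp
qed

lemma run_B10:
  "drun table2 (length w + 1) (B10, tps (tp l (bits w @ 3 # r)) (tp m []) G E N C Z Y)
    (Qry, tps (tp (rev (bits w) @ l) (3 # r)) (tp (rev (bits w) @ m) []) G E N C Z Y)"
proof (induction w arbitrary: l m)
  case (Cons b w)
  let ?b = "if b then 2 else 1"
  have "steps table2 B10 (tps (tp l (?b # bits w @ 3 # r)) (tp m []) G E N C Z Y)
     = [(B10, tps (tp (?b # l) (bits w @ 3 # r)) (tp (?b # m) []) G E N C Z Y)]"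
    by (simp add: steps_def)
  from drun_Suc[OF this Cons.IH[of "?b # l" "?b # m"]] show ?case by simp
qed (simp add: drun_Suc drun_0 steps_def)

lemma run_B5:
  "drun table2 (length (cont ws) + 1) (B5, tps I Q (tp l (cont ws)) E N C Z Y)
    (B7, tps I Q (tp (rev (cont ws) @ l) []) E N C Z Y)"
proof -
  have "drun table2 (length xs + 1) (B5, tps I Q (tp l xs) E N C Z Y)
    (B7, tps I Q (tp (rev xs @ l) []) E N C Z Y)" if "set xs \<subseteq> {1, 2, 3}" for xs
    using that
  proof (induction xs arbitrary: l)
    case (Cons x xs)
    have "steps table2 B5 (tps I Q (tp l (x # xs)) E N C Z Y) = [(B5, tps I Q (tp (x # l) xs) E N C Z Y)]"
      using Cons.prems by (auto simp: steps_def)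
    from drun_Suc[OF this Cons.IH[of "x # l"]] show ?case using Cons.prems by simp
  qed (simp add: drun_Suc drun_0 steps_def)
  then show ?thesis using set_cont by blast
qed

text \<open>Each entry is either copied to the query or passed over, so the copied ones form a
  subsequence. Both choices take equally long, hence the cost does not depend on
  \<open>us\<close>.\<close>

lemma A_B1:
  "A c B1 (tps I (tp m []) (tp l (cont ws)) E N C Z Y) \<longleftrightarrow>
    (\<exists>us\<in>set (subseqs ws). length (cont ws) + length ws + 1 \<le> c \<and>
      A (c - (length (cont ws) + length ws + 1)) B4
        (tps I (tp (rev (cont us) @ m) []) (tp (rev (cont ws) @ l) []) E N C Z Y))"
proof (induction ws arbitrary: l m c)
  case Nil
  show ?case by (subst A_iff) (auto simp: steps_def)
next
  case (Cons w ws)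
  let ?F = "tps I (tp m []) (tp l (bits w @ 3 # cont ws)) E N C Z Y"
  let ?d = "length (cont ws) + length ws + 1"
  have "steps table2 B1 ?F = [(B2, ?F), (B3, ?F)]"
    by (cases w) (auto simp: steps_def)
  then have "A c B1 ?F \<longleftrightarrow> 0 < c \<and> (A (c - 1) B2 ?F \<or> A (c - 1) B3 ?F)"
    using A_iff[of B1 c ?F] by simp
  also have "A (c - 1) B2 ?F \<longleftrightarrow> length w + 1 \<le> c - 1 \<and> A (c - 1 - (length w + 1)) B1
      (tps I (tp m []) (tp (3 # rev (bits w) @ l) (cont ws)) E N C Z Y)"
    using A_drun[OF run_skip[of B2 2 B1 w ?F l "cont ws"], of "c - 1"] by simp
  also have "A (c - 1) B3 ?F \<longleftrightarrow> length w + 1 \<le> c - 1 \<and> A (c - 1 - (length w + 1)) B1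
      (tps I (tp (3 # rev (bits w) @ m) []) (tp (3 # rev (bits w) @ l) (cont ws)) E N C Z Y)"
    by (rule A_drun[OF run_B3])
  finally have "A c B1 ?F \<longleftrightarrow> 0 < c \<and> length w + 1 \<le> c - 1 \<and>
    ((\<exists>us\<in>set (subseqs ws). ?d \<le> c - 1 - (length w + 1) \<and> A (c - 1 - (length w + 1) - ?d) B4
        (tps I (tp (rev (cont us) @ m) []) (tp (rev (cont (w # ws)) @ l) []) E N C Z Y)) \<or>
     (\<exists>us\<in>set (subseqs ws). ?d \<le> c - 1 - (length w + 1) \<and> A (c - 1 - (length w + 1) - ?d) B4
        (tps I (tp (rev (cont (w # us)) @ m) []) (tp (rev (cont (w # ws)) @ l) []) E N C Z Y)))"
    unfolding Cons.IH by auto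
  moreover have "c - (length (cont (w # ws)) + length (w # ws) + 1) = c - 1 - (length w + 1) - ?d"
    by simp
  moreover have "length (cont (w # ws)) + length (w # ws) + 1 \<le> c \<longleftrightarrow>
      0 < c \<and> length w + 1 \<le> c - 1 \<and> ?d \<le> c - 1 - (length w + 1)" by auto
  moreover have "set (subseqs (w # ws)) = (#) w ` set (subseqs ws) \<union> set (subseqs ws)"
    by (simp add: Let_def)
  ultimately show ?case by (simp only: bex_Un bex_simps cont_simps(2)) blast
qed

text \<open>The condition on \<open>nb\<close> comes from the guard on tape 4. As decrementing keeps
  the length and \<open>bin 0\<close> is empty, it tests whether the original number is positive,
  which leaves room for a proof with one vertex.\<close>

lemma A_A3:
  "A c A3 (tps (tp l (bits w @ 3 # r)) Q G (tp m (bits e)) (tp [5] (bits nb)) C Z Y) \<longleftrightarrow>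
    w = e \<and> nb \<noteq> [] \<and> length w + 1 \<le> c"
proof (induction w arbitrary: e l m c)
  case Nil
  show ?case
    by (subst A_iff; cases e; cases nb) (auto simp: steps_def A_Acc)
next
  case (Cons b w)
  show ?case
  proof (cases e)
    case Nil
    then show ?thesis by (subst A_iff) (auto simp: steps_def)
  next
    case (Cons b' e')
    then show ?thesis
      by (subst A_iff) (auto simp: steps_def Cons.IH)
  qed
qed

lemma run_D0:
  "drun table2 (z + 1) (D0, tps I Q G E (tp l (bits (replicate z False @ True # v))) C Z Y)
    (D1, tps I Q G E (tp (replicate z 2 @ l) (1 # bits v)) C Z Y)"
proof (induction z arbitrary: l)
  case 0
  show ?case by (simp add: drun_Suc drun_0 steps_def)
next
  case (Suc z)
  have "steps table2 D0 (tps I Q G E (tp l (bits (replicate (Suc z) False @ True # v))) C Z Y) =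
    [(D0, tps I Q G E (tp (2 # l) (bits (replicate z False @ True # v))) C Z Y)]"
    by (simp add: steps_def)
  moreover have "replicate z 2 @ 2 # l = replicate (Suc z) 2 @ l" by (simp add: replicate_app_Cons_same)
  ultimately show ?case using Suc.IH[of "2 # l"] by (simp only: drun_Suc) (simp add: drun_Suc)
qed

lemma not_A_D0: "val nb = 0 \<Longrightarrow> \<not> A c D0 (tps I Q G E (tp l (bits nb)) C Z Y)"
proof (induction nb arbitrary: l c)
  case Nil
  show ?case by (subst A_iff) (auto simp: steps_def)
next
  case (Cons b nb)
  then show ?case by (subst A_iff) (auto simp: steps_def)
qed

text \<open>The cost \<open>d\<close> depends on how far the borrow runs, namely 2 * z + 3 for
  \<open>z\<close> low zeros, and is therefore only bounded.\<close>

lemma A_D0: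
  assumes "0 < val nb"
  obtains nb' d where "val nb' = val nb - 1" "length nb' = length nb" "d \<le> 2 * length nb + 3"
    "\<And>c I Q G E C Z Y. A c D0 (tps I Q G E (tp [5] (bits nb)) C Z Y) \<longleftrightarrow>
      d \<le> c \<and> A (c - d) B0 (tps I Q G E (tp [5] (bits nb')) C Z Y)"
proof -
  from assms obtain z v where nb: "nb = replicate z False @ True # v" by (rule split_at_True)
  have bits: "bits (replicate z True @ False # v) = replicate z 2 @ 1 # bits v"
    by (induction z) auto
  have "drun table2 (z + 1 + (z + 2)) (D0, tps I Q G E (tp [5] (bits nb)) C Z Y)
      (B0, tps I Q G E (tp [5] (bits (replicate z True @ False # v))) C Z Y)" for I Q G E C Z Y
  proof (rule drun_trans)
    show "drun table2 (z + 1) (D0, tps I Q G E (tp [5] (bits nb)) C Z Y)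
      (D1, tps I Q G E (tp (replicate z 2 @ [5]) (1 # bits v)) C Z Y)"
      unfolding nb by (rule run_D0)
    have "set (replicate z (2::nat)) \<subseteq> {Suc 0..<5}" by auto
    then show "drun table2 (z + 2) (D1, tps I Q G E (tp (replicate z 2 @ [5]) (1 # bits v)) C Z Y)
      (B0, tps I Q G E (tp [5] (bits (replicate z True @ False # v))) C Z Y)"
      using drun_rewind[of table2 D1 4 B0 "tps I Q G E (tp (replicate z 2 @ [5]) (1 # bits v)) C Z Y"
        "replicate z 2" "1 # bits v"] by (auto simp: bits split: if_splits)
  qed
  from A_drun[OF this] show thesis
    using val_ones[of z v] by (intro that[of "replicate z True @ False # v" "z + 1 + (z + 2)"]) (auto simp: nb)
qed

lemma run_cleanup:
  assumes "set qs \<subseteq> {1..<5}" "set gs \<subseteq> {1..<5}" "set is \<subseteq> {1..<5}" "hd r \<in> {1..<5}"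
  shows "drun table2 (length qs + length gs + length is + 6)
    (R1, tps (tp (rev is @ [5]) r) (tp (rev qs @ [5]) []) (tp (rev gs @ [5]) []) E N C Z Y)
    (S0, tps (tp [5] (is @ r)) (tp [5] []) (tp [5] gs) E N C Z Y)"
proof -
  have "drun table2 (length qs + 2)
    (R1, tps (tp (rev is @ [5]) r) (tp (rev qs @ [5]) []) (tp (rev gs @ [5]) []) E N C Z Y)
    (R2, tps (tp (rev is @ [5]) r) (tp [5] []) (tp (rev gs @ [5]) []) E N C Z Y)"
    using drun_erase[of table2 R1 1 R2 "tps (tp (rev is @ [5]) r) (tp (rev qs @ [5]) [])
      (tp (rev gs @ [5]) []) E N C Z Y" "rev qs" "[]"] assms by simp
  also have "drun table2 (length gs + 2)
    (R2, tps (tp (rev is @ [5]) r) (tp [5] []) (tp (rev gs @ [5]) []) E N C Z Y)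
    (R3, tps (tp (rev is @ [5]) r) (tp [5] []) (tp [5] gs) E N C Z Y)"
    using drun_rewind[of table2 R2 2 R3 "tps (tp (rev is @ [5]) r) (tp [5] [])
      (tp (rev gs @ [5]) []) E N C Z Y" "rev gs" "[]"] assms by simp
  also have "drun table2 (length is + 2)
    (R3, tps (tp (rev is @ [5]) r) (tp [5] []) (tp [5] gs) E N C Z Y)
    (S0, tps (tp [5] (is @ r)) (tp [5] []) (tp [5] gs) E N C Z Y)"
    using drun_rewind[of table2 R3 0 S0 "tps (tp (rev is @ [5]) r) (tp [5] [])
      (tp [5] gs) E N C Z Y" "rev is" r] assms by simp
  finally have *: "drun table2 (length qs + 2 + (length gs + 2) + (length is + 2))
    (R1, tps (tp (rev is @ [5]) r) (tp (rev qs @ [5]) []) (tp (rev gs @ [5]) []) E N C Z Y)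
    (S0, tps (tp [5] (is @ r)) (tp [5] []) (tp [5] gs) E N C Z Y)" .
  have "length qs + 2 + (length gs + 2) + (length is + 2) = length qs + length gs + length is + 6" by simp
  with * show ?thesis by (simp only:)
qed

text \<open>The symbol under the head of tape 3 tells the two purposes of a query apart: the start
  of the goal (blank if its code is empty) during a round, or the mark 3 in the final test.\<close>

lemma A_Yes:
  "A c Yes (tps I Q G (tp [5] (bits e)) N C Z Y) \<longleftrightarrow> 0 < c \<and> A (c - 1) R1 (tps I Q G (tp [5] (bits e)) N C Z Y)"
  "A c Yes (tps I Q G (tp l [3]) N C Z Y) \<longleftrightarrow> 0 < c"
  by (subst A_iff; cases e; auto simp: steps_def A_Acc)+

lemma A_Qry_word:
  assumes "set qs \<subseteq> {1..<5}"
  shows "A c Qry (tps I (tp (rev qs @ [5]) []) G E N C Z Y) \<longleftrightarrow>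
    qs \<in> X \<and> A c Yes (tps I (tp (rev qs @ [5]) []) G E N C Z Y)"
  using assms by (subst A_Qry, subst tps_nth(2)[unfolded One_nat_def[symmetric]], subst tape_word_tp) auto

text \<open>Merges the truncated subtractions of three consecutive phases into one total cost;
  \<open>q\<close> is the oracle answer required in between.\<close>

lemma budget_add:
  fixes a b c d D :: nat
  assumes "D = a + b + d"
  shows "(a \<le> c \<and> b \<le> c - a \<and> q \<and> d \<le> c - a - b \<and> A (c - a - b - d) s F) \<longleftrightarrow> q \<and> D \<le> c \<and> A (c - D) s F"
  using assms by (auto simp: diff_diff_left)

section \<open>One round of the checking phase\<close>

context
  fixes ts :: "bool list list" and e :: "bool list" and rest :: "nat list" and C Z Y :: tape
begin

definition cfg :: "bool list list \<Rightarrow> bool list \<Rightarrow> nat \<Rightarrow> tape" where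
  "cfg ws nb = tps (tp [5] (cont ts @ 4 # rest)) (tp [5] []) (tp [5] (cont ws)) (tp [5] (bits e))
     (tp [5] (bits nb)) C Z Y"

text \<open>\<open>is\<close> is the part of tape 0 before the head: empty after a hyperedge query,
  and reaching to the end of the copied sentence after a label query. The 7 adds the move out of
  \<open>Yes\<close> to the 6 of \<open>run_cleanup\<close>.\<close>

lemma A_after_query:
  assumes "set qs \<subseteq> {1..<5}" "cont ts @ 4 # rest = is @ r" "set is \<subseteq> {1..<5}" "hd r \<in> {1..<5}"
  shows "A c Qry (tps (tp (rev is @ [5]) r) (tp (rev qs @ [5]) []) (tp (rev (cont ws) @ [5]) []) (tp [5] (bits e))
     (tp [5] (bits nb)) C Z Y) \<longleftrightarrow>
    qs \<in> X \<and> length qs + length (cont ws) + length is + 7 \<le> c \<and>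
      A (c - (length qs + length (cont ws) + length is + 7)) S0 (cfg ws nb)"
proof -
  have "length qs + length (cont ws) + length is + 7 \<le> c \<longleftrightarrow> 0 < c \<and>
    length qs + length (cont ws) + length is + 6 \<le> c - 1"
    "c - 1 - (length qs + length (cont ws) + length is + 6) = c - (length qs + length (cont ws) + length is + 7)"
    by auto
  then show ?thesis
    using A_drun[OF run_cleanup[OF assms(1) _ assms(3,4), of "cont ws" "tp [5] (bits e)" "tp [5] (bits nb)" C Z Y], of "c - 1"]
    unfolding A_Qry_word[OF assms(1)] A_Yes cfg_def assms(2) by auto
qed

lemma A_B1_loop:
  "A c B1 (tps (tp [5] (cont ts @ 4 # rest)) (tp [3, 5] []) (tp [5] (cont ws)) (tp [5] (bits e))
     (tp [5] (bits nb)) C Z Y) \<longleftrightarrow>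
   (\<exists>us\<in>set (subseqs ws). \<exists>w. 3 # cont (us @ [w]) \<in> X \<and>
     length (cont ws) + length ws + length (cont us) + length (cont (ws @ [w])) + 2 * length w + 11 \<le> c \<and>
     A (c - (length (cont ws) + length ws + length (cont us) + length (cont (ws @ [w])) + 2 * length w + 11))
       S0 (cfg (ws @ [w]) nb))"
proof -
  have hd4: "hd (cont ts @ 4 # rest) \<in> {1..<5}"
    using cont_range[of ts] by (cases "cont ts") auto
  have q: "set (3 # cont (us @ [w])) \<subseteq> {1..<5}" for us w
    using cont_range[of "us @ [w]"] by simp
  let ?F = "\<lambda>us w. tps (tp [5] (cont ts @ 4 # rest)) (tp (rev (3 # cont (us @ [w])) @ [5]) [])
    (tp (rev (cont (ws @ [w])) @ [5]) []) (tp [5] (bits e)) (tp [5] (bits nb)) C Z Y"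
  have 1: "A d B4 (tps (tp [5] (cont ts @ 4 # rest)) (tp (rev (cont us) @ [3, 5]) []) (tp (rev (cont ws) @ [5]) [])
      (tp [5] (bits e)) (tp [5] (bits nb)) C Z Y) \<longleftrightarrow>
    (\<exists>w. length w + 1 \<le> d \<and> A (d - (length w + 1)) Qry (?F us w))" for d us
    by (subst A_guess[of B4 Qry]) simp_all
  have 2: "A d Qry (?F us w) \<longleftrightarrow> 3 # cont (us @ [w]) \<in> X \<and>
      length (3 # cont (us @ [w])) + length (cont (ws @ [w])) + length ([] :: nat list) + 7 \<le> d \<and>
      A (d - (length (3 # cont (us @ [w])) + length (cont (ws @ [w])) + length ([] :: nat list) + 7)) S0 (cfg (ws @ [w]) nb)"
    for d us w
    using A_after_query[OF q[of us w] _ _ hd4, of "[]" d "ws @ [w]" nb] by (simp del: cont_simps(3))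
  have 3: "(length (cont ws) + length ws + 1 \<le> c \<and> length w + 1 \<le> c - (length (cont ws) + length ws + 1) \<and>
     3 # cont (us @ [w]) \<in> X \<and> length (3 # cont (us @ [w])) + length (cont (ws @ [w])) + length ([] :: nat list) + 7
       \<le> c - (length (cont ws) + length ws + 1) - (length w + 1) \<and>
     A (c - (length (cont ws) + length ws + 1) - (length w + 1) -
       (length (3 # cont (us @ [w])) + length (cont (ws @ [w])) + length ([] :: nat list) + 7)) S0 (cfg (ws @ [w]) nb))
   \<longleftrightarrow> 3 # cont (us @ [w]) \<in> X \<and>
     length (cont ws) + length ws + length (cont us) + length (cont (ws @ [w])) + 2 * length w + 11 \<le> c \<and>
     A (c - (length (cont ws) + length ws + length (cont us) + length (cont (ws @ [w])) + 2 * length w + 11))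
       S0 (cfg (ws @ [w]) nb)" for us w
    by (rule budget_add) simp
  have "A c B1 (tps (tp [5] (cont ts @ 4 # rest)) (tp [3, 5] []) (tp [5] (cont ws)) (tp [5] (bits e))
     (tp [5] (bits nb)) C Z Y) \<longleftrightarrow>
   (\<exists>us\<in>set (subseqs ws). length (cont ws) + length ws + 1 \<le> c \<and>
      (\<exists>w. length w + 1 \<le> c - (length (cont ws) + length ws + 1) \<and>
       A (c - (length (cont ws) + length ws + 1) - (length w + 1)) Qry (?F us w)))"
    unfolding A_B1 1 ..
  then show ?thesis unfolding 2 3[symmetric] by blast
qed

lemma A_B8:
  "A c B8 (tps (tp [5] (cont ts @ 4 # rest)) (tp m []) G E N C Z Y) \<longleftrightarrow>
   (\<exists>us a vs. ts = us @ a # vs \<and> length (cont us) + length us + 1 \<le> c \<and>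
      A (c - (length (cont us) + length us + 1)) B10
        (tps (tp (rev (cont us) @ [5]) (bits a @ 3 # cont vs @ 4 # rest)) (tp m []) G E N C Z Y))"
  using A_choose[of B8 0 B9 B10 "4 # rest" c "tps (tp [] []) (tp m []) G E N C Z Y" "[5]" ts] by simp

lemma A_A1:
  "A c A1 (cfg ws nb) \<longleftrightarrow>
   (\<exists>us a vs. ts = us @ a # vs \<and> length (cont us) + length us + 1 \<le> c \<and>
      a = e \<and> nb \<noteq> [] \<and> length a + 1 \<le> c - (length (cont us) + length us + 1))"
  unfolding cfg_def
  using A_choose[of A1 0 A2 A3 "4 # rest" c "tps (tp [] []) (tp [5] []) (tp [5] (cont ws)) (tp [5] (bits e))
     (tp [5] (bits nb)) C Z Y" "[5]" ts] by (simp add: A_A3)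

lemma A_F1:
  "A c F1 (tps I (tp [4, 5] []) (tp [5] (cont ws)) (tp [5] (bits e)) N C Z Y) \<longleftrightarrow>
   (\<exists>us w vs. ws = us @ w # vs \<and> 4 # bits w @ 3 # bits e \<in> X \<and>
      length (cont us) + length us + 1 + (length w + 1) + (length e + 1) < c)"
proof -
  have 1: "A d F3 (tps I (tp [4, 5] []) (tp l (bits w @ 3 # r)) (tp [5] (bits e)) N C Z Y) \<longleftrightarrow>
      4 # bits w @ 3 # bits e \<in> X \<and> length w + 1 + (length e + 1) < d" for d w l r
  proof -
    have "A d F3 (tps I (tp [4, 5] []) (tp l (bits w @ 3 # r)) (tp [5] (bits e)) N C Z Y) \<longleftrightarrow>
      length w + 1 \<le> d \<and> length e + 1 \<le> d - (length w + 1) \<and> A (d - (length w + 1) - (length e + 1)) Qry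
      (tps I (tp (rev (4 # bits w @ 3 # bits e) @ [5]) []) (tp (3 # rev (bits w) @ l) r) (tp (rev (bits e) @ [5]) [3]) N C Z Y)"
      using A_drun[OF run_F3] A_drun[OF run_F4] by simp
    also have "\<dots> \<longleftrightarrow> length w + 1 \<le> d \<and> length e + 1 \<le> d - (length w + 1) \<and>
        4 # bits w @ 3 # bits e \<in> X \<and> 0 < d - (length w + 1) - (length e + 1)"
      by (subst A_Qry_word) (simp_all add: A_Yes)
    also have "\<dots> \<longleftrightarrow> 4 # bits w @ 3 # bits e \<in> X \<and> length w + 1 + (length e + 1) < d" by auto
    finally show ?thesis .
  qed
  have "A c F1 (tps I (tp [4, 5] []) (tp [5] (cont ws)) (tp [5] (bits e)) N C Z Y) \<longleftrightarrow>
   (\<exists>us w vs. ws = us @ w # vs \<and> length (cont us) + length us + 1 \<le> c \<and>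
      A (c - (length (cont us) + length us + 1)) F3
        (tps I (tp [4, 5] []) (tp (rev (cont us) @ [5]) (bits w @ 3 # cont vs)) (tp [5] (bits e)) N C Z Y))"
    using A_choose[of F1 2 F2 F3 "[]" c "tps I (tp [4, 5] []) (tp [] []) (tp [5] (bits e)) N C Z Y" "[5]" ws] by simp
  moreover have "(length (cont us) + length us + 1 \<le> c \<and> 4 # bits w @ 3 # bits e \<in> X \<and>
      length w + 1 + (length e + 1) < c - (length (cont us) + length us + 1)) \<longleftrightarrow>
    4 # bits w @ 3 # bits e \<in> X \<and> length (cont us) + length us + 1 + (length w + 1) + (length e + 1) < c" for us w
    by auto
  ultimately show ?thesis unfolding 1 by simp
qed

lemma A_B10_loop:
  "ts = us @ a # vs \<Longrightarrow> A c B10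
     (tps (tp (rev (cont us) @ [5]) (bits a @ 3 # cont vs @ 4 # rest)) (tp (3 # rev (bits w) @ [4, 5]) [])
       (tp (3 # rev (bits w) @ rev (cont ws) @ [5]) []) (tp [5] (bits e)) (tp [5] (bits nb)) C Z Y) \<longleftrightarrow>
   4 # bits w @ 3 # bits a \<in> X \<and>
   length (cont (ws @ [w])) + length (cont us) + length w + 3 * length a + 10 \<le> c \<and>
   A (c - (length (cont (ws @ [w])) + length (cont us) + length w + 3 * length a + 10)) S0 (cfg (ws @ [w]) nb)"
proof -
  assume ts: "ts = us @ a # vs"
  let ?F = "tps (tp (rev (cont us @ bits a) @ [5]) (3 # cont vs @ 4 # rest)) (tp (rev (4 # bits w @ 3 # bits a) @ [5]) [])
       (tp (rev (cont (ws @ [w])) @ [5]) []) (tp [5] (bits e)) (tp [5] (bits nb)) C Z Y"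
  let ?d = "length (4 # bits w @ 3 # bits a) + length (cont (ws @ [w])) + length (cont us @ bits a) + 7"
  have "A d Qry ?F \<longleftrightarrow> 4 # bits w @ 3 # bits a \<in> X \<and> ?d \<le> d \<and> A (d - ?d) S0 (cfg (ws @ [w]) nb)" for d
    by (rule A_after_query) (simp_all add: ts)
  moreover have "A c B10
     (tps (tp (rev (cont us) @ [5]) (bits a @ 3 # cont vs @ 4 # rest)) (tp (3 # rev (bits w) @ [4, 5]) [])
       (tp (3 # rev (bits w) @ rev (cont ws) @ [5]) []) (tp [5] (bits e)) (tp [5] (bits nb)) C Z Y) \<longleftrightarrow>
     length a + 1 \<le> c \<and> A (c - (length a + 1)) Qry ?F"
    using A_drun[OF run_B10] by simp
  moreover have "(0 \<le> c \<and> length a + 1 \<le> c - 0 \<and> 4 # bits w @ 3 # bits a \<in> X \<and> ?d \<le> c - 0 - (length a + 1) \<and>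
      A (c - 0 - (length a + 1) - ?d) S0 (cfg (ws @ [w]) nb)) \<longleftrightarrow>
    4 # bits w @ 3 # bits a \<in> X \<and>
    length (cont (ws @ [w])) + length (cont us) + length w + 3 * length a + 10 \<le> c \<and>
    A (c - (length (cont (ws @ [w])) + length (cont us) + length w + 3 * length a + 10)) S0 (cfg (ws @ [w]) nb)"
    by (rule budget_add) simp
  ultimately show ?thesis by simp
qed

lemma A_B5:
  "A c B5 (tps (tp [5] (cont ts @ 4 # rest)) (tp [4, 5] []) (tp [5] (cont ws)) (tp [5] (bits e))
     (tp [5] (bits nb)) C Z Y) \<longleftrightarrow>
   length (cont ws) + 1 \<le> c \<and> (\<exists>w. length w + 1 \<le> c - (length (cont ws) + 1) \<and>
     A (c - (length (cont ws) + 1) - (length w + 1)) B8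
       (tps (tp [5] (cont ts @ 4 # rest)) (tp (3 # rev (bits w) @ [4, 5]) [])
       (tp (3 # rev (bits w) @ rev (cont ws) @ [5]) []) (tp [5] (bits e)) (tp [5] (bits nb)) C Z Y))"
  using A_drun[OF run_B5] by (simp add: A_guess[of B7 B8])

lemma A_B5_sound:
  assumes "A c B5 (tps (tp [5] (cont ts @ 4 # rest)) (tp [4, 5] []) (tp [5] (cont ws)) (tp [5] (bits e))
     (tp [5] (bits nb)) C Z Y)"
  shows "\<exists>w. \<exists>a\<in>set ts. \<exists>c'<c. 4 # bits w @ 3 # bits a \<in> X \<and> A c' S0 (cfg (ws @ [w]) nb)"
proof -
  from assms obtain w where w: "A (c - (length (cont ws) + 1) - (length w + 1)) B8
       (tps (tp [5] (cont ts @ 4 # rest)) (tp (3 # rev (bits w) @ [4, 5]) [])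
       (tp (3 # rev (bits w) @ rev (cont ws) @ [5]) []) (tp [5] (bits e)) (tp [5] (bits nb)) C Z Y)"
    unfolding A_B5 by blast
  let ?c1 = "c - (length (cont ws) + 1) - (length w + 1)"
  from w obtain us a vs where ts: "ts = us @ a # vs" and c2: "A (?c1 - (length (cont us) + length us + 1)) B10
        (tps (tp (rev (cont us) @ [5]) (bits a @ 3 # cont vs @ 4 # rest)) (tp (3 # rev (bits w) @ [4, 5]) [])
       (tp (3 # rev (bits w) @ rev (cont ws) @ [5]) []) (tp [5] (bits e)) (tp [5] (bits nb)) C Z Y)"
    unfolding A_B8 by blast
  let ?c2 = "?c1 - (length (cont us) + length us + 1)"
  let ?d = "length (cont (ws @ [w])) + length (cont us) + length w + 3 * length a + 10"
  from c2 have d: "4 # bits w @ 3 # bits a \<in> X" "?d \<le> ?c2" "A (?c2 - ?d) S0 (cfg (ws @ [w]) nb)"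
    unfolding A_B10_loop[OF ts] by blast+
  have "?c2 - ?d < c" using d(2) by simp
  moreover have "a \<in> set ts" by (simp add: ts)
  ultimately show ?thesis using d(1,3) by blast
qed

lemma A_B5_complete:
  assumes "a \<in> set ts" "4 # bits w @ 3 # bits a \<in> X" "A c S0 (cfg (ws @ [w]) nb)"
    and le: "c + 4 * length (cont (ws @ [w])) + 5 * length (cont ts) + 20 \<le> c1"
  shows "A c1 B5 (tps (tp [5] (cont ts @ 4 # rest)) (tp [4, 5] []) (tp [5] (cont ws)) (tp [5] (bits e))
     (tp [5] (bits nb)) C Z Y)"
proof -
  from assms(1) obtain us vs where ts: "ts = us @ a # vs" by (auto simp: in_set_conv_decomp)
  let ?d = "length (cont (ws @ [w])) + length (cont us) + length w + 3 * length a + 10"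
  have len: "length us \<le> length (cont us)" by (rule length_le_cont)
  let ?c2 = "c1 - (length (cont ws) + 1) - (length w + 1)"
  let ?c3 = "?c2 - (length (cont us) + length us + 1)"
  have "c \<le> ?c3 - ?d" using le len by (simp add: ts)
  with assms(3) have "A (?c3 - ?d) S0 (cfg (ws @ [w]) nb)" by (rule ac_mono)
  moreover have le': "?d \<le> ?c3" "length (cont us) + length us + 1 \<le> ?c2" "length w + 1 \<le> c1 - (length (cont ws) + 1)"
    "length (cont ws) + 1 \<le> c1" using le len by (simp_all add: ts)
  ultimately have "A ?c3 B10
     (tps (tp (rev (cont us) @ [5]) (bits a @ 3 # cont vs @ 4 # rest)) (tp (3 # rev (bits w) @ [4, 5]) [])
       (tp (3 # rev (bits w) @ rev (cont ws) @ [5]) []) (tp [5] (bits e)) (tp [5] (bits nb)) C Z Y)"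
    unfolding A_B10_loop[OF ts] using assms(2) by blast
  with ts le'(2) have "A ?c2 B8
       (tps (tp [5] (cont ts @ 4 # rest)) (tp (3 # rev (bits w) @ [4, 5]) [])
       (tp (3 # rev (bits w) @ rev (cont ws) @ [5]) []) (tp [5] (bits e)) (tp [5] (bits nb)) C Z Y)"
    unfolding A_B8 by blast
  with le'(3,4) show ?thesis unfolding A_B5 by blast
qed

lemma A_B1_sound:
  assumes "A c B1 (tps (tp [5] (cont ts @ 4 # rest)) (tp [3, 5] []) (tp [5] (cont ws)) (tp [5] (bits e))
     (tp [5] (bits nb)) C Z Y)"
  shows "\<exists>w us. \<exists>c'<c. us \<in> set (subseqs ws) \<and> 3 # cont (us @ [w]) \<in> X \<and> A c' S0 (cfg (ws @ [w]) nb)"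
proof -
  from assms obtain us w where us: "us \<in> set (subseqs ws)" "3 # cont (us @ [w]) \<in> X" and
    le: "length (cont ws) + length ws + length (cont us) + length (cont (ws @ [w])) + 2 * length w + 11 \<le> c" and
    a: "A (c - (length (cont ws) + length ws + length (cont us) + length (cont (ws @ [w])) + 2 * length w + 11))
       S0 (cfg (ws @ [w]) nb)"
    unfolding A_B1_loop by blast
  have "c - (length (cont ws) + length ws + length (cont us) + length (cont (ws @ [w])) + 2 * length w + 11) < c"
    using le by simp
  with us a show ?thesis by blast
qed

lemma A_B1_complete:
  assumes "us \<in> set (subseqs ws)" "3 # cont (us @ [w]) \<in> X" "A c S0 (cfg (ws @ [w]) nb)"
    and le: "c + 6 * length (cont (ws @ [w])) + 11 \<le> c1"
  shows "A c1 B1 (tps (tp [5] (cont ts @ 4 # rest)) (tp [3, 5] []) (tp [5] (cont ws)) (tp [5] (bits e))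
     (tp [5] (bits nb)) C Z Y)"
proof -
  let ?d = "length (cont ws) + length ws + length (cont us) + length (cont (ws @ [w])) + 2 * length w + 11"
  have "c + ?d \<le> c1" using le length_le_cont[of ws] length_cont_subseqs[OF assms(1)] by simp
  then have "?d \<le> c1" "A (c1 - ?d) S0 (cfg (ws @ [w]) nb)" using assms(3) by (auto elim!: ac_mono)
  then show ?thesis unfolding A_B1_loop using assms(1,2) by blast
qed

lemma A_S0: "A c S0 (cfg ws nb) \<longleftrightarrow> 0 < c \<and> (A (c - 1) A1 (cfg ws nb) \<or> A (c - 1) D0 (cfg ws nb) \<or>
   A (c - 1) F1 (tps (tp [5] (cont ts @ 4 # rest)) (tp [4, 5] []) (tp [5] (cont ws)) (tp [5] (bits e))
     (tp [5] (bits nb)) C Z Y))"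
  by (subst A_iff) (auto simp: steps_def cfg_def)

lemma A_B0: "A c B0 (cfg ws nb) \<longleftrightarrow> 0 < c \<and>
   (A (c - 1) B1 (tps (tp [5] (cont ts @ 4 # rest)) (tp [3, 5] []) (tp [5] (cont ws)) (tp [5] (bits e))
     (tp [5] (bits nb)) C Z Y) \<or>
    A (c - 1) B5 (tps (tp [5] (cont ts @ 4 # rest)) (tp [4, 5] []) (tp [5] (cont ws)) (tp [5] (bits e))
     (tp [5] (bits nb)) C Z Y))"
  by (subst A_iff) (auto simp: steps_def cfg_def)

text \<open>Phrased by oracle answers only; \<open>derivable_iff\<close> later shows that
  \<open>w\<close> is then the index of a vertex.\<close>

definition derivable :: "bool list list \<Rightarrow> bool list \<Rightarrow> bool" where
  "derivable ws w \<longleftrightarrow> (\<exists>us\<in>set (subseqs ws). 3 # cont (us @ [w]) \<in> X) \<or>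
     (\<exists>a\<in>set ts. 4 # bits w @ 3 # bits a \<in> X)"

text \<open>The strictly smaller budget in the last alternative is the measure for the induction
  over rounds in \<open>checking_sound\<close>.\<close>

lemma A_S0_sound:
  assumes "A c S0 (cfg ws nb)"
  shows "e \<in> set ts \<and> nb \<noteq> [] \<or> (\<exists>w\<in>set ws. 4 # bits w @ 3 # bits e \<in> X) \<or>
    (\<exists>w nb'. \<exists>c'<c. 0 < val nb \<and> val nb' = val nb - 1 \<and> length nb' = length nb \<and> derivable ws w \<and>
       A c' S0 (cfg (ws @ [w]) nb'))"
proof -
  consider "A (c - 1) A1 (cfg ws nb)" | "0 < c" "A (c - 1) D0 (cfg ws nb)" | "A (c - 1) F1
    (tps (tp [5] (cont ts @ 4 # rest)) (tp [4, 5] []) (tp [5] (cont ws)) (tp [5] (bits e)) (tp [5] (bits nb)) C Z Y)"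
    using assms unfolding A_S0 by blast
  then show ?thesis
  proof cases
    case 1
    then show ?thesis unfolding A_A1 by auto
  next
    case 2
    have "0 < val nb" using 2(2) not_A_D0[of nb] unfolding cfg_def by blast
    then obtain nb' d where nb': "val nb' = val nb - 1" "length nb' = length nb"
      "\<And>c I Q G E C Z Y. A c D0 (tps I Q G E (tp [5] (bits nb)) C Z Y) \<longleftrightarrow>
        d \<le> c \<and> A (c - d) B0 (tps I Q G E (tp [5] (bits nb')) C Z Y)"
      by (rule A_D0) blast
    from 2(2) have "A (c - 1 - d) B0 (cfg ws nb')" unfolding cfg_def nb'(3) by blast
    then obtain w c' where "c' < c - 1 - d - 1" "derivable ws w" "A c' S0 (cfg (ws @ [w]) nb')"
      unfolding A_B0 derivable_def using A_B1_sound[of "c - 1 - d - 1" ws nb'] A_B5_sound[of "c - 1 - d - 1" ws nb']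
      by blast
    moreover from this(1) have "c' < c" by simp
    ultimately show ?thesis using nb'(1,2) \<open>0 < val nb\<close> by blast
  next
    case 3
    then show ?thesis unfolding A_F1 by auto
  qed
qed

lemma A_S0_accept_goal:
  assumes "e \<in> set ts" "nb \<noteq> []" "3 * length (cont ts) + 3 \<le> c"
  shows "A c S0 (cfg ws nb)"
proof -
  from assms(1) obtain us vs where ts: "ts = us @ e # vs" by (auto simp: in_set_conv_decomp)
  then have "length (cont us) + length us + 1 \<le> c - 1"
      "length e + 1 \<le> c - 1 - (length (cont us) + length us + 1)"
    using assms(3) length_le_cont[of us] by simp_all
  then have "A (c - 1) A1 (cfg ws nb)" unfolding A_A1 using ts assms(2) by blast
  then show ?thesis using assms(3) unfolding A_S0 by simp
qed

lemma A_S0_accept_label: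
  assumes "w \<in> set ws" "4 # bits w @ 3 # bits e \<in> X" "2 * length (cont ws) + length e + 5 \<le> c"
  shows "A c S0 (cfg ws nb)"
proof -
  from assms(1) obtain us vs where ws: "ws = us @ w # vs" by (auto simp: in_set_conv_decomp)
  then have "length (cont us) + length us + 1 + (length w + 1) + (length e + 1) < c - 1"
    using assms(3) length_le_cont[of us] by simp
  then have "A (c - 1) F1 (tps (tp [5] (cont ts @ 4 # rest)) (tp [4, 5] []) (tp [5] (cont ws)) (tp [5] (bits e))
     (tp [5] (bits nb)) C Z Y)"
    unfolding A_F1 using ws assms(2) by blast
  then show ?thesis using assms(3) unfolding A_S0 by simp
qed

text \<open>The cost dominates both justifications of \<open>w\<close>, by a hyperedge (factor 6 for
  the list) and by a label (factor 5 for the theory), together with the decrement and the two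
  branching moves.\<close>

lemma A_S0_step:
  assumes "derivable ws w" "0 < val nb"
  obtains nb' where "val nb' = val nb - 1" "length nb' = length nb"
    "\<And>c. A c S0 (cfg (ws @ [w]) nb') \<Longrightarrow>
      A (c + 6 * length (cont (ws @ [w])) + 5 * length (cont ts) + 2 * length nb + 30) S0 (cfg ws nb)"
proof -
  from assms(2) obtain nb' d where nb': "val nb' = val nb - 1" "length nb' = length nb" "d \<le> 2 * length nb + 3"
    "\<And>c I Q G E C Z Y. A c D0 (tps I Q G E (tp [5] (bits nb)) C Z Y) \<longleftrightarrow>
      d \<le> c \<and> A (c - d) B0 (tps I Q G E (tp [5] (bits nb')) C Z Y)"
    by (rule A_D0) blast
  show thesis
  proof (rule that[OF nb'(1,2)])
    fix c assume a: "A c S0 (cfg (ws @ [w]) nb')"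
    let ?c = "c + 6 * length (cont (ws @ [w])) + 5 * length (cont ts) + 2 * length nb + 30"
    let ?c1 = "?c - 1 - d - 1"
    have le: "c + 6 * length (cont (ws @ [w])) + 5 * length (cont ts) + 20 \<le> ?c1" "d \<le> ?c - 1" "0 < ?c - 1 - d"
      using nb'(3) by simp_all
    have "A (?c - 1 - d) B0 (cfg ws nb')"
    proof (cases "\<exists>a\<in>set ts. 4 # bits w @ 3 # bits a \<in> X")
      case True
      then show ?thesis using le A_B5_complete[OF _ _ a, of _ ?c1] unfolding A_B0 by auto
    next
      case False
      with assms(1) obtain us where us: "us \<in> set (subseqs ws)" "3 # cont (us @ [w]) \<in> X"
        unfolding derivable_def by blast
      then show ?thesis using le A_B1_complete[OF us a, of ?c1] unfolding A_B0 by simp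
    qed
    then have "A (?c - 1) D0 (cfg ws nb)" unfolding cfg_def nb'(4) using le(2) by blast
    then show "A ?c S0 (cfg ws nb)" unfolding A_S0 by simp
  qed
qed

end

end


section \<open>Derivations as lists of vertices\<close>

text \<open>Repetitions are allowed, as the machine does not test for them.\<close>

definition derivation_list :: "('v, 's) hypergraph \<Rightarrow> 's set \<Rightarrow> 'v list \<Rightarrow> bool" where
  "derivation_list H T vs \<longleftrightarrow> (\<forall>i<length vs. vs ! i \<in> verts H \<and>
     (lab H (vs ! i) \<in> T \<or> (\<exists>S. (S, vs ! i) \<in> hedges H \<and> S \<subseteq> set (take i vs))))"

lemma derivation_list_Nil [simp]: "derivation_list H T []"
  by (simp add: derivation_list_def)

lemma derivation_list_snoc:
  "derivation_list H T (vs @ [v]) \<longleftrightarrow> derivation_list H T vs \<and> v \<in> verts H \<and>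
     (lab H v \<in> T \<or> (\<exists>S. (S, v) \<in> hedges H \<and> S \<subseteq> set vs))"
  by (auto simp: derivation_list_def nth_append less_Suc_eq)

lemma derivation_list_verts: "derivation_list H T vs \<Longrightarrow> set vs \<subseteq> verts H"
  by (auto simp: derivation_list_def in_set_conv_nth)

text \<open>The vertices of the proof are positions in the list, so that every edge increases.\<close>

lemma proof_of_derivation_list:
  fixes H :: "('v, 's) hypergraph"
  assumes H: "derivation_structure sat T H" and vs: "derivation_list H T vs"
    and v: "v \<in> set vs" "lab H v = \<eta>"
  shows "\<exists>P :: (nat, 's) hypergraph. is_proof sat T \<eta> P \<and> admissible P H \<and> card (verts P) \<le> length vs"
proof -
  let ?l = "\<lambda>i. lab H (vs ! i)"
  have "\<forall>i. \<exists>S. i < length vs \<and> ?l i \<notin> T \<longrightarrow> (S, vs ! i) \<in> hedges H \<and> S \<subseteq> set (take i vs)"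
    using vs unfolding derivation_list_def by blast
  then obtain S where S: "\<And>i. i < length vs \<Longrightarrow> ?l i \<notin> T \<Longrightarrow> (S i, vs ! i) \<in> hedges H"
    "\<And>i. i < length vs \<Longrightarrow> ?l i \<notin> T \<Longrightarrow> S i \<subseteq> set (take i vs)"
    by metis
  \<comment> \<open>All earlier positions that carry a vertex of \<open>S i\<close> are taken, so
    that their image under \<open>(!) vs\<close> is exactly \<open>S i\<close>, as a homomorphism
    demands.\<close>
  define J where "J i = {j. j < i \<and> vs ! j \<in> S i}" for i
  have J: "(!) vs ` J i = S i" if "i < length vs" "?l i \<notin> T" for i
    using S(2)[OF that] that(1) by (fastforce simp: J_def in_set_conv_nth image_iff)
  define R where "R = {(j, i). i < length vs \<and> ?l i \<notin> T \<and> j \<in> J i}"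
  from v obtain g where g: "g < length vs" "vs ! g = v" by (auto simp: in_set_conv_nth)
  \<comment> \<open>Keeping only the positions from which the goal position is reachable makes
    \<open>g\<close> the unique sink.\<close>
  define V where "V = {i. (i, g) \<in> R\<^sup>*}"
  \<comment> \<open>A position labelled in \<open>T\<close> gets no hyperedge, so exactly these
    positions are leaves.\<close>
  define P :: "(nat, 's) hypergraph"
    where "P = \<lparr>verts = V, hedges = {(J i, i) |i. i \<in> V \<and> ?l i \<notin> T}, lab = ?l\<rparr>"
  have le: "i \<le> g" if "i \<in> V" for i
  proof -
    from that have "(i, g) \<in> R\<^sup>*" by (simp add: V_def)
    then show ?thesis by (induction rule: converse_rtrancl_induct) (auto simp: R_def J_def)
  qed
  have JV: "J i \<subseteq> V" if "i \<in> V" "?l i \<notin> T" for i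
  proof
    fix j assume "j \<in> J i"
    then have "(j, i) \<in> R" using that le[of i] g by (simp add: R_def)
    then show "j \<in> V" using that unfolding V_def by (auto intro: converse_rtrancl_into_rtrancl)
  qed
  have VT: "?l i \<in> T" if "leaf P i" for i
    using that by (auto simp: leaf_def P_def)
  have fin: "finite V" using le by (meson finite_nat_set_iff_bounded_le)
  have "derivation_structure sat T P"
    unfolding derivation_structure_def
  proof (intro conjI allI impI)
    show "hypergraph P" using fin JV by (auto simp: hypergraph_def P_def)
    show "lab P i \<in> T" if "leaf P i" for i using VT[OF that] by (simp add: P_def)
    show "\<forall>(S, d)\<in>hedges P. entails sat (lab P ` S) (lab P d)"
    proof (clarify)
      fix A d assume "(A, d) \<in> hedges P"
      then have d: "A = J d" "d \<in> V" "?l d \<notin> T" by (auto simp: P_def)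
      then have "d < length vs" using le[of d] g by simp
      then have "(S d, vs ! d) \<in> hedges H" "lab P ` A = lab H ` S d"
        using S(1) d J[symmetric] by (auto simp: P_def image_image)
      then show "entails sat (lab P ` A) (lab P d)"
        using H by (auto simp: derivation_structure_def P_def)
    qed
  qed
  moreover have "acyclic_hypergraph P"
  proof -
    have "hpath P d es \<Longrightarrow> es \<noteq> [] \<Longrightarrow> d < snd (last es)" for d es
    proof (induction es arbitrary: d)
      case (Cons x es)
      then have "d < snd x" by (auto simp: P_def J_def)
      with Cons show ?case by (cases es) (auto intro: less_trans)
    qed simp
    then show ?thesis by (auto simp: acyclic_hypergraph_def)
  qed
  moreover have "{u. sink P u} = {g} \<and> lab P g = \<eta>"
  proof -
    have "g \<in> V" by (simp add: V_def)
    moreover have "g \<notin> J i" if "i \<in> V" for i using le[OF that] by (simp add: J_def)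
    moreover have "u = g" if "sink P u" for u
    proof (rule ccontr)
      assume "u \<noteq> g"
      moreover from that have "(u, g) \<in> R\<^sup>*" by (simp add: sink_def P_def V_def)
      ultimately obtain i where "(u, i) \<in> R" "(i, g) \<in> R\<^sup>*" by (metis converse_rtranclE)
      then have "u \<in> J i" "(J i, i) \<in> hedges P" by (auto simp: R_def P_def V_def)
      with that show False by (auto simp: sink_def)
    qed
    ultimately show ?thesis using g v by (auto simp: sink_def P_def)
  qed
  moreover have "admissible P H"
    unfolding admissible_def homomorphism_def
  proof (intro exI[of _ "(!) vs"] conjI)
    have "vs ! i \<in> verts H" if "i \<in> V" for i
      using le[OF that] g derivation_list_verts[OF vs] by (meson le_less_trans nth_mem subsetD)
    then show "(!) vs ` verts P \<subseteq> verts H" by (auto simp: P_def)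
    show "\<forall>i\<in>verts P. lab H (vs ! i) = lab P i" by (simp add: P_def)
    show "\<forall>(S, d)\<in>hedges P. ((!) vs ` S, vs ! d) \<in> hedges H"
    proof clarify
      fix A d assume "(A, d) \<in> hedges P"
      then have d: "A = J d" "d \<in> V" "?l d \<notin> T" by (auto simp: P_def)
      then have "d < length vs" using le[of d] g by simp
      then show "((!) vs ` A, vs ! d) \<in> hedges H" using S(1) d J by simp
    qed
  qed
  moreover have "card (verts P) \<le> length vs"
  proof -
    have "V \<subseteq> {..<length vs}" using le g by fastforce
    then show ?thesis using card_mono[of "{..<length vs}" V] by (simp add: P_def)
  qed
  ultimately show ?thesis unfolding is_proof_def by blast
qed

section \<open>From admissible proofs to lists of vertices\<close>

definition hedge_rel :: "('v, 's) hypergraph \<Rightarrow> ('v \<times> 'v) set" where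
  "hedge_rel P = {(s, d). \<exists>S. (S, d) \<in> hedges P \<and> s \<in> S}"

text \<open>A cycle of the relation unrolls to a cyclic path of the hypergraph. Well-foundedness
  supplies the minimal vertices from which a list is extended.\<close>

lemma wf_hedge_rel:
  assumes "hypergraph P" "acyclic_hypergraph P"
  shows "wf (hedge_rel P)"
proof (rule finite_acyclic_wf)
  have "hedge_rel P \<subseteq> verts P \<times> verts P" "finite (verts P)"
    using assms(1) by (auto simp: hypergraph_def hedge_rel_def)
  then show "finite (hedge_rel P)" by (meson finite_SigmaI finite_subset)
  have path: "\<exists>es. es \<noteq> [] \<and> hpath P a es \<and> snd (last es) = b" if "(a, b) \<in> (hedge_rel P)\<^sup>+" for a b
    using that
  proof (induction rule: converse_trancl_induct)
    case (base a)
    then obtain S where "(S, b) \<in> hedges P" "a \<in> S" by (auto simp: hedge_rel_def)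
    then show ?case by (intro exI[of _ "[(S, b)]"]) simp
  next
    case (step a c)
    then obtain es where "es \<noteq> []" "hpath P c es" "snd (last es) = b" by blast
    moreover from step obtain S where "(S, c) \<in> hedges P" "a \<in> S" by (auto simp: hedge_rel_def)
    ultimately show ?case by (intro exI[of _ "(S, c) # es"]) simp
  qed
  then show "acyclic (hedge_rel P)"
    using assms(2) unfolding acyclic_def acyclic_hypergraph_def by blast
qed

text \<open>A longest list of distinct vertices exhausts the image of the proof.\<close>

lemma derivation_list_of_proof:
  assumes P: "derivation_structure sat T P" "acyclic_hypergraph P" and h: "homomorphism h P H"
  shows "\<exists>vs. derivation_list H T vs \<and> distinct vs \<and> set vs = h ` verts P"
proof -
  let ?U = "h ` verts P"
  let ?Q = "\<lambda>vs. derivation_list H T vs \<and> distinct vs \<and> set vs \<subseteq> ?U"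
  have hyp: "hypergraph P" using P(1) by (simp add: derivation_structure_def)
  then have fin: "finite ?U" by (simp add: hypergraph_def)
  have bound: "length vs < Suc (card ?U)" if "?Q vs" for vs
    using that card_mono[OF fin, of "set vs"] distinct_card[of vs] by simp
  have "\<exists>vs. ?Q vs \<and> (\<forall>vs'. ?Q vs' \<longrightarrow> length vs' \<le> length vs)"
    by (rule ex_has_greatest_nat[of ?Q "[]" length "Suc (card ?U)"]) (simp, use bound in blast)
  then obtain vs where vs: "?Q vs" and max: "\<And>vs'. ?Q vs' \<Longrightarrow> length vs' \<le> length vs"
    by blast
  have "?U \<subseteq> set vs"
  proof (rule ccontr)
    assume "\<not> ?U \<subseteq> set vs"
    then have "{u \<in> verts P. h u \<notin> set vs} \<noteq> {}" by auto
    \<comment> \<open>A minimal vertex with unlisted image: the images of all its predecessors are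
      listed, so its own image could be appended to the longest list.\<close>
    then obtain u where "u \<in> {u \<in> verts P. h u \<notin> set vs}"
      "\<And>y. (y, u) \<in> hedge_rel P \<Longrightarrow> y \<notin> {u \<in> verts P. h u \<notin> set vs}"
      by (rule wfE_min'[OF wf_hedge_rel[OF hyp P(2)]]) blast
    then have u: "u \<in> verts P" "h u \<notin> set vs"
      and min: "\<And>y. (y, u) \<in> hedge_rel P \<Longrightarrow> y \<in> verts P \<Longrightarrow> h y \<in> set vs"
      by blast+
    have "lab H (h u) \<in> T \<or> (\<exists>S. (S, h u) \<in> hedges H \<and> S \<subseteq> set vs)"
    proof (cases "leaf P u")
      case True
      then show ?thesis using P(1) h u by (auto simp: derivation_structure_def homomorphism_def)
    next
      case False
      then obtain S where S: "(S, u) \<in> hedges P" using u by (auto simp: leaf_def)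
      then have "S \<subseteq> verts P" using hyp by (auto simp: hypergraph_def)
      then have "h ` S \<subseteq> set vs" using S min by (auto simp: hedge_rel_def)
      moreover have "(h ` S, h u) \<in> hedges H" using S h by (auto simp: homomorphism_def)
      ultimately show ?thesis by blast
    qed
    moreover have "h u \<in> verts H" using h u by (auto simp: homomorphism_def)
    ultimately have "?Q (vs @ [h u])" using vs u by (auto simp: derivation_list_snoc)
    from max[OF this] show False by simp
  qed
  with vs show ?thesis by blast
qed

text \<open>Only a sink that is also a leaf could avoid all hyperedges, and its label \<eta> would
  then belong to the theory. Hence all indices to be guessed obey the index bound.\<close>

lemma proof_verts_in_hedges:
  assumes P: "is_proof sat T \<eta> P" and h: "homomorphism h P H" and \<eta>: "\<eta> \<notin> T"
  shows "h ` verts P \<subseteq> hedge_verts H"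
proof
  fix x assume "x \<in> h ` verts P"
  then obtain u where u: "u \<in> verts P" "x = h u" by blast
  obtain g where g: "{v. sink P v} = {g}" "lab P g = \<eta>" using P by (auto simp: is_proof_def)
  show "x \<in> hedge_verts H"
  proof (cases "sink P u")
    case True
    then have "lab P u \<notin> T" using g \<eta> by auto
    then have "\<not> leaf P u" using P by (auto simp: is_proof_def derivation_structure_def)
    then obtain S where "(S, u) \<in> hedges P" using u by (auto simp: leaf_def)
    then have "(h ` S, h u) \<in> hedges H" using h by (auto simp: homomorphism_def)
    then show ?thesis using u by (auto simp: hedge_verts_def)
  next
    case False
    then obtain S d where S: "(S, d) \<in> hedges P" "u \<in> S" using u by (auto simp: sink_def)
    have "(h ` S, h d) \<in> hedges H" using S(1) h by (auto simp: homomorphism_def)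
    moreover have "x \<in> h ` S" using S(2) u by simp
    ultimately show ?thesis unfolding hedge_verts_def by blast
  qed
qed

lemma derivation_list_of_admissible_proof:
  assumes P: "is_proof sat T \<eta> P" and h: "homomorphism h P H"
  shows "\<exists>vs. derivation_list H T vs \<and> distinct vs \<and> length vs \<le> card (verts P) \<and>
    \<eta> \<in> lab H ` set vs \<and> (\<eta> \<notin> T \<longrightarrow> set vs \<subseteq> hedge_verts H)"
proof -
  have ds: "derivation_structure sat T P" "acyclic_hypergraph P" using P by (auto simp: is_proof_def)
  from derivation_list_of_proof[OF this h] obtain vs
    where vs: "derivation_list H T vs" "distinct vs" "set vs = h ` verts P" by blast
  have "finite (verts P)" using ds by (auto simp: derivation_structure_def hypergraph_def)
  then have "length vs \<le> card (verts P)"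
    using distinct_card[OF vs(2)] vs(3) card_image_le by metis
  moreover obtain g where "g \<in> verts P" "lab P g = \<eta>"
    using P by (auto simp: is_proof_def sink_def)
  then have "\<eta> = lab H (h g)" "h g \<in> set vs"
    using h unfolding vs(3) homomorphism_def by simp_all
  then have "\<eta> \<in> lab H ` set vs" by blast
  moreover have "\<eta> \<notin> T \<longrightarrow> set vs \<subseteq> hedge_verts H"
    using proof_verts_in_hedges[OF P h] vs(3) by blast
  ultimately show ?thesis using vs by blast
qed


section \<open>Encodings\<close>

lemma val_bin [simp]: "val (bin n) = n"
proof (induction n rule: less_induct)
  case (less n)
  then show ?case
    by (subst bin.simps) (cases "n = 0"; auto simp: odd_two_times_div_two_succ)
qed

lemma bin_eq_iff [simp]: "bin m = bin n \<longleftrightarrow> m = n"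
  by (metis val_bin)

lemma bin_eq_Nil_iff [simp]: "bin n = [] \<longleftrightarrow> n = 0"
proof
  assume "bin n = []"
  then show "n = 0" using val_bin[of n] by simp
qed (subst bin.simps, simp)

lemma bits_eq_iff [simp]: "bits v = bits w \<longleftrightarrow> v = w"
proof (induction v arbitrary: w)
  case Nil
  then show ?case by (cases w) auto
next
  case (Cons a v)
  then show ?case by (cases w) auto
qed

text \<open>The terminator 3 lies outside the alphabet of \<open>bits\<close>, which makes the code
  prefix-free.\<close>

lemma bits_append_eq_iff [simp]: "bits v @ 3 # r = bits w @ 3 # s \<longleftrightarrow> v = w \<and> r = s"
proof (induction v arbitrary: w)
  case Nil
  then show ?case by (cases w) auto
next
  case (Cons a v)
  then show ?case by (cases w) auto
qed

lemma cont_eq_iff [simp]: "cont us = cont vs \<longleftrightarrow> us = vs"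
proof (induction us arbitrary: vs)
  case Nil
  then show ?case by (cases vs) auto
next
  case (Cons u us)
  then show ?case by (cases vs) auto
qed

lemma hedge_query_eq: "hedge_query is = 3 # cont (map bin is)"
  by (simp add: hedge_query_def cont_def o_def)

lemma hedge_in_oracle_iff:
  "3 # cont us \<in> structure_oracle enc num H \<longleftrightarrow>
    (\<exists>vs d. (set vs, d) \<in> hedges H \<and> us = map (bin \<circ> num) (vs @ [d]))"
  by (auto simp: structure_oracle_def hedge_query_eq label_query_def simp del: map_append cont_simps)

lemma label_in_oracle_iff:
  "4 # bits w @ 3 # bits a \<in> structure_oracle enc num H \<longleftrightarrow>
    (\<exists>v\<in>verts H. w = bin (num v) \<and> a = enc (lab H v))"
  by (auto simp: structure_oracle_def hedge_query_eq label_query_def)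


section \<open>Correctness of the checking phase\<close>

text \<open>\<open>goal\<close> justifies accepting a goal from the theory without naming a vertex.
  \<open>C\<close>, \<open>Z\<close> and \<open>Y\<close> stand for arbitrary contents of tapes 5 to
  7.\<close>

locale mp_instance =
  fixes sat :: "'m \<Rightarrow> 's \<Rightarrow> bool" and H :: "('v, 's) hypergraph" and num :: "'v \<Rightarrow> nat"
    and enc :: "'s \<Rightarrow> bool list" and \<alpha>s :: "'s list" and \<eta> :: 's and n :: nat and C Z Y :: tape
  assumes H: "derivation_structure sat (set \<alpha>s) H"
    and num: "inj_on num (verts H)"
    and enc: "inj enc"
    and goal: "\<eta> \<in> set \<alpha>s \<Longrightarrow> \<exists>v\<in>verts H. lab H v = \<eta>"
begin

abbreviation "X \<equiv> structure_oracle enc num H"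
abbreviation "idx \<equiv> bin \<circ> num"
abbreviation "conf \<equiv> cfg (map enc \<alpha>s) (enc \<eta>) (bits (enc \<eta>) @ 4 # bits (bin n)) C Z Y"

text \<open>This is what an accepting run provides, so the list may contain repetitions;
  completeness regains a distinct list by passing to a proof with
  \<open>small_derivation_iff\<close>.\<close>

definition small_derivation :: bool where
  "small_derivation \<longleftrightarrow>
     (\<exists>vs. derivation_list H (set \<alpha>s) vs \<and> length vs \<le> n \<and> \<eta> \<in> lab H ` set vs)"

lemma small_derivation_iff:
  "small_derivation \<longleftrightarrow> (\<exists>P :: (nat, 's) hypergraph.
     is_proof sat (set \<alpha>s) \<eta> P \<and> admissible P H \<and> card (verts P) \<le> n)"
proof
  assume small_derivation
  then obtain vs v where "derivation_list H (set \<alpha>s) vs" "length vs \<le> n" "v \<in> set vs" "lab H v = \<eta>"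
    by (auto simp: small_derivation_def)
  with proof_of_derivation_list[OF H] show "\<exists>P :: (nat, 's) hypergraph.
     is_proof sat (set \<alpha>s) \<eta> P \<and> admissible P H \<and> card (verts P) \<le> n"
    by (meson le_trans)
next
  assume "\<exists>P :: (nat, 's) hypergraph.
     is_proof sat (set \<alpha>s) \<eta> P \<and> admissible P H \<and> card (verts P) \<le> n"
  then obtain P :: "(nat, 's) hypergraph" and h where P: "is_proof sat (set \<alpha>s) \<eta> P" "homomorphism h P H"
    "card (verts P) \<le> n" by (auto simp: admissible_def)
  from derivation_list_of_admissible_proof[OF P(1,2)] P(3) show small_derivation
    unfolding small_derivation_def by (meson le_trans)
qed

lemma subseqs_map: "subseqs (map f xs) = map (map f) (subseqs xs)"
  by (induction xs) (simp_all add: Let_def)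

text \<open>The oracle accepts every enumeration of a tail, so the subsequence of \<open>vs\<close>
  lying in \<open>S\<close> can be used; conversely, injectivity of the numbering recovers the tail
  from the copied indices.\<close>

lemma derivable_iff:
  assumes vs: "set vs \<subseteq> verts H"
  shows "derivable X (map enc \<alpha>s) (map idx vs) w \<longleftrightarrow> (\<exists>v. w = idx v \<and> v \<in> verts H \<and>
     (lab H v \<in> set \<alpha>s \<or> (\<exists>S. (S, v) \<in> hedges H \<and> S \<subseteq> set vs)))"
proof -
  have hyp: "hypergraph H" using H by (simp add: derivation_structure_def)
  have "(\<exists>a\<in>set (map enc \<alpha>s). 4 # bits w @ 3 # bits a \<in> X) \<longleftrightarrow>
    (\<exists>v. w = idx v \<and> v \<in> verts H \<and> lab H v \<in> set \<alpha>s)"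
    unfolding label_in_oracle_iff using enc by (auto simp: inj_eq)
  moreover have "(\<exists>us\<in>set (subseqs (map idx vs)). 3 # cont (us @ [w]) \<in> X) \<longleftrightarrow>
    (\<exists>v. w = idx v \<and> v \<in> verts H \<and> (\<exists>S. (S, v) \<in> hedges H \<and> S \<subseteq> set vs))"
  proof
    assume "\<exists>us\<in>set (subseqs (map idx vs)). 3 # cont (us @ [w]) \<in> X"
    then obtain us vs' d where us: "us \<in> set (subseqs (map idx vs))" "(set vs', d) \<in> hedges H"
      "us @ [w] = map idx (vs' @ [d])" unfolding hedge_in_oracle_iff by blast
    then have d: "set vs' \<subseteq> verts H" "d \<in> verts H" using hyp by (auto simp: hypergraph_def)
    have "num ` set vs' \<subseteq> num ` set vs" using subseqs_subset[OF us(1)] us(3) by auto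
    then have "set vs' \<subseteq> set vs" using num d(1) vs unfolding inj_on_def by blast
    then show "\<exists>v. w = idx v \<and> v \<in> verts H \<and> (\<exists>S. (S, v) \<in> hedges H \<and> S \<subseteq> set vs)"
      using us d by auto
  next
    assume "\<exists>v. w = idx v \<and> v \<in> verts H \<and> (\<exists>S. (S, v) \<in> hedges H \<and> S \<subseteq> set vs)"
    then obtain v S where v: "w = idx v" "(S, v) \<in> hedges H" "S \<subseteq> set vs" by blast
    let ?us = "filter (\<lambda>v. v \<in> S) vs"
    have "map idx ?us \<in> set (subseqs (map idx vs))"
      using subseqs_filter[of "\<lambda>v. v \<in> S" vs] by (simp add: subseqs_map)
    moreover have "3 # cont (map idx ?us @ [w]) \<in> X"
      unfolding hedge_in_oracle_iff using v by (intro exI[of _ ?us] exI[of _ v]) (auto simp: Int_absorb1 Collect_conj_eq)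
    ultimately show "\<exists>us\<in>set (subseqs (map idx vs)). 3 # cont (us @ [w]) \<in> X" by blast
  qed
  ultimately show ?thesis unfolding derivable_def by blast
qed

text \<open>The invariants say that the counter still covers all further vertices, and that a
  nonempty counter witnesses 0 < n. The latter serves the case of a goal in the theory, where the
  guessed list is replaced by a single vertex.\<close>

lemma checking_sound:
  assumes "ac checker X c S0 (conf (map idx vs) nb)" "derivation_list H (set \<alpha>s) vs"
    "length vs + val nb \<le> n" "nb \<noteq> [] \<Longrightarrow> 0 < n"
  shows small_derivation
  using assms
proof (induction c arbitrary: vs nb rule: less_induct)
  case (less c)
  have vs: "set vs \<subseteq> verts H" using derivation_list_verts[OF less.prems(2)] .
  from A_S0_sound[OF less.prems(1)] consider
    "enc \<eta> \<in> set (map enc \<alpha>s)" "nb \<noteq> []" | w where "w \<in> set (map idx vs)" "4 # bits w @ 3 # bits (enc \<eta>) \<in> X"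
    | w nb' c' where "c' < c" "0 < val nb" "val nb' = val nb - 1" "length nb' = length nb"
      "derivable X (map enc \<alpha>s) (map idx vs) w" "ac checker X c' S0 (conf (map idx vs @ [w]) nb')"
    by blast
  then show ?case
  proof cases
    case 1
    then have "\<eta> \<in> set \<alpha>s" using enc by (auto simp: inj_eq)
    moreover from goal[OF this] obtain v where "v \<in> verts H" "lab H v = \<eta>" by blast
    ultimately have "derivation_list H (set \<alpha>s) ([] @ [v])" unfolding derivation_list_snoc by auto
    then show ?thesis
      unfolding small_derivation_def using \<open>lab H v = \<eta>\<close> less.prems(4)[OF 1(2)] by (intro exI[of _ "[v]"]) auto
  next
    case 2
    then obtain v v' where v: "v \<in> set vs" "v' \<in> verts H" "num v = num v'" "lab H v' = \<eta>"
      using enc unfolding label_in_oracle_iff by (auto simp: inj_eq)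
    then have "v' = v" using num vs by (auto simp: inj_on_def)
    then show ?thesis unfolding small_derivation_def
      using v less.prems(2,3) by (intro exI[of _ vs]) auto
  next
    case 3
    from 3(5) obtain v where v: "w = idx v" "v \<in> verts H"
     "lab H v \<in> set \<alpha>s \<or> (\<exists>S. (S, v) \<in> hedges H \<and> S \<subseteq> set vs)"
      unfolding derivable_iff[OF vs] by blast
    show ?thesis
    proof (rule less.IH[OF 3(1)])
      show "ac checker X c' S0 (conf (map idx (vs @ [v])) nb')" using 3(6) v(1) by simp
      show "derivation_list H (set \<alpha>s) (vs @ [v])" unfolding derivation_list_snoc using less.prems v by blast
      show "length (vs @ [v]) + val nb' \<le> n" using 3 less.prems by simp
      show "0 < n" if "nb' \<noteq> []" using that 3(4) less.prems(4) by (cases nb) auto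
    qed
  qed
qed

lemma length_cont_idx:
  assumes "\<forall>v\<in>set vs. length (idx v) \<le> b"
  shows "length (cont (map idx vs)) \<le> length vs * (b + 1)"
  using assms by (induction vs) auto

text \<open>\<open>us\<close> is already on the tape and \<open>vs\<close> remains to be guessed. As
  \<open>m\<close> bounds the list tape throughout, every round can be charged the same
  amount.\<close>

lemma checking_complete:
  assumes "derivation_list H (set \<alpha>s) (us @ vs)" "\<eta> \<in> lab H ` set (us @ vs)"
    "\<forall>v\<in>set (us @ vs). length (idx v) \<le> b" "length vs \<le> val nb" "length (us @ vs) * (b + 1) \<le> m"
  shows "ac checker X (length vs * (6 * m + 5 * length (cont (map enc \<alpha>s)) + 2 * length nb + 30) +
    (2 * m + length (enc \<eta>) + 5)) S0 (conf (map idx us) nb)"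
  using assms
proof (induction vs arbitrary: us nb)
  case Nil
  then obtain v where v: "v \<in> set us" "lab H v = \<eta>" by auto
  have "length (cont (map idx us)) \<le> length us * (b + 1)" using Nil by (intro length_cont_idx) simp
  also have "\<dots> \<le> m" using Nil by simp
  finally have le: "length (cont (map idx us)) \<le> m" .
  show ?case
  proof (rule A_S0_accept_label)
    show "idx v \<in> set (map idx us)" using v by simp
    show "4 # bits (idx v) @ 3 # bits (enc \<eta>) \<in> X"
      unfolding label_in_oracle_iff using v derivation_list_verts[OF Nil(1)] by auto
  qed (use le in \<open>simp add: o_def\<close>)
next
  case (Cons v vs)
  have us: "set us \<subseteq> verts H" "v \<in> verts H" using derivation_list_verts[OF Cons.prems(1)] by auto
  have "lab H v \<in> set \<alpha>s \<or> (\<exists>S. (S, v) \<in> hedges H \<and> S \<subseteq> set us)"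
    using Cons.prems(1) unfolding derivation_list_def by (auto dest!: spec[of _ "length us"])
  then have der: "derivable X (map enc \<alpha>s) (map idx us) (idx v)"
    unfolding derivable_iff[OF us(1)] using us(2) by blast
  let ?K = "6 * m + 5 * length (cont (map enc \<alpha>s)) + 2 * length nb + 30"
  let ?E = "2 * m + length (enc \<eta>) + 5"
  have "0 < val nb" using Cons.prems by simp
  from A_S0_step[OF der this] obtain nb' where nb': "val nb' = val nb - 1" "length nb' = length nb"
    "\<And>c. ac checker X c S0 (conf (map idx us @ [idx v]) nb') \<Longrightarrow>
      ac checker X (c + 6 * length (cont (map idx us @ [idx v])) + 5 * length (cont (map enc \<alpha>s)) + 2 * length nb + 30)
       S0 (conf (map idx us) nb)" by metis
  have "length (cont (map idx (us @ [v]))) \<le> length (us @ [v]) * (b + 1)"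
    using Cons.prems by (intro length_cont_idx) simp
  also have "\<dots> \<le> length (us @ v # vs) * (b + 1)" by (intro mult_le_mono1) simp
  also have "\<dots> \<le> m" using Cons.prems by simp
  finally have le: "length (cont (map idx us @ [idx v])) \<le> m" by simp
  have "ac checker X (length vs * (6 * m + 5 * length (cont (map enc \<alpha>s)) + 2 * length nb' + 30) +
    (2 * m + length (enc \<eta>) + 5)) S0 (conf (map idx (us @ [v])) nb')"
    using Cons.prems nb'(1) by (intro Cons.IH) simp_all
  then have a: "ac checker X (length vs * ?K + ?E) S0 (conf (map idx us @ [idx v]) nb')"
    using nb'(2) by simp
  show ?case
    by (rule ac_mono[OF nb'(3)[OF a]]) (unfold length_Cons mult_Suc, use le in linarith)
qed

text \<open>At most \<open>U\<close> rounds cost 49 * U ^ 2 each and the final test at most 10 * U ^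
  3, which 64 * U ^ 3 covers; 64 is a power of two for the sake of the exponential case.\<close>

lemma checking_iff:
  assumes U: "length (cont (map enc \<alpha>s)) \<le> U" "length (enc \<eta>) \<le> U" "length (bin n) \<le> U" "0 < U"
    and idx: "\<forall>v\<in>hedge_verts H. length (idx v) \<le> U" and card: "card (hedge_verts H) \<le> U"
    and c: "64 * U ^ 3 \<le> c"
  shows "ac checker X c S0 (conf [] (bin n)) \<longleftrightarrow> small_derivation"
proof
  assume "ac checker X c S0 (conf [] (bin n))"
  then show small_derivation
    using checking_sound[of c "[]" "bin n"] by auto
next
  assume pos: small_derivation
  have U3: "U \<le> U ^ 2" "U ^ 2 \<le> U ^ 3" "1 \<le> U"
    using U(4) by (auto intro!: self_le_power power_increasing)
  show "ac checker X c S0 (conf [] (bin n))"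
  proof (cases "\<eta> \<in> set \<alpha>s")
    case True
    obtain vs where "length vs \<le> n" "\<eta> \<in> lab H ` set vs"
      using pos unfolding small_derivation_def by blast
    then have "0 < n" by (cases vs) auto
    then show ?thesis using True U c U3 by (intro A_S0_accept_goal) auto
  next
    case False
    \<comment> \<open>The given list may be long and contain isolated vertices. Going through a
      proof yields a distinct list inside \<open>hedge_verts H\<close>, whose length and indices are
      bounded by \<open>U\<close>.\<close>
    from pos[unfolded small_derivation_iff] obtain P :: "(nat, 's) hypergraph" and h
      where P: "is_proof sat (set \<alpha>s) \<eta> P" "homomorphism h P H" "card (verts P) \<le> n"
      by (auto simp: admissible_def)
    from derivation_list_of_admissible_proof[OF P(1,2)] False obtain vs
      where vs: "derivation_list H (set \<alpha>s) vs" "distinct vs" "length vs \<le> card (verts P)"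
        "\<eta> \<in> lab H ` set vs" "set vs \<subseteq> hedge_verts H" by blast
    have "hypergraph H" using H by (simp add: derivation_structure_def)
    then have "hedge_verts H \<subseteq> verts H" "finite (verts H)" by (auto simp: hypergraph_def hedge_verts_def)
    then have "finite (hedge_verts H)" by (rule finite_subset)
    then have len: "length vs \<le> U"
      using card_mono[OF _ vs(5)] distinct_card[OF vs(2)] card by simp
    let ?K = "6 * (U * (U + 1)) + 5 * length (cont (map enc \<alpha>s)) + 2 * length (bin n) + 30"
    have "ac checker X (length vs * ?K + (2 * (U * (U + 1)) + length (enc \<eta>) + 5))
      S0 (conf (map idx []) (bin n))"
    proof (rule checking_complete)
      show "\<forall>v\<in>set ([] @ vs). length (idx v) \<le> U" using idx vs(5) by auto
      show "length ([] @ vs) * (U + 1) \<le> U * (U + 1)" using mult_le_mono1[OF len, of "U + 1"] by simp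
    qed (use vs P(3) in simp_all)
    then have "ac checker X (length vs * ?K + (2 * (U * (U + 1)) + length (enc \<eta>) + 5))
      S0 (conf [] (bin n))" by simp
    then show ?thesis
    proof (rule ac_mono)
      define V where "V = U * U"
      have V: "U \<le> V" "V \<le> U ^ 3" "U * (U + 1) = V + U" "U * (49 * V) = 49 * U ^ 3"
        using U3 by (simp_all add: V_def power2_eq_square power3_eq_cube)
      \<comment> \<open>49 = 6 + 6 + 5 + 2 + 30, each of the terms being bounded by a multiple of
        \<open>V\<close>.\<close>
      have K: "?K \<le> 49 * V"
        unfolding V(3) unfolding distrib_left using U U3(3) V(1) by linarith
      have "length vs * ?K \<le> U * (49 * V)"
        by (rule mult_le_mono[OF len K])
      then have "length vs * ?K \<le> 49 * U ^ 3" unfolding V(4) .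
      moreover have "2 * (U * (U + 1)) + length (enc \<eta>) + 5 \<le> 10 * U ^ 3"
        unfolding V(3) unfolding distrib_left using U U3(3) V(1,2) by linarith
      ultimately show "length vs * ?K + (2 * (U * (U + 1)) + length (enc \<eta>) + 5) \<le> c"
        using c U3 by linarith
    qed
  qed
qed

end


section \<open>Polynomial bounds\<close>

lemma poly_mono_nat: "x \<le> y \<Longrightarrow> poly p x \<le> poly p y" for x y :: nat
  by (induction p) (auto intro: mult_le_mono)

text \<open>Powers are the clocks that the preprocessing can produce. Encoded instances have length
  at least 2 because of their two separators.\<close>

lemma poly_le_power: "\<exists>k. \<forall>N\<ge>2. poly p N \<le> N ^ k" for p :: "nat poly"
proof (induction p)
  case (pCons a p)
  then obtain k where k: "\<And>N. N \<ge> 2 \<Longrightarrow> poly p N \<le> N ^ k" by blast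
  have "poly (pCons a p) N \<le> N ^ (a + k + 2)" if N: "N \<ge> 2" for N
  proof -
    have "a \<le> N ^ a"
      using N by (meson less_exp less_imp_le le_trans power_mono zero_le)
    also have "\<dots> \<le> N ^ (a + k + 1)" using N by (intro power_increasing) auto
    finally have 1: "a \<le> N ^ (a + k + 1)" .
    have "N * poly p N \<le> N * N ^ k" using k[OF N] by simp
    also have "\<dots> = N ^ (k + 1)" by simp
    also have "\<dots> \<le> N ^ (a + k + 1)" using N by (intro power_increasing) auto
    finally have "N * poly p N \<le> N ^ (a + k + 1)" .
    with 1 have "a + N * poly p N \<le> N ^ (a + k + 1) + N ^ (a + k + 1)" by (rule add_mono)
    then have "poly (pCons a p) N \<le> 2 * N ^ (a + k + 1)" by (simp add: mult_2)
    also have "\<dots> \<le> N * N ^ (a + k + 1)" using N by (intro mult_le_mono1)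
    finally show ?thesis by simp
  qed
  then show ?case by blast
qed auto


lemma add_le_Suc_mult: "0 < b \<Longrightarrow> a + b \<le> (a + 1) * b" for a b :: nat
  by (simp add: add_mult_distrib)


section \<open>Running time\<close>

lemma init_config_machine:
  "init_config (ntm_of 8 5 (machine k e)) w = conc 8 (Z0, tps (input_tape w) (input_tape [])
     (input_tape []) (input_tape []) (input_tape []) (input_tape []) (input_tape []) (input_tape []))"
proof -
  have "[0..<8] = [0, 1, 2, 3, 4, 5, 6, 7]" by (simp add: upt_rec)
  moreover have "input_tape [] = ((\<lambda>_. 0), 0)" by (auto simp: input_tape_def)
  moreover have "replicate 7 x = [x, x, x, x, x, x, x]" for x :: tape
    by (simp add: eval_nat_numeral)
  ultimately show ?thesis
    by (simp add: init_config_def conc_def ntm_of_def clocked_def)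
qed

lemma machine_halts_and_accepts:
  assumes run: "drun_le (table1 k e) t (Z0, tps (input_tape w) (input_tape []) (input_tape []) (input_tape [])
      (input_tape []) (input_tape []) (input_tape []) (input_tape [])) (S0, tps I Q G E N (clock 0 c) Z Y)"
    and w: "set w \<subseteq> {1..<5}"
  shows "all_runs_halt_within (ntm_of 8 5 (machine k e)) X w (t + 2 * c)"
    and "accepts (ntm_of 8 5 (machine k e)) X w \<longleftrightarrow> ac checker X c S0 (tps I Q G E N C Z Y)"
proof -
  let ?F = "tps (input_tape w) (input_tape []) (input_tape []) (input_tape [])
      (input_tape []) (input_tape []) (input_tape []) (input_tape [])"
  let ?M = "machine k e"
  from run obtain d where d: "d \<le> t" "drun (table1 k e) d (Z0, ?F) (S0, tps I Q G E N (clock 0 c) Z Y)"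
    unfolding drun_le_def by blast
  have init: "init_config (ntm_of 8 5 ?M) w = conc 8 (st_init ?M, ?F)"
    unfolding init_config_machine by (simp add: clocked_def)
  have tab: "table ?M q = table1 k e q" if "table1 k e q \<noteq> []" for q
    using table2_Nil[OF that] by (simp add: clocked_def)
  have "halts ?M X (2 * c + of_bool (S0 = st_qry checker)) (S0, (tps I Q G E N C Z Y)(5 := clock 0 c))"
    by (rule checker.halts_clocked) simp
  then have "halts ?M X (2 * c) (S0, tps I Q G E N (clock 0 c) Z Y)" by simp
  from halts_drun[OF d(2) tab _ this] have "halts ?M X (d + 2 * c) (Z0, ?F)"
    by (simp add: clocked_def)
  then have "halts ?M X (t + 2 * c) (st_init ?M, ?F)"
    using d(1) by (auto simp: clocked_def elim!: halts_mono)
  then show "all_runs_halt_within (ntm_of 8 5 ?M) X w (t + 2 * c)"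
    by (intro all_runs_halt_ntm_of[OF machine_ok _ init]) simp_all
  have "bounded 8 5 ?F"
  proof -
    have "fst (input_tape v) i \<le> 5" if "set v \<subseteq> {1..<5}" for v i
    proof (cases "0 \<le> i \<and> nat i < length v")
      case True
      then have "v ! nat i \<in> {1..<5}" using that by (meson nth_mem subsetD)
      then show ?thesis using True by (simp add: input_tape_def)
    qed (auto simp: input_tape_def)
    then show ?thesis using w by (auto simp: bounded_def dest!: less_8_cases)
  qed
  from accepts_ntm_of[OF machine_ok _ this init]
  have "accepts (ntm_of 8 5 ?M) X w \<longleftrightarrow> (\<exists>F'. (astep ?M X)\<^sup>*\<^sup>* (Z0, ?F) (st_acc ?M, F'))"
    by (simp add: clocked_def)
  also have "\<dots> \<longleftrightarrow> (\<exists>F'. (astep ?M X)\<^sup>*\<^sup>* (S0, tps I Q G E N (clock 0 c) Z Y) (st_acc ?M, F'))"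
    using reach_drun[OF d(2) tab, of X] by (simp add: clocked_def)
  also have "\<dots> \<longleftrightarrow> (\<exists>F'. (astep ?M X)\<^sup>*\<^sup>* (S0, (tps I Q G E N C Z Y)(5 := clock 0 c)) (st_acc checker, F'))"
    by (simp add: clocked_def)
  also have "\<dots> \<longleftrightarrow> ac checker X c S0 (tps I Q G E N C Z Y)"
    by (rule checker.accepts_clocked) simp
  finally show "accepts (ntm_of 8 5 ?M) X w \<longleftrightarrow> ac checker X c S0 (tps I Q G E N C Z Y)" .
qed


section \<open>Instances of the minimal proof problem\<close>

lemma encode_instance_eq:
  "encode_instance enc (\<alpha>s, \<eta>, n) = cont (map enc \<alpha>s) @ [4] @ bits (enc \<eta>) @ [4] @ bits (bin n)"
  by (simp add: encode_instance_def cont_def o_def)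

text \<open>Every sentence of the instance is written out in it, and there are at most as many
  sentences as input symbols, whence the additional factor \<open>[:0, 1:]\<close>.\<close>

lemma size_le_encode:
  assumes "\<And>\<alpha>. sz \<alpha> \<le> poly p (length (enc \<alpha>))" "distinct \<alpha>s"
  shows "theory_size sz (set \<alpha>s) + sz \<eta> \<le> poly ([:0, 1:] * p) (length (encode_instance enc (\<alpha>s, \<eta>, n)))"
proof -
  let ?N = "length (encode_instance enc (\<alpha>s, \<eta>, n))"
  have "sz \<alpha> \<le> poly p ?N" if "\<alpha> \<in> set \<alpha>s \<union> {\<eta>}" for \<alpha>
  proof -
    have "length (enc \<alpha>) \<le> length (cont (map enc \<alpha>s))" if "\<alpha> \<in> set \<alpha>s"
      using that by (induction \<alpha>s) auto
    then have "length (enc \<alpha>) \<le> ?N" using \<open>\<alpha> \<in> set \<alpha>s \<union> {\<eta>}\<close> by (auto simp: encode_instance_eq)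
    from poly_mono_nat[OF this] show ?thesis using assms(1)[of \<alpha>] by (rule le_trans[rotated])
  qed
  then have "theory_size sz (set \<alpha>s) \<le> of_nat (card (set \<alpha>s)) * poly p ?N" "sz \<eta> \<le> poly p ?N"
    unfolding theory_size_def by (blast intro: sum_bounded_above)+
  then have "theory_size sz (set \<alpha>s) + sz \<eta> \<le> (length \<alpha>s + 1) * poly p ?N"
    using assms(2) by (simp add: distinct_card)
  also have "\<dots> \<le> ?N * poly p ?N"
    using length_le_cont[of "map enc \<alpha>s"] by (intro mult_le_mono1) (simp add: encode_instance_eq)
  finally show ?thesis by simp
qed

text \<open>Common core of both complexity bounds: \<open>U\<close> dominates all relevant
  quantities, and \<open>clock\<close> abstracts from the way the clock is computed.\<close>

lemma machine_decides:
  fixes U :: "nat \<Rightarrow> nat" and D :: "'s set \<Rightarrow> 's \<Rightarrow> ('v, 's) hypergraph"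
  assumes sz: "\<And>\<alpha>. 0 < sz \<alpha>" and enc: "inj enc" and num: "vertex_numbering C D num" and D: "deriver sat C D"
    and U: "\<And>N. N \<le> U N"
    and size: "\<And>\<alpha>s \<eta> n. distinct \<alpha>s \<Longrightarrow> \<eta> \<in> C \<Longrightarrow>
      hypergraph_size sz (D (set \<alpha>s) \<eta>) \<le> U (length (encode_instance enc (\<alpha>s, \<eta>, n)))"
    and idx: "\<And>\<alpha>s \<eta> n v. distinct \<alpha>s \<Longrightarrow> \<eta> \<in> C \<Longrightarrow> v \<in> hedge_verts (D (set \<alpha>s) \<eta>) \<Longrightarrow>
      length (bin (num (set \<alpha>s) \<eta> v)) \<le> U (length (encode_instance enc (\<alpha>s, \<eta>, n)))"
    and clock: "\<And>ts es ns w. set ts \<subseteq> {1, 2, 3} \<Longrightarrow> set es \<subseteq> {1, 2} \<Longrightarrow> set ns \<subseteq> {1, 2} \<Longrightarrow>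
      w = ts @ [4] @ es @ [4] @ ns \<Longrightarrow> \<exists>Z Y c r. 64 * U (length w) ^ 3 \<le> c \<and> r + 2 * c \<le> t (length w) \<and>
      drun_le (table1 k e) r
      (Z0, tps (input_tape w) (input_tape []) (input_tape []) (input_tape [])
        (input_tape []) (input_tape []) (input_tape []) (input_tape []))
      (S0, tps (tp [5] w) (tp [5] []) (tp [5] []) (tp [5] es) (tp [5] ns) (clock 0 c) Z Y)"
  shows "decides_in_time (ntm_of 8 5 (machine k e)) (MP_binary sat C D enc num) t"
  unfolding decides_in_time_def
proof
  fix x assume x: "x \<in> instances (MP_binary sat C D enc num)"
  obtain \<alpha>s \<eta> n where x_eq: "x = (\<alpha>s, \<eta>, n)" by (cases x)
  with x have inst: "distinct \<alpha>s" "\<eta> \<in> C" by (auto simp: MP_binary_def)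
  let ?H = "D (set \<alpha>s) \<eta>" and ?num = "num (set \<alpha>s) \<eta>"
  let ?w = "encode_instance enc (\<alpha>s, \<eta>, n)"
  let ?X = "structure_oracle enc ?num ?H"
  have w: "?w = cont (map enc \<alpha>s) @ [4] @ bits (enc \<eta>) @ [4] @ bits (bin n)"
    by (rule encode_instance_eq)
  have H: "derivation_structure sat (set \<alpha>s) ?H"
    and P: "entails sat (set \<alpha>s) \<eta> \<Longrightarrow> \<exists>P. substructure sat (set \<alpha>s) P ?H \<and> is_proof sat (set \<alpha>s) \<eta> P"
    using D inst by (auto simp: deriver_def)
  have "mp_instance sat ?H ?num enc \<alpha>s \<eta>"
  proof
    show "inj_on ?num (verts ?H)"
      using num inst by (auto simp: vertex_numbering_def bij_betw_def)
    \<comment> \<open>A goal in the theory is entailed, so the deriver contains a proof, whose sink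
      carries the goal.\<close>
    show "\<exists>v\<in>verts ?H. lab ?H v = \<eta>" if "\<eta> \<in> set \<alpha>s"
    proof -
      have "entails sat (set \<alpha>s) \<eta>" using that by (auto simp: entails_def)
      then obtain P where P: "substructure sat (set \<alpha>s) P ?H" "is_proof sat (set \<alpha>s) \<eta> P" using P by blast
      then obtain v where v: "{u. sink P u} = {v}" "lab P v = \<eta>" by (auto simp: is_proof_def)
      then have "v \<in> verts P" by (auto simp: sink_def)
      with P v show ?thesis by (auto simp: substructure_def)
    qed
  qed (fact H enc)+
  then interpret mp_instance sat ?H ?num enc \<alpha>s \<eta> n C' Z Y for C' Z Y .
  obtain Z Y c r where c: "64 * U (length ?w) ^ 3 \<le> c" "r + 2 * c \<le> t (length ?w)" and run: "drun_le (table1 k e) r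
      (Z0, tps (input_tape ?w) (input_tape []) (input_tape []) (input_tape [])
        (input_tape []) (input_tape []) (input_tape []) (input_tape []))
      (S0, tps (tp [5] ?w) (tp [5] []) (tp [5] []) (tp [5] (bits (enc \<eta>))) (tp [5] (bits (bin n))) (clock 0 c) Z Y)"
    using clock[OF set_cont set_bits set_bits w] by blast
  have wr: "set ?w \<subseteq> {1..<5}" unfolding w by simp
  note res = machine_halts_and_accepts[OF run wr, of ?X]
  have "ac checker ?X c S0 (tps (tp [5] ?w) (tp [5] []) (tp [5] []) (tp [5] (bits (enc \<eta>))) (tp [5] (bits (bin n)))
      (tp [] []) Z Y) \<longleftrightarrow> small_derivation"
  proof -
    have "card (hedge_verts ?H) \<le> hypergraph_size sz ?H"
      using H sz by (intro card_hedge_verts_le) (auto simp: derivation_structure_def)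
    then have card: "card (hedge_verts ?H) \<le> U (length ?w)" using size[OF inst] by (rule le_trans)
    have "\<forall>v\<in>hedge_verts ?H. length ((bin \<circ> ?num) v) \<le> U (length ?w)" using idx[OF inst] by simp
    moreover have "length (cont (map enc \<alpha>s)) \<le> U (length ?w)" "length (enc \<eta>) \<le> U (length ?w)"
      "length (bin n) \<le> U (length ?w)" "0 < U (length ?w)"
      using U[of "length ?w"] by (simp_all add: w)
    ultimately show ?thesis
      using checking_iff[OF _ _ _ _ _ card c(1), of "tp [] []" Z Y]
      by (simp add: cfg_def w)
  qed
  then have "accepts (ntm_of 8 5 (machine k e)) ?X ?w \<longleftrightarrow> small_derivation"
    using res(2)[of "tp [] []"] by simp
  moreover have "small_derivation \<longleftrightarrow> x \<in> positive (MP_binary sat C D enc num)"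
    unfolding small_derivation_iff by (simp add: MP_binary_def x_eq)
  moreover have "all_runs_halt_within (ntm_of 8 5 (machine k e)) ?X ?w (t (length ?w))"
    using res(1) c(2) unfolding all_runs_halt_within_def by (meson le_trans)
  ultimately show "all_runs_halt_within (ntm_of 8 5 (machine k e)) (oracle_of (MP_binary sat C D enc num) x)
      (encode (MP_binary sat C D enc num) x) (t (length (encode (MP_binary sat C D enc num) x))) \<and>
    accepts (ntm_of 8 5 (machine k e)) (oracle_of (MP_binary sat C D enc num) x)
      (encode (MP_binary sat C D enc num) x) = (x \<in> positive (MP_binary sat C D enc num))"
    by (simp add: MP_binary_def x_eq)
qed

theorem theorem9:
  fixes sat :: "'m \<Rightarrow> 's \<Rightarrow> bool"
    and sz :: "'s \<Rightarrow> nat"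
    and enc :: "'s \<Rightarrow> bool list"
    and C :: "'s set"
    and D :: "'s set \<Rightarrow> 's \<Rightarrow> ('v, 's) hypergraph"
    and num :: "'s set \<Rightarrow> 's \<Rightarrow> 'v \<Rightarrow> nat"
  assumes "\<And>\<alpha>. 0 < sz \<alpha>"
    and "sentence_encoding sz enc"
    and "vertex_numbering C D num"
  shows "(polynomial_deriver sat sz C D \<and> polynomial_indices sz C D num \<longrightarrow>
            MP_binary sat C D enc num \<in> NP) \<and>
         (exponential_deriver sat sz C D \<and> exponential_indices sz C D num \<longrightarrow>
            MP_binary sat C D enc num \<in> NExpTime)"
proof (intro conjI impI; elim conjE)
  from assms(2) obtain p where enc: "inj enc" and p: "\<And>\<alpha>. sz \<alpha> \<le> poly p (length (enc \<alpha>))"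
    by (auto simp: sentence_encoding_def)
  let ?s = "[:0, 1:] * p"
  let ?len = "\<lambda>\<alpha>s \<eta> n. length (encode_instance enc (\<alpha>s, \<eta>, n))"
  have poly_size: "poly q (theory_size sz (set \<alpha>s) + sz \<eta>) \<le> poly (pcompose q ?s) (?len \<alpha>s \<eta> n)"
    if "distinct \<alpha>s" for q \<alpha>s \<eta> n
    unfolding poly_pcompose by (rule poly_mono_nat[OF size_le_encode[OF p that]])
  have ntm: "ntm (ntm_of 8 5 (machine k e))" for k e
    by (rule ntm_ntm_of[OF machine_ok]) simp
  have ge2: "2 \<le> length w" if "w = ts @ [4] @ es @ [4] @ ns" for w ts es ns :: "nat list"
    using that by simp
  {
    assume "polynomial_deriver sat sz C D" "polynomial_indices sz C D num"
    then have D: "deriver sat C D" and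
      "\<exists>q. \<forall>T \<eta>. finite T \<and> \<eta> \<in> C \<longrightarrow> hypergraph_size sz (D T \<eta>) \<le> poly q (theory_size sz T + sz \<eta>)"
      "\<exists>q. \<forall>T \<eta>. finite T \<and> \<eta> \<in> C \<longrightarrow> (\<forall>v\<in>hedge_verts (D T \<eta>).
        length (bin (num T \<eta> v)) \<le> poly q (theory_size sz T + sz \<eta>))"
      unfolding polynomial_deriver_def polynomial_indices_def indices_bounded_def by blast+
    then obtain q1 q2 where
      q1: "\<And>T \<eta>. finite T \<Longrightarrow> \<eta> \<in> C \<Longrightarrow> hypergraph_size sz (D T \<eta>) \<le> poly q1 (theory_size sz T + sz \<eta>)"
      and q2: "\<And>T \<eta> v. finite T \<Longrightarrow> \<eta> \<in> C \<Longrightarrow> v \<in> hedge_verts (D T \<eta>) \<Longrightarrow>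
        length (bin (num T \<eta> v)) \<le> poly q2 (theory_size sz T + sz \<eta>)"
      by metis
    \<comment> \<open>One polynomial for input length, structure size and index lengths; composing
      with \<open>?s\<close> turns bounds in the size of the instance into bounds in its
      length.\<close>
    define u where "u = [:0, 1:] + pcompose q1 ?s + pcompose q2 ?s"
    obtain k where k: "\<And>N. N \<ge> 2 \<Longrightarrow> poly (smult 64 (u ^ 3)) N \<le> N ^ k"
      using poly_le_power by blast
    \<comment> \<open>Preprocessing plus two steps per clock cell, so 16 * k + 4 = (16 * k + 2) +
      2.\<close>
    define t where "t = [:16, 3:] + monom (16 * k + 4) k"
    have "decides_in_time (ntm_of 8 5 (machine k False)) (MP_binary sat C D enc num) (poly t)"
    proof (rule machine_decides[where U = "poly u"])
      show "N \<le> poly u N" for N by (simp add: u_def)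
      fix \<alpha>s :: "'s list" and \<eta> n assume inst: "distinct \<alpha>s" "\<eta> \<in> C"
      show "hypergraph_size sz (D (set \<alpha>s) \<eta>) \<le> poly u (?len \<alpha>s \<eta> n)"
        using q1[of "set \<alpha>s" \<eta>] poly_size[OF inst(1), of q1 \<eta> n] inst by (simp add: u_def)
      show "length (bin (num (set \<alpha>s) \<eta> v)) \<le> poly u (?len \<alpha>s \<eta> n)" if "v \<in> hedge_verts (D (set \<alpha>s) \<eta>)" for v
        using q2[of "set \<alpha>s" \<eta> v] poly_size[OF inst(1), of q2 \<eta> n] inst that by (simp add: u_def)
    next
      fix ts es ns w :: "nat list"
      assume w: "set ts \<subseteq> {1, 2, 3}" "set es \<subseteq> {1, 2}" "set ns \<subseteq> {1, 2}" "w = ts @ [4] @ es @ [4] @ ns"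
      have "64 * poly u (length w) ^ 3 \<le> length w ^ k"
        using k[OF ge2[OF w(4)]] by (simp add: poly_power)
      moreover have "3 * length w + (16 * k + 2) * length w ^ k + 16 + 2 * length w ^ k \<le> poly t (length w)"
        by (simp add: t_def poly_monom algebra_simps)
      ultimately show "\<exists>Z Y c r. 64 * poly u (length w) ^ 3 \<le> c \<and> r + 2 * c \<le> poly t (length w) \<and>
        drun_le (table1 k False) r
        (Z0, tps (input_tape w) (input_tape []) (input_tape []) (input_tape [])
          (input_tape []) (input_tape []) (input_tape []) (input_tape []))
        (S0, tps (tp [5] w) (tp [5] []) (tp [5] []) (tp [5] es) (tp [5] ns) (clock 0 c) Z Y)"
        using preprocessing_poly[OF w, of k] by blast
    qed (use assms enc D in auto)
    with ntm show "MP_binary sat C D enc num \<in> NP" unfolding NP_def by blast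
  next
    assume "exponential_deriver sat sz C D" "exponential_indices sz C D num"
    then have D: "deriver sat C D" and
      "\<exists>q. \<forall>T \<eta>. finite T \<and> \<eta> \<in> C \<longrightarrow> hypergraph_size sz (D T \<eta>) \<le> 2 ^ poly q (theory_size sz T + sz \<eta>)"
      "\<exists>q. \<forall>T \<eta>. finite T \<and> \<eta> \<in> C \<longrightarrow> (\<forall>v\<in>hedge_verts (D T \<eta>).
        length (bin (num T \<eta> v)) \<le> 2 ^ poly q (theory_size sz T + sz \<eta>))"
      unfolding exponential_deriver_def exponential_indices_def indices_bounded_def by blast+
    then obtain q1 q2 where
      q1: "\<And>T \<eta>. finite T \<Longrightarrow> \<eta> \<in> C \<Longrightarrow> hypergraph_size sz (D T \<eta>) \<le> 2 ^ poly q1 (theory_size sz T + sz \<eta>)"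
      and q2: "\<And>T \<eta> v. finite T \<Longrightarrow> \<eta> \<in> C \<Longrightarrow> v \<in> hedge_verts (D T \<eta>) \<Longrightarrow>
        length (bin (num T \<eta> v)) \<le> 2 ^ poly q2 (theory_size sz T + sz \<eta>)"
      by metis
    define u where "u = [:0, 1:] + pcompose q1 ?s + pcompose q2 ?s"
    have pow_le: "2 ^ poly q (theory_size sz (set \<alpha>s) + sz \<eta>) \<le> (2::nat) ^ poly u (?len \<alpha>s \<eta> n)"
      if "distinct \<alpha>s" "q = q1 \<or> q = q2" for q \<alpha>s \<eta> n
    proof (rule power_increasing)
      show "poly q (theory_size sz (set \<alpha>s) + sz \<eta>) \<le> poly u (?len \<alpha>s \<eta> n)"
        using poly_size[OF that(1), of q \<eta> n] that(2) by (auto simp: u_def)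
    qed simp
    \<comment> \<open>The exponent of 64 * (2 ^ u) ^ 3 = 2 ^ (6 + 3 * u) has to stay below N ^
      k.\<close>
    obtain k where k: "\<And>N. N \<ge> 2 \<Longrightarrow> poly ([:6:] + smult 3 u) N \<le> N ^ k"
      using poly_le_power by blast
    define t where "t = [:22, 3:] + monom (16 * k + 2) k"
    have "decides_in_time (ntm_of 8 5 (machine k True)) (MP_binary sat C D enc num) (\<lambda>N. 2 ^ poly t N)"
    proof (rule machine_decides[where U = "\<lambda>N. 2 ^ poly u N"])
      show "N \<le> 2 ^ poly u N" for N
      proof -
        have "N \<le> poly u N" by (simp add: u_def)
        also have "\<dots> \<le> 2 ^ poly u N" by (rule less_imp_le[OF less_exp])
        finally show ?thesis .
      qed
      fix \<alpha>s :: "'s list" and \<eta> n assume inst: "distinct \<alpha>s" "\<eta> \<in> C"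
      show "hypergraph_size sz (D (set \<alpha>s) \<eta>) \<le> 2 ^ poly u (?len \<alpha>s \<eta> n)"
        using le_trans[OF q1[of "set \<alpha>s" \<eta>] pow_le[OF inst(1), of q1 \<eta> n]] inst by simp
      show "length (bin (num (set \<alpha>s) \<eta> v)) \<le> 2 ^ poly u (?len \<alpha>s \<eta> n)" if "v \<in> hedge_verts (D (set \<alpha>s) \<eta>)" for v
        using le_trans[OF q2[of "set \<alpha>s" \<eta> v] pow_le[OF inst(1), of q2 \<eta> n]] inst that by simp
    next
      fix ts es ns w :: "nat list"
      assume w: "set ts \<subseteq> {1, 2, 3}" "set es \<subseteq> {1, 2}" "set ns \<subseteq> {1, 2}" "w = ts @ [4] @ es @ [4] @ ns"
      let ?N = "length w"
      obtain Z Y c where c: "2 ^ ?N ^ k \<le> c" "c \<le> 2 * 4 ^ ?N ^ k"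
        and run: "drun_le (table1 k True) (3 * ?N + 16 * k * ?N ^ k + 24 * 4 ^ ?N ^ k + 17)
        (Z0, tps (input_tape w) (input_tape []) (input_tape []) (input_tape [])
          (input_tape []) (input_tape []) (input_tape []) (input_tape []))
        (S0, tps (tp [5] w) (tp [5] []) (tp [5] []) (tp [5] es) (tp [5] ns) (clock 0 c) Z Y)"
        using preprocessing_exp[OF w, of k] by blast
      have "64 * (2 ^ poly u ?N) ^ 3 = (2::nat) ^ (6 + 3 * poly u ?N)"
        by (simp add: power_add power_mult[symmetric] mult.commute)
      also have "\<dots> \<le> 2 ^ ?N ^ k"
        using k[OF ge2[OF w(4)]] by (intro power_increasing) simp_all
      also note c(1)
      finally have 1: "64 * (2 ^ poly u ?N) ^ 3 \<le> c" .
      let ?a = "3 * ?N + 16 * k * ?N ^ k + 17" and ?b = "2 * ?N ^ k + 5"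
      \<comment> \<open>28 = 24 + 2 * 2 by the upper bound on \<open>c\<close>; rounding up to 32 =
        2 ^ 5 explains the 5 in \<open>?b\<close>.\<close>
      have "3 * ?N + 16 * k * ?N ^ k + 24 * 4 ^ ?N ^ k + 17 + 2 * c \<le> ?a + 28 * 4 ^ ?N ^ k"
        using c(2) by simp
      also have "28 * 4 ^ ?N ^ k \<le> (2::nat) ^ ?b"
        by (simp add: power_add power_mult)
      also have "?a + 2 ^ ?b \<le> (?a + 1) * 2 ^ ?b" by (rule add_le_Suc_mult) simp
      also have "\<dots> \<le> 2 ^ ?a * 2 ^ ?b"
        by (intro mult_le_mono1) (unfold Suc_eq_plus1[symmetric], rule Suc_leI, rule less_exp)
      also have "\<dots> = 2 ^ (?a + ?b)" by (rule power_add[symmetric])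
      also have "?a + ?b = poly t ?N" by (simp add: t_def poly_monom algebra_simps)
      finally have "3 * ?N + 16 * k * ?N ^ k + 24 * 4 ^ ?N ^ k + 17 + 2 * c \<le> 2 ^ poly t ?N" by simp
      with 1 run show "\<exists>Z Y c r. 64 * (2 ^ poly u ?N) ^ 3 \<le> c \<and> r + 2 * c \<le> 2 ^ poly t ?N \<and>
        drun_le (table1 k True) r
        (Z0, tps (input_tape w) (input_tape []) (input_tape []) (input_tape [])
          (input_tape []) (input_tape []) (input_tape []) (input_tape []))
        (S0, tps (tp [5] w) (tp [5] []) (tp [5] []) (tp [5] es) (tp [5] ns) (clock 0 c) Z Y)"
        by blast
    qed (use assms enc D in auto)
    with ntm show "MP_binary sat C D enc num \<in> NExpTime" unfolding NExpTime_def by blast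
  }
qed

end
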